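(* Let $G$ be a finite simple graph on the vertex set $[n]$. For every $k\ge1$, the graded Betti numbers of $I_c(G)^k\subset S=K[x_1,\dots,x_n]$ do not depend on the ground field $K$; that is, for all $k\ge1$ and all $i,j\geq 0$, the number $\beta_{i,j}(I_c(G)^k)=\dim_K \mathrm{Tor}_i^S(K,I_c(G)^k)_j$ is the same for every field $K$.
   Context: $[n]=\{1,\dots,n\}$; $G$ has edge set $E(G)$ and may have isolated vertices. The complementary edge ideal of $G$ over a field $K$ is $I_c(G)=\big((x_1\cdots x_n)/(x_ix_j) : \{i,j\}\in E(G)\big)\subset S=K[x_1,\dots,x_n]$, where $S$ is standard graded. *)

theory Defs
  imports Complex_Main "HOL-Library.Poly_Mapping"
begin

section \<open>The polynomial ring\<close>

text \<open>
  The vertices, and hence the variables, are indexed by a finite type \<open>'n\<close>, so that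
  \<open>n = CARD('n)\<close> and \<open>('n, 'k) mpoly\<close> is the ring \<open>S = K[x\<^sub>1, \<dots>, x\<^sub>n]\<close>:
  a polynomial maps exponent vectors to coefficients, and the product is convolution.
\<close>

type_synonym ('n, 'k) mpoly = "('n \<Rightarrow>\<^sub>0 nat) \<Rightarrow>\<^sub>0 'k"

definition var :: "'n \<Rightarrow> ('n, 'k::comm_ring_1) mpoly" where
  "var v = Poly_Mapping.single (Poly_Mapping.single v 1) 1"

definition const :: "'k::comm_ring_1 \<Rightarrow> ('n, 'k) mpoly" where
  "const c = Poly_Mapping.single 0 c"

definition mdeg :: "('n::finite \<Rightarrow>\<^sub>0 nat) \<Rightarrow> nat" where
  "mdeg m = (\<Sum>v\<in>UNIV. Poly_Mapping.lookup m v)"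

text \<open>The graded piece \<open>S\<^sub>d\<close>, which is \<open>{0}\<close> for negative \<open>d\<close>.\<close>

definition hom_poly :: "int \<Rightarrow> ('n::finite, 'k::comm_ring_1) mpoly set" where
  "hom_poly d = {f. \<forall>m\<in>Poly_Mapping.keys f. int (mdeg m) = d}"


section \<open>Complementary edge ideals and their powers\<close>

definition simple_graph :: "'n set set \<Rightarrow> bool" where
  "simple_graph E \<longleftrightarrow> (\<forall>e\<in>E. card e = 2)"

abbreviation ideal_gen :: "'a::comm_ring_1 set \<Rightarrow> 'a set" where
  "ideal_gen \<equiv> module.span (*)"

text \<open>
  For an edge \<open>e = {i, j}\<close>, the monomial \<open>(x\<^sub>1\<cdots>x\<^sub>n)/(x\<^sub>ix\<^sub>j)\<close> is the product of the variables
  outside \<open>e\<close>.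
\<close>

definition comp_edge_ideal :: "'n::finite set set \<Rightarrow> ('n, 'k::field) mpoly set" where
  "comp_edge_ideal E = ideal_gen ((\<lambda>e. \<Prod>v\<in>UNIV - e. var v) ` E)"

definition ideal_mult :: "'a::comm_ring_1 set \<Rightarrow> 'a set \<Rightarrow> 'a set" where
  "ideal_mult I J = ideal_gen {f * g | f g. f \<in> I \<and> g \<in> J}"

primrec ideal_power :: "'a::comm_ring_1 set \<Rightarrow> nat \<Rightarrow> 'a set" where
  "ideal_power I 0 = UNIV"
| "ideal_power I (Suc k) = ideal_mult I (ideal_power I k)"


section \<open>Graded free resolutions and Tor\<close>

text \<open>
  A graded \<open>S\<close>-module is given by its scalar multiplication \<open>sc\<close> and its family of graded
  pieces \<open>M :: int \<Rightarrow> 'm set\<close>.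

  A sequence of graded free \<open>S\<close>-modules of finite rank is given in terms of bases:
  \<open>F\<^sub>i = \<Oplus>\<^bsub>b < rk F i\<^esub> S(- shift F i b)\<close>, and \<open>diff F i\<close> is the matrix of
  \<open>F\<^sub>i \<rightarrow> F\<^bsub>i-1\<^esub>\<close> for \<open>i \<ge> 1\<close>: row \<open>a < rk F (i - 1)\<close>, column \<open>b < rk F i\<close>.
\<close>

record (overloaded) ('n, 'k) free_seq =
  rk :: "nat \<Rightarrow> nat"
  shift :: "nat \<Rightarrow> nat \<Rightarrow> int"
  diff :: "nat \<Rightarrow> nat \<Rightarrow> nat \<Rightarrow> ('n, 'k) mpoly"

text \<open>
  Since \<open>S(-d) \<otimes> M = M(-d)\<close>, the degree \<open>j\<close> part of \<open>F\<^sub>i \<otimes>\<^sub>S M\<close> consists of the tuples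
  whose entry at \<open>b\<close> lies in \<open>M\<^bsub>j - shift F i b\<^esub>\<close>; tuples are finitely supported
  functions. The module \<open>F\<^sub>i\<close> itself is the case \<open>M = S\<close>.
\<close>

definition strand ::
  "('n, 'k::field) free_seq \<Rightarrow> (int \<Rightarrow> 'm::ab_group_add set) \<Rightarrow> nat \<Rightarrow> int \<Rightarrow> (nat \<Rightarrow>\<^sub>0 'm) set" where
  "strand F M i j = {u. Poly_Mapping.keys u \<subseteq> {..<rk F i} \<and>
     (\<forall>b<rk F i. Poly_Mapping.lookup u b \<in> M (j - shift F i b))}"

text \<open>The map \<open>F\<^sub>i \<otimes>\<^sub>S M \<rightarrow> F\<^bsub>i-1\<^esub> \<otimes>\<^sub>S M\<close>, where \<open>F\<^bsub>-1\<^esub> = 0\<close>.\<close>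

primrec bdry ::
  "('n, 'k::field) free_seq \<Rightarrow> (('n, 'k) mpoly \<Rightarrow> 'm::ab_group_add \<Rightarrow> 'm) \<Rightarrow> nat \<Rightarrow>
    (nat \<Rightarrow>\<^sub>0 'm) \<Rightarrow> (nat \<Rightarrow>\<^sub>0 'm)" where
  "bdry F sc 0 u = 0"
| "bdry F sc (Suc i) u = (\<Sum>a<rk F i. Poly_Mapping.single a
     (\<Sum>b<rk F (Suc i). sc (diff F (Suc i) a b) (Poly_Mapping.lookup u b)))"

text \<open>
  \<open>F\<close> is a graded free resolution of the graded module \<open>(sc, N)\<close>. The augmentation
  \<open>F\<^sub>0 \<rightarrow> N\<close> sends the \<open>b\<close>-th basis element to \<open>g b\<close>. All maps are homogeneous of degree 0,
  so exactness is stated degree by degree.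
\<close>

definition graded_free_resolution ::
  "('n::finite, 'k::field) free_seq \<Rightarrow> (('n, 'k) mpoly \<Rightarrow> 'q::ab_group_add \<Rightarrow> 'q) \<Rightarrow>
    (int \<Rightarrow> 'q set) \<Rightarrow> bool" where
  "graded_free_resolution F sc N \<longleftrightarrow>
     (\<forall>i. \<forall>a<rk F i. \<forall>b<rk F (Suc i).
        diff F (Suc i) a b \<in> hom_poly (shift F (Suc i) b - shift F i a)) \<and>
     (\<forall>i j. {u \<in> strand F hom_poly (Suc i) j. bdry F (*) (Suc i) u = 0} =
        bdry F (*) (Suc (Suc i)) ` strand F hom_poly (Suc (Suc i)) j) \<and>
     (\<exists>g. let aug = (\<lambda>u. \<Sum>b<rk F 0. sc (Poly_Mapping.lookup u b) (g b)) in
        (\<forall>b<rk F 0. g b \<in> N (shift F 0 b)) \<and>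
        (\<forall>j. aug ` strand F hom_poly 0 j = N j) \<and>
        (\<forall>j. {u \<in> strand F hom_poly 0 j. aug u = 0} =
           bdry F (*) (Suc 0) ` strand F hom_poly (Suc 0) j))"

text \<open>
  The dimension over \<open>K\<close> of \<open>H\<^sub>i(F \<otimes>\<^sub>S M)\<^sub>j\<close>, that is, of cycles modulo boundaries. The
  difference is the dimension of the quotient because all spaces involved are
  finite-dimensional when \<open>M\<close> has finite-dimensional graded pieces.
\<close>

definition homology_dim ::
  "('n, 'k::field) free_seq \<Rightarrow> (('n, 'k) mpoly \<Rightarrow> 'm::ab_group_add \<Rightarrow> 'm) \<Rightarrow>
    (int \<Rightarrow> 'm set) \<Rightarrow> nat \<Rightarrow> int \<Rightarrow> nat" where
  "homology_dim F sc M i j =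
     (let dimK = vector_space.dim (\<lambda>c. Poly_Mapping.map (sc (const c))) in
        dimK {u \<in> strand F M i j. bdry F sc i u = 0} -
        dimK (bdry F sc (Suc i) ` strand F M (Suc i) j))"

text \<open>
  \<open>dim\<^sub>K Tor\<^sub>i\<^sup>S(N, M)\<^sub>j\<close>, computed from a graded free resolution of the first argument;
  any choice of resolution gives the same number.
\<close>

definition tor_dim ::
  "(('n::finite, 'k::field) mpoly \<Rightarrow> 'q::ab_group_add \<Rightarrow> 'q) \<Rightarrow> (int \<Rightarrow> 'q set) \<Rightarrow>
    (('n, 'k) mpoly \<Rightarrow> 'm::ab_group_add \<Rightarrow> 'm) \<Rightarrow> (int \<Rightarrow> 'm set) \<Rightarrow> nat \<Rightarrow> int \<Rightarrow> nat" where
  "tor_dim scN N scM M i j =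
     homology_dim (SOME F. graded_free_resolution F scN N) scM M i j"


section \<open>Graded Betti numbers\<close>

text \<open>The residue field \<open>K = S/(x\<^sub>1, \<dots>, x\<^sub>n)\<close>, concentrated in degree 0.\<close>

definition residue_scale :: "('n, 'k::field) mpoly \<Rightarrow> 'k \<Rightarrow> 'k" where
  "residue_scale f c = Poly_Mapping.lookup f 0 * c"

definition residue_piece :: "int \<Rightarrow> 'k::field set" where
  "residue_piece d = (if d = 0 then UNIV else {0})"

text \<open>\<open>\<beta>\<^bsub>i,j\<^esub>(I) = dim\<^sub>K Tor\<^sub>i\<^sup>S(K, I)\<^sub>j\<close> for a homogeneous ideal \<open>I\<close> of \<open>S\<close>.\<close>

definition graded_betti :: "('n::finite, 'k::field) mpoly set \<Rightarrow> nat \<Rightarrow> nat \<Rightarrow> nat" where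
  "graded_betti I i j =
     tor_dim residue_scale residue_piece (*) (\<lambda>d. I \<inter> hom_poly d) i (int j)"

end

theory Submission
  imports Defs "HOL-Library.Function_Algebras"
begin

text \<open>
  The graded Betti numbers of an ideal \<open>I\<close> are the dimensions of the homology of \<open>F \<otimes> I\<close> for any graded
  free resolution \<open>F\<close> of the residue field (\<open>homology_dim_le\<close>), so \<open>F\<close> may be taken to be the Koszul
  complex (\<open>koszul_resolves\<close>). If \<open>I\<close> is a monomial ideal, this complex has a basis of cells
  \<open>x\<^sup>m e\<^sub>\<sigma>\<close> with \<open>x\<^sup>m \<in> I\<close>, and its boundary matrices have entries \<open>0\<close>, \<open>1\<close> and \<open>-1\<close>, the same over every field.
  Its homology depends on the field only through torsion. There is no such dependence if every cycle over
  the field is a combination of integral cycles (\<open>cycles_lift\<close>, \<open>dim_cycles_rat\<close>), and this is what is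
  proved for \<open>I\<^sub>c(G)\<^sup>k\<close>.

  The ideal \<open>I\<^sub>c(G)\<^sup>k\<close> contains the monomial \<open>x\<^sup>m\<close> if and only if \<open>m \<ge> (k, \<dots>, k) - d\<close> for the degree
  vector \<open>d\<close> of a multiset of \<open>k\<close> edges. Suppose first that the number of edges in each connected component
  is prescribed. Order the vertices of each component such that every vertex but the first has an earlier
  neighbour, and compare degree vectors at the last vertex where they differ. An alternating walk between
  two edge multisets shows that the larger vector can be lowered there in favour of an earlier vertex
  (\<open>exchange_down\<close>). So these monomials have linear quotients (\<open>cover_linear_quotients\<close>), over any ring
  their homology is confined to the linear strand, and each cycle in that strand is a combination of integral
  ones (\<open>linear_quotients_cycles_lift\<close>).

  In general the edges can be distributed over the components in several ways, and the homology is no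
  longer linear. The distributions are added one after the other, in increasing order of the number of edges
  in one component \<open>j\<close>. The intersection of a new piece with the previous ones has an edge to spare in \<open>j\<close>
  when it is seen in the new piece, and an edge to spare outside \<open>j\<close> when it is seen in the previous ones. A spare
  edge at a vertex \<open>v\<close> permits division by \<open>x\<^sub>v\<close>, so that the intersection is contracted by a cone in
  both pieces, already over the integers. The Mayer--Vietoris sequence therefore splits and integral
  cycles suffice for the union as well (\<open>cycles_lift_union\<close>, \<open>cover_cycles_lift\<close>).
\<close>

abbreviation (input) "lookup \<equiv> Poly_Mapping.lookup"
abbreviation (input) "single \<equiv> Poly_Mapping.single"
abbreviation (input) "keys \<equiv> Poly_Mapping.keys"

section \<open>Dimensions of quotients and of integral families\<close>

lemma (in vector_space) card_independent_le_dim: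
  assumes "independent B" "B \<subseteq> W" "W \<subseteq> span T" "finite T"
  shows "finite B" and "card B \<le> dim W"
proof -
  obtain C where C: "B \<subseteq> C" "C \<subseteq> W" "independent C" "W \<subseteq> span C"
    using maximal_independent_subset_extend[OF assms(2,1)] by blast
  have "finite C"
    using independent_span_bound[OF assms(4) C(3)] C(2) assms(3) by auto
  moreover have "card C = dim W" using basis_card_eq_dim C by blast
  ultimately show "finite B" "card B \<le> dim W"
    using C(1) finite_subset card_mono by metis+
qed

lemma (in vector_space) dim_le_dim:
  assumes "V \<subseteq> W" "W \<subseteq> span T" "finite T"
  shows "dim V \<le> dim W"
proof -
  obtain B where B: "B \<subseteq> V" "independent B" "V \<subseteq> span B" "card B = dim V"
    using basis_exists by blast
  then show ?thesis using card_independent_le_dim(2)[of B W T] assms by auto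
qed

text \<open>
  The last premise says that the family \<open>g\<close> on \<open>D\<close> is independent modulo \<open>B\<close>, so that it extends a basis of \<open>B\<close>.
\<close>

lemma (in vector_space) dim_plus_card_le:
  assumes B: "subspace B" "B \<subseteq> W" and W: "W \<subseteq> span T" "finite T"
    and D: "finite D" "g ` D \<subseteq> W"
    and mod: "\<And>c. (\<Sum>d\<in>D. scale (c d) (g d)) \<in> B \<Longrightarrow> \<forall>d\<in>D. c d = 0"
  shows "dim B + card D \<le> dim W"
proof -
  obtain C where C: "C \<subseteq> B" "independent C" "B \<subseteq> span C" "card C = dim B"
    using basis_exists by blast
  have finC: "finite C" using card_independent_le_dim(1)[OF C(2) _ W] C(1) B(2) by auto
  have spanC: "span C = B" using C B(1) span_subspace by blast
  have inj: "inj_on g D"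
  proof (rule inj_onI, rule ccontr)
    fix x y assume xy: "x \<in> D" "y \<in> D" "g x = g y" "x \<noteq> y"
    let ?c = "\<lambda>d. if d = x then 1 else if d = y then -1 else (0::'a)"
    have "(\<Sum>d\<in>D. scale (?c d) (g d)) = (\<Sum>d\<in>{x,y}. scale (?c d) (g d))"
      by (rule sum.mono_neutral_right) (use xy D in auto)
    also have "\<dots> = 0" using xy by simp
    finally have "(\<Sum>d\<in>D. scale (?c d) (g d)) \<in> B" by (simp only: subspace_0[OF B(1)])
    then have "\<forall>d\<in>D. ?c d = 0" by (rule mod)
    then have "?c x = 0" using xy(1) by blast
    then show False by simp
  qed
  have disj: "C \<inter> g ` D = {}"
  proof (rule ccontr)
    assume "C \<inter> g ` D \<noteq> {}"
    then obtain x where x: "x \<in> D" "g x \<in> B" using C by auto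
    let ?c = "\<lambda>d. if d = x then 1 else (0::'a)"
    have "(\<Sum>d\<in>D. scale (?c d) (g d)) = (\<Sum>d\<in>{x}. scale (?c d) (g d))"
      by (rule sum.mono_neutral_right) (use x D in auto)
    also have "\<dots> = g x" by simp
    finally have "(\<Sum>d\<in>D. scale (?c d) (g d)) \<in> B" by (simp only: x)
    then have "\<forall>d\<in>D. ?c d = 0" by (rule mod)
    then have "?c x = 0" using x(1) by blast
    then show False by simp
  qed
  have indep: "independent (C \<union> g ` D)"
  proof (rule independent_if_scalars_zero)
    show "finite (C \<union> g ` D)" using finC D by auto
    fix f x assume s: "(\<Sum>x\<in>C \<union> g ` D. scale (f x) x) = 0" and x: "x \<in> C \<union> g ` D"
    have s2: "(\<Sum>x\<in>C. scale (f x) x) + (\<Sum>d\<in>D. scale (f (g d)) (g d)) = 0"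
      using s sum.union_disjoint[OF finC finite_imageI[OF D(1)] disj, of "\<lambda>x. scale (f x) x"]
        sum.reindex[OF inj, of "\<lambda>x. scale (f x) x"] by (simp add: o_def)
    have inB: "(\<Sum>x\<in>C. scale (f x) x) \<in> B"
      by (intro subspace_sum B subspace_scale) (use C in auto)
    have "(\<Sum>d\<in>D. scale (f (g d)) (g d)) = - (\<Sum>x\<in>C. scale (f x) x)"
      using s2 by (simp add: add_eq_0_iff)
    then have "(\<Sum>d\<in>D. scale (f (g d)) (g d)) \<in> B" using inB subspace_neg[OF B(1)] by simp
    then have z: "\<forall>d\<in>D. f (g d) = 0" by (rule mod)
    then have "(\<Sum>x\<in>C. scale (f x) x) = 0" using s2 by simp
    then have "\<forall>x\<in>C. f x = 0" using independentD[OF C(2) finC] by blast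
    then show "f x = 0" using z x by auto
  qed
  have "card (C \<union> g ` D) \<le> dim W"
    by (rule card_independent_le_dim(2)[OF indep _ W]) (use C B D in auto)
  then show ?thesis
    using card_Un_disjoint[OF finC finite_imageI[OF D(1)] disj] card_image[OF inj] C(4) by simp
qed

lemma (in vector_space) obtain_complement_basis:
  assumes "B \<subseteq> Z" "subspace B" "Z \<subseteq> span T" "finite T"
  obtains D where "finite D" "D \<subseteq> Z" "dim B + card D = dim Z" "Z \<subseteq> span (B \<union> D)"
    "\<And>c. (\<Sum>d\<in>D. scale (c d) d) \<in> B \<Longrightarrow> \<forall>d\<in>D. c d = 0"
proof -
  obtain C where C: "C \<subseteq> B" "independent C" "B \<subseteq> span C" "card C = dim B"
    using basis_exists by blast
  obtain E where E: "C \<subseteq> E" "E \<subseteq> Z" "independent E" "Z \<subseteq> span E"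
    using maximal_independent_subset_extend[OF subset_trans[OF C(1) assms(1)] C(2)] by blast
  have finE: "finite E" using card_independent_le_dim(1)[OF E(3,2) assms(3,4)] .
  have finC: "finite C" using finE E(1) finite_subset by blast
  have cE: "card E = dim Z" using basis_card_eq_dim E by blast
  show thesis
  proof (rule that[of "E - C"])
    show "finite (E - C)" "E - C \<subseteq> Z" using finE E by auto
    show "dim B + card (E - C) = dim Z"
      using C(4) cE card_Diff_subset[OF finC E(1)] card_mono[OF finE E(1)] by simp
    have "E \<subseteq> B \<union> (E - C)" using C(1) by auto
    then show "Z \<subseteq> span (B \<union> (E - C))" using E(4) span_mono by blast
    fix c assume "(\<Sum>d\<in>E - C. scale (c d) d) \<in> B"
    then have "(\<Sum>d\<in>E - C. scale (c d) d) \<in> span C" using C(3) by auto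
    then obtain b where b: "(\<Sum>d\<in>E - C. scale (c d) d) = (\<Sum>d\<in>C. scale (b d) d)"
      using span_finite[OF finC] by auto
    let ?u = "\<lambda>d. if d \<in> C then - b d else c d"
    have "(\<Sum>d\<in>E. scale (?u d) d) = (\<Sum>d\<in>E - C. scale (?u d) d) + (\<Sum>d\<in>C. scale (?u d) d)"
      by (rule sum.subset_diff[OF E(1) finE])
    also have "(\<Sum>d\<in>E - C. scale (?u d) d) = (\<Sum>d\<in>E - C. scale (c d) d)"
      by (intro sum.cong) auto
    also have "(\<Sum>d\<in>C. scale (?u d) d) = - (\<Sum>d\<in>C. scale (b d) d)"
      by (simp add: sum_negf)
    finally have "(\<Sum>d\<in>E. scale (?u d) d) = 0" using b by simp
    then have "\<forall>d\<in>E. ?u d = 0" using independentD[OF E(3) finE subset_refl, of ?u] by blast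
    then show "\<forall>d\<in>E - C. c d = 0" by auto
  qed
qed

text \<open>
  The last premise says that \<open>f\<close> induces an injection \<open>Z/B \<rightarrow> Z'/B'\<close>; it keeps a basis of \<open>Z\<close> modulo \<open>B\<close>
  independent modulo \<open>B'\<close>.
\<close>

lemma dim_quotient_le:
  assumes "Vector_Spaces.linear s1 s2 f"
    and "module.subspace s1 B" "B \<subseteq> Z" "Z \<subseteq> module.span s1 T" "finite T"
    and "module.subspace s2 B'" "B' \<subseteq> Z'" "Z' \<subseteq> module.span s2 T'" "finite T'"
    and "f ` Z \<subseteq> Z'" and "module.subspace s1 Z"
    and "\<And>z. z \<in> Z \<Longrightarrow> f z \<in> B' \<Longrightarrow> z \<in> B"
  shows "vector_space.dim s1 Z - vector_space.dim s1 B
       \<le> vector_space.dim s2 Z' - vector_space.dim s2 B'"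
proof -
  interpret Vector_Spaces.linear s1 s2 f by fact
  obtain D where D: "finite D" "D \<subseteq> Z" "vs1.dim B + card D = vs1.dim Z"
    "Z \<subseteq> vs1.span (B \<union> D)" "\<And>c. (\<Sum>d\<in>D. s1 (c d) d) \<in> B \<Longrightarrow> \<forall>d\<in>D. c d = 0"
    by (rule vs1.obtain_complement_basis[OF assms(3,2,4,5)]) auto
  have "vs2.dim B' + card D \<le> vs2.dim Z'"
  proof (rule vs2.dim_plus_card_le[OF assms(6-9) D(1)])
    show "f ` D \<subseteq> Z'" using D(2) assms(10) by auto
    fix c assume "(\<Sum>d\<in>D. s2 (c d) (f d)) \<in> B'"
    moreover have "(\<Sum>d\<in>D. s2 (c d) (f d)) = f (\<Sum>d\<in>D. s1 (c d) d)"
      by (simp add: sum scale)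
    moreover have "(\<Sum>d\<in>D. s1 (c d) d) \<in> Z"
      using D(2) by (intro vs1.subspace_sum[OF assms(11)] vs1.subspace_scale[OF assms(11)]) auto
    ultimately have "(\<Sum>d\<in>D. s1 (c d) d) \<in> B" using assms(12) by simp
    then show "\<forall>d\<in>D. c d = 0" by (rule D(5))
  qed
  then show ?thesis using D(3) by linarith
qed

lemma rank_nullity:
  assumes "Vector_Spaces.linear s1 s2 f" "module.subspace s1 X" "X \<subseteq> module.span s1 T" "finite T"
  shows "vector_space.dim s1 {x\<in>X. f x = 0} + vector_space.dim s2 (f ` X) = vector_space.dim s1 X"
proof -
  interpret Vector_Spaces.linear s1 s2 f by fact
  let ?N = "{x\<in>X. f x = 0}"
  have N: "vs1.subspace ?N"
    using assms(2) by (auto simp: vs1.subspace_def add scale)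
  obtain D where D: "finite D" "D \<subseteq> X" "vs1.dim ?N + card D = vs1.dim X" "X \<subseteq> vs1.span (?N \<union> D)"
    "\<And>c. (\<Sum>d\<in>D. s1 (c d) d) \<in> ?N \<Longrightarrow> \<forall>d\<in>D. c d = 0"
    by (rule vs1.obtain_complement_basis[OF _ N assms(3,4)]) auto
  have sub: "f ` X \<subseteq> vs2.span (f ` D)"
  proof -
    have "f ` X \<subseteq> f ` vs1.span (?N \<union> D)" using D(4) by auto
    also have "\<dots> = vs2.span (f ` ?N \<union> f ` D)" by (simp only: span_image[symmetric] image_Un[symmetric])
    also have "\<dots> \<subseteq> vs2.span (insert 0 (f ` D))" by (rule vs2.span_mono) auto
    finally show ?thesis by simp
  qed
  have "vs2.dim (f ` X) \<le> card (f ` D)" using vs2.dim_le_card[OF sub] D(1) by auto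
  then have 1: "vs2.dim (f ` X) \<le> card D" using card_image_le[OF D(1)] le_trans by blast
  have "vs2.dim {0} + card D \<le> vs2.dim (f ` X)"
  proof (rule vs2.dim_plus_card_le[OF _ _ sub finite_imageI[OF D(1)] D(1)])
    show "{0} \<subseteq> f ` X" using vs1.subspace_0[OF assms(2)] zero by force
    show "f ` D \<subseteq> f ` X" using D(2) by auto
    fix c assume "(\<Sum>d\<in>D. s2 (c d) (f d)) \<in> {0}"
    then have "f (\<Sum>d\<in>D. s1 (c d) d) = 0" by (simp add: sum scale)
    moreover have "(\<Sum>d\<in>D. s1 (c d) d) \<in> X"
      using D(2) by (intro vs1.subspace_sum[OF assms(2)] vs1.subspace_scale[OF assms(2)]) auto
    ultimately show "\<forall>d\<in>D. c d = 0" using D(5) by auto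
  qed simp
  then show ?thesis using 1 D(3) by simp
qed

lemma dim_inj_image:
  assumes "Vector_Spaces.linear s1 s2 f" "module.subspace s1 X" "X \<subseteq> module.span s1 T" "finite T"
    and "\<And>x. x \<in> X \<Longrightarrow> f x = 0 \<Longrightarrow> x = 0"
  shows "vector_space.dim s2 (f ` X) = vector_space.dim s1 X"
proof -
  interpret Vector_Spaces.linear s1 s2 f by fact
  have "{x\<in>X. f x = 0} = {0}" using assms(5) vs1.subspace_0[OF assms(2)] zero by auto
  moreover have "vs1.dim {0} = 0"
    using vs1.dim_le_card[of "{0}" "{}"] by simp
  ultimately show ?thesis using rank_nullity[OF assms(1-4)] by simp
qed

definition fscale :: "'k::comm_ring_1 \<Rightarrow> ('c \<Rightarrow> 'k) \<Rightarrow> 'c \<Rightarrow> 'k" where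
  "fscale a f = (\<lambda>x. a * f x)"

lemma vector_space_fscale: "vector_space (fscale :: 'k::field \<Rightarrow> ('c \<Rightarrow> 'k) \<Rightarrow> _)"
  by unfold_locales (auto simp: fscale_def fun_eq_iff algebra_simps)

interpretation fs: vector_space "fscale :: 'k::field \<Rightarrow> ('c \<Rightarrow> 'k) \<Rightarrow> _"
  by (rule vector_space_fscale)

lemma sum_apply: "(\<Sum>x\<in>A. f x) y = (\<Sum>x\<in>A. f x y)"
  by (induction A rule: infinite_finite_induct) auto

text \<open>The image of an integral chain in the chains with other coefficients.\<close>

definition red :: "('c \<Rightarrow> int) \<Rightarrow> 'c \<Rightarrow> 'k::comm_ring_1" where
  "red w = (\<lambda>x. of_int (w x))"

lemma common_denominator:
  fixes q :: "'d \<Rightarrow> rat"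
  assumes "finite T"
  obtains N :: int and n :: "'d \<Rightarrow> int" where "N > 0" "\<And>t. t \<in> T \<Longrightarrow> of_int N * q t = of_int (n t)"
proof -
  have "\<exists>N::int. N > 0 \<and> (\<forall>t\<in>T. \<exists>z::int. of_int N * q t = of_int z)"
    using assms
  proof (induction T)
    case empty
    show ?case by (intro exI[of _ 1]) auto
  next
    case (insert x T)
    then obtain N :: int where N: "N > 0" "\<forall>t\<in>T. \<exists>z::int. of_int N * q t = of_int z" by blast
    obtain a b where ab: "b > 0" "q x = of_int a / of_int b"
      using quotient_of_denom_pos' quotient_of_div surjective_pairing by blast
    have "\<exists>z::int. of_int (b * N) * q t = of_int z" if tT: "t \<in> insert x T" for t
    proof (cases "t = x")
      case True
      then have "of_int (b * N) * q t = of_int (N * a)" using ab by simp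
      then show ?thesis by blast
    next
      case False
      then obtain z :: int where "of_int N * q t = of_int z" using N tT by auto
      then have "of_int (b * N) * q t = of_int (b * z)" by simp
      then show ?thesis by blast
    qed
    then show ?case using ab N by (intro exI[of _ "b * N"]) auto
  qed
  then obtain N :: int where N: "N > 0" "\<forall>t\<in>T. \<exists>z::int. of_int N * q t = of_int z" by blast
  from bchoice[OF N(2)] obtain n :: "'d \<Rightarrow> int"
    where "\<forall>t\<in>T. of_int N * q t = of_int (n t)" by blast
  with N(1) show ?thesis by (intro that) auto
qed

text \<open>
  A rational linear relation can be scaled to an integral one with coprime coefficients, and such a
  relation stays nontrivial in every field. So passing from a field to the rationals preserves the
  independence of integer vectors.
\<close>

lemma dim_span_red_le:
  fixes S :: "('c \<Rightarrow> int) set" and V :: "('c \<Rightarrow> rat) set"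
  assumes "red ` S \<subseteq> V" "V \<subseteq> fs.span W" "finite W" and "fs.span (red ` S :: ('c \<Rightarrow> 'k::field) set) \<subseteq> fs.span X" "finite X"
  shows "fs.dim (red ` S :: ('c \<Rightarrow> 'k::field) set) \<le> fs.dim V"
proof -
  obtain B where B: "B \<subseteq> (red ` S :: ('c \<Rightarrow> 'k) set)" "fs.independent B"
    "red ` S \<subseteq> fs.span B" "card B = fs.dim (red ` S :: ('c \<Rightarrow> 'k) set)"
    using fs.basis_exists by blast
  have finB: "finite B"
    using fs.card_independent_le_dim(1)[OF B(2) subset_refl _ assms(5)] B(1) assms(4)
      fs.span_superset by blast
  let ?red = "red :: ('c \<Rightarrow> int) \<Rightarrow> 'c \<Rightarrow> 'k"
  obtain T where T: "T \<subseteq> S" "inj_on ?red T" "B = ?red ` T"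
    using B(1) unfolding subset_image_inj by blast
  have finT: "finite T" using finB T finite_image_iff by blast
  have dimV: "fs.dim (insert 0 V) = fs.dim V"
    by (rule fs.span_eq_dim) simp
  have "fs.dim {0 :: 'c \<Rightarrow> rat} + card T \<le> fs.dim (insert 0 V)"
  proof (rule fs.dim_plus_card_le[where g = red])
    show "{0} \<subseteq> insert 0 V" "insert 0 V \<subseteq> fs.span W" using assms(2) fs.span_zero by auto
    show "red ` T \<subseteq> insert 0 V" using assms(1) T(1) by auto
    fix q :: "('c \<Rightarrow> int) \<Rightarrow> rat" assume "(\<Sum>t\<in>T. fscale (q t) (red t)) \<in> {0}"
    then have q: "(\<Sum>t\<in>T. q t * of_int (t x)) = 0" for x
      by (auto simp: fun_eq_iff sum_apply fscale_def red_def)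
    obtain N n where N: "N > 0" "\<And>t. t \<in> T \<Longrightarrow> of_int N * q t = (of_int (n t) :: rat)"
      using common_denominator[OF finT, of q] by blast
    have n: "(\<Sum>t\<in>T. n t * t x) = 0" for x
    proof -
      have "of_int (\<Sum>t\<in>T. n t * t x) = (\<Sum>t\<in>T. (of_int (n t) * of_int (t x) :: rat))" by simp
      also have "\<dots> = (\<Sum>t\<in>T. of_int N * (q t * of_int (t x)))"
        by (intro sum.cong) (simp_all add: N(2)[symmetric] mult.assoc)
      also have "\<dots> = 0" using q[of x] by (simp flip: sum_distrib_left)
      finally show ?thesis using of_int_eq_0_iff by blast
    qed
    \<comment> \<open>Otherwise the coefficients divided by their greatest common divisor are a relation over the field;
      its characteristic divides all of them, which contradicts coprimality.\<close>
    define g where "g = Gcd (n ` T)"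
    have "\<forall>t\<in>T. n t = 0"
    proof (rule ccontr)
      assume "\<not> (\<forall>t\<in>T. n t = 0)"
      then have g0: "g \<noteq> 0" unfolding g_def by auto
      have gp: "g > 0" using g0 unfolding g_def by (smt (verit) Gcd_int_greater_eq_0)
      define p where "p t = n t div g" for t
      have p: "n t = g * p t" if "t \<in> T" for t
        using that unfolding p_def g_def by simp
      have "g * (\<Sum>t\<in>T. p t * t x) = 0" for x
        using n[of x] by (simp add: sum_distrib_left p mult.assoc)
      then have p0: "(\<Sum>t\<in>T. p t * t x) = 0" for x using g0 by auto
      have pk: "(\<Sum>t\<in>T. fscale (of_int (p t) :: 'k) (red t)) = 0"
      proof
        fix x
        have "(\<Sum>t\<in>T. fscale (of_int (p t) :: 'k) (red t)) x = of_int (\<Sum>t\<in>T. p t * t x)"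
          by (simp add: sum_apply fscale_def red_def)
        then show "(\<Sum>t\<in>T. fscale (of_int (p t) :: 'k) (red t)) x = 0 x" using p0 by simp
      qed
      let ?inv = "the_inv_into T ?red"
      have "(\<Sum>b\<in>B. fscale (of_int (p (?inv b)) :: 'k) b) = 0"
        using pk unfolding T(3) by (simp add: sum.reindex[OF T(2)] the_inv_into_f_f[OF T(2)])
      then have "\<forall>b\<in>B. (of_int (p (?inv b)) :: 'k) = 0"
        using fs.independentD[OF B(2) finB subset_refl, of "\<lambda>b. of_int (p (?inv b))"] by blast
      then have pz: "(of_int (p t) :: 'k) = 0" if "t \<in> T" for t
        using that unfolding T(3) by (simp add: the_inv_into_f_f[OF T(2)])
      have "Gcd (p ` T) = 1"
      proof -
        have "n ` T = (*) g ` p ` T" using p by (auto simp: image_iff)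
        then have "g = g * Gcd (p ` T)"
          unfolding g_def using Gcd_mult[of g "p ` T"] gp by (simp add: normalize_mult g_def)
        then show ?thesis using g0 by simp
      qed
      moreover have "int CHAR('k) dvd Gcd (p ` T)"
        by (rule Gcd_greatest) (use pz of_int_eq_0_iff_char_dvd in blast)
      ultimately show False using CHAR_not_1 by simp
    qed
    then show "\<forall>t\<in>T. q t = 0" using N(1) N(2) by fastforce
  qed (use assms finT in auto)
  moreover have "card T = card B" using T card_image by metis
  ultimately show ?thesis using B(4) dimV by simp
qed

section \<open>Linear maps between finite free modules\<close>

definition smul :: "'a::comm_ring_1 \<Rightarrow> ('b \<Rightarrow>\<^sub>0 'a) \<Rightarrow> ('b \<Rightarrow>\<^sub>0 'a)" where
  "smul c u = Poly_Mapping.map ((*) c) u"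

lemma lookup_smul [simp]: "lookup (smul c u) a = c * lookup u a"
  unfolding smul_def by (simp add: Poly_Mapping.map.rep_eq when_def)

lemma smul_simps:
  "smul c (u + w) = smul c u + smul c w" "smul (c + d) u = smul c u + smul d u"
  "smul c (smul d u) = smul (c * d) u" "smul 1 u = u" "smul 0 u = 0" "smul c 0 = 0"
  by (auto intro!: poly_mapping_eqI simp: lookup_add algebra_simps)

lemma smul_diff: "smul c (u - w) = smul c u - smul c w"
  by (rule poly_mapping_eqI) (simp add: lookup_minus right_diff_distrib)

definition slin :: "(('b \<Rightarrow>\<^sub>0 'a::comm_ring_1) \<Rightarrow> ('c \<Rightarrow>\<^sub>0 'a)) \<Rightarrow> bool" where
  "slin f \<longleftrightarrow> (\<forall>u w. f (u + w) = f u + f w) \<and> (\<forall>c u. f (smul c u) = smul c (f u))"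

lemma slin_add: "slin f \<Longrightarrow> f (u + w) = f u + f w"
  and slin_smul: "slin f \<Longrightarrow> f (smul c u) = smul c (f u)"
  by (auto simp: slin_def)

lemma slin_zero: "slin f \<Longrightarrow> f 0 = 0"
  using slin_smul[of f 0 0] by (simp add: smul_simps)

lemma slin_minus: "slin f \<Longrightarrow> f (u - w) = f u - f w"
  using slin_add[of f "u - w" w] by simp

lemma slin_sum: "slin f \<Longrightarrow> f (\<Sum>x\<in>A. g x) = (\<Sum>x\<in>A. f (g x))"
  by (induction A rule: infinite_finite_induct) (auto simp: slin_zero slin_add)

definition lin :: "nat \<Rightarrow> (nat \<Rightarrow> 'b \<Rightarrow>\<^sub>0 'a::comm_ring_1) \<Rightarrow> (nat \<Rightarrow>\<^sub>0 'a) \<Rightarrow> ('b \<Rightarrow>\<^sub>0 'a)" where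
  "lin r p u = (\<Sum>b<r. smul (lookup u b) (p b))"

lemma lookup_lin:
  "lookup (lin r p u) a = (\<Sum>b<r. lookup u b * lookup (p b) a)"
  by (simp add: lin_def lookup_sum)

lemma slin_lin: "slin (lin r p)"
  unfolding slin_def
  by (auto intro!: poly_mapping_eqI
      simp: lookup_lin lookup_add algebra_simps sum.distrib sum_distrib_left)

lemma lin_cong: "(\<And>b. b < r \<Longrightarrow> p b = q b) \<Longrightarrow> lin r p u = lin r q u"
  by (simp add: lin_def)

lemma slin_lin_comp: "slin f \<Longrightarrow> f (lin r p u) = lin r (\<lambda>b. f (p b)) u"
  by (simp add: lin_def slin_sum slin_smul)

lemma lin_diff_fun: "lin r (\<lambda>b. p b - q b) u = lin r p u - lin r q u"
  by (rule poly_mapping_eqI) (simp add: lookup_lin lookup_minus right_diff_distrib sum_subtractf)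

abbreviation unit :: "nat \<Rightarrow> (nat \<Rightarrow>\<^sub>0 'a::comm_ring_1)" where
  "unit b \<equiv> single b 1"

lemma lin_unit_self:
  assumes "keys u \<subseteq> {..<r}"
  shows "lin r unit u = u"
proof (rule poly_mapping_eqI)
  fix a
  have "(\<Sum>b<r. lookup u b * lookup (unit b) a)
      = (\<Sum>b<r. if b = a then lookup u a else 0)"
    by (intro sum.cong) (auto simp: lookup_single when_def)
  also have "\<dots> = lookup u a"
    using assms by (auto simp: sum.delta in_keys_iff subset_iff)
  finally show "lookup (lin r unit u) a = lookup u a"
    by (simp add: lookup_lin)
qed

lemma slin_expand:
  assumes "slin f" "keys u \<subseteq> {..<r}"
  shows "f u = lin r (\<lambda>b. f (unit b)) u"
  using slin_lin_comp[OF assms(1), of r unit u] lin_unit_self[OF assms(2)] by simp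

lemma lookup_bdry:
  fixes u :: "nat \<Rightarrow>\<^sub>0 ('n, 'k::field) mpoly"
  shows "lookup (bdry F (*) (Suc i) u) a =
    (if a < rk F i then \<Sum>b<rk F (Suc i). diff F (Suc i) a b * lookup u b else 0)"
  by (simp add: lookup_sum lookup_single when_def)

lemma slin_bdry: "slin (bdry F (*) i :: _ \<Rightarrow> nat \<Rightarrow>\<^sub>0 ('n, 'k::field) mpoly)"
proof (cases i)
  case 0
  then show ?thesis by (simp add: slin_def smul_simps)
next
  case (Suc i')
  show ?thesis unfolding Suc slin_def
    by (auto intro!: poly_mapping_eqI simp del: bdry.simps
        simp: lookup_bdry lookup_add algebra_simps sum.distrib sum_distrib_left)
qed

lemma bdry_expand:
  fixes u :: "nat \<Rightarrow>\<^sub>0 ('n, 'k::field) mpoly"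
  shows "bdry F (*) (Suc i) u = lin (rk F (Suc i)) (\<lambda>b. bdry F (*) (Suc i) (unit b)) u"
  by (rule poly_mapping_eqI) (simp del: bdry.simps
      add: lookup_bdry lookup_lin lookup_single when_def mult.commute if_distrib[of "\<lambda>x. _ * x"] cong: if_cong)

section \<open>Degrees\<close>

lemma mdeg_add: "mdeg (m + m') = mdeg m + mdeg m'"
  by (simp add: mdeg_def lookup_add sum.distrib)

lemma hom_poly_zero [simp]: "0 \<in> hom_poly d"
  by (simp add: hom_poly_def)

lemma hom_poly_add: "f \<in> hom_poly d \<Longrightarrow> g \<in> hom_poly d \<Longrightarrow> f + g \<in> hom_poly d"
  using keys_add[of f g] by (auto simp: hom_poly_def)

lemma hom_poly_mult: "f \<in> hom_poly d \<Longrightarrow> g \<in> hom_poly e \<Longrightarrow> f * g \<in> hom_poly (d + e)"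
  using keys_mult[of f g] by (fastforce simp: hom_poly_def mdeg_add)

lemma hom_poly_const: "const c \<in> hom_poly 0"
  by (auto simp: hom_poly_def const_def mdeg_def)

lemma hom_poly_one: "1 \<in> hom_poly 0"
  using hom_poly_const[of 1] by (simp add: const_def)

lemma hom_poly_sum: "(\<And>x. x \<in> A \<Longrightarrow> f x \<in> hom_poly d) \<Longrightarrow> (\<Sum>x\<in>A. f x) \<in> hom_poly d"
  by (induction A rule: infinite_finite_induct) (auto intro: hom_poly_add)

definition is_ideal :: "'a::comm_ring_1 set \<Rightarrow> bool" where
  "is_ideal I \<longleftrightarrow> 0 \<in> I \<and> (\<forall>f\<in>I. \<forall>g\<in>I. f + g \<in> I) \<and> (\<forall>c. \<forall>f\<in>I. c * f \<in> I)"

lemma is_ideal_UNIV: "is_ideal UNIV"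
  by (simp add: is_ideal_def)

lemma is_ideal_sum: "is_ideal I \<Longrightarrow> (\<And>x. x \<in> A \<Longrightarrow> f x \<in> I) \<Longrightarrow> (\<Sum>x\<in>A. f x) \<in> I"
  by (induction A rule: infinite_finite_induct) (auto simp: is_ideal_def)

abbreviation strandI :: "('n::finite, 'k::field) free_seq \<Rightarrow> ('n, 'k) mpoly set \<Rightarrow> nat \<Rightarrow> int
    \<Rightarrow> (nat \<Rightarrow>\<^sub>0 ('n, 'k) mpoly) set" where
  "strandI F I \<equiv> strand F (\<lambda>d. I \<inter> hom_poly d)"

lemma strandI_lookup:
  assumes "is_ideal I" "u \<in> strandI F I i j"
  shows "lookup u b \<in> I \<inter> hom_poly (j - shift F i b)"
proof (cases "b < rk F i")
  case True
  then show ?thesis using assms(2) by (auto simp: strand_def)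
next
  case False
  then have "b \<notin> keys u" using assms(2) by (auto simp: strand_def)
  then show ?thesis using assms(1) by (auto simp: in_keys_iff is_ideal_def)
qed

lemma strandI_I:
  assumes "\<And>b. b < rk F i \<Longrightarrow> lookup u b \<in> I \<inter> hom_poly (j - shift F i b)"
    and "\<And>b. b \<ge> rk F i \<Longrightarrow> lookup u b = 0"
  shows "u \<in> strandI F I i j"
  using assms unfolding strand_def by (auto simp: in_keys_iff not_le[symmetric])

lemma strandI_keys: "u \<in> strandI F I i j \<Longrightarrow> keys u \<subseteq> {..<rk F i}"
  by (simp add: strand_def)

lemma strandI_zeros: "u \<in> strandI F I i j \<Longrightarrow> b \<ge> rk F i \<Longrightarrow> lookup u b = 0"
  using strandI_keys by (fastforce simp: in_keys_iff)

lemma strandI_add: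
  assumes "is_ideal I" "u \<in> strandI F I i j" "w \<in> strandI F I i j"
  shows "u + w \<in> strandI F I i j"
  using strandI_lookup[OF assms(1,2)] strandI_lookup[OF assms(1,3)] assms
  by (intro strandI_I) (auto simp: lookup_add hom_poly_add is_ideal_def strandI_zeros)

lemma strandI_const_smul:
  assumes "is_ideal I" "u \<in> strandI F I i j"
  shows "smul (const c) u \<in> strandI F I i j"
  using strandI_lookup[OF assms] assms hom_poly_mult[OF hom_poly_const[of c]]
  by (intro strandI_I) (fastforce simp: is_ideal_def strandI_zeros)+

lemma const_simps:
  "const (a + b) = const a + const b" "const (a * b) = const a * const b" "const 1 = 1" "const 0 = 0"
  by (simp_all add: const_def single_add mult_single)

lemma const_minus_one: "const (- 1) = - 1"
  by (simp add: const_def single_uminus)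

lemma smul_minus_one: "smul (const (- 1)) u = - u"
  by (rule poly_mapping_eqI) (simp add: const_minus_one)

lemma strandI_minus:
  assumes "is_ideal I" "u \<in> strandI F I i j" "w \<in> strandI F I i j"
  shows "u - w \<in> strandI F I i j"
  using strandI_add[OF assms(1,2) strandI_const_smul[OF assms(1,3), of "-1"]]
  by (simp add: smul_minus_one)

lemma strandI_zero: "is_ideal I \<Longrightarrow> 0 \<in> strandI F I i j"
  by (auto intro!: strandI_I simp: is_ideal_def)

lemma unit_strand: "b < rk F i \<Longrightarrow> unit b \<in> strandI F UNIV i (shift F i b)"
  by (rule strandI_I) (auto simp: lookup_single when_def hom_poly_one)

text \<open>
  A homogeneous linear map between free modules respects the subcomplex of tuples with entries in an
  ideal; this subcomplex is the tensor product with the ideal.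
\<close>

lemma lin_strandI:
  assumes "is_ideal I" "u \<in> strandI F I i j"
    and "\<And>b. b < rk F i \<Longrightarrow> p b \<in> strandI F' UNIV i' (shift F i b)"
  shows "lin (rk F i) p u \<in> strandI F' I i' j"
proof (rule strandI_I)
  fix a
  have "lookup u b * lookup (p b) a \<in> I \<inter> hom_poly (j - shift F' i' a)"
    if "b < rk F i" for b
  proof -
    have "lookup (p b) a \<in> hom_poly (shift F i b - shift F' i' a)"
      using strandI_lookup[OF is_ideal_UNIV assms(3)[OF that], of a] by simp
    moreover have "lookup u b \<in> I" "lookup u b \<in> hom_poly (j - shift F i b)"
      using strandI_lookup[OF assms(1,2), of b] by auto
    ultimately show ?thesis
      using hom_poly_mult[of "lookup u b" "j - shift F i b"] assms(1)
      by (fastforce simp: is_ideal_def mult.commute)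
  qed
  then show "lookup (lin (rk F i) p u) a \<in> I \<inter> hom_poly (j - shift F' i' a)"
    by (auto simp: lookup_lin intro!: is_ideal_sum assms hom_poly_sum)
next
  fix a assume "rk F' i' \<le> a"
  then show "lookup (lin (rk F i) p u) a = 0"
    using strandI_zeros[OF assms(3)] by (auto simp: lookup_lin intro!: sum.neutral)
qed

section \<open>Comparison of graded free resolutions\<close>

definition aug :: "(('n, 'k::field) mpoly \<Rightarrow> 'q::ab_group_add \<Rightarrow> 'q) \<Rightarrow> ('n, 'k) free_seq \<Rightarrow> (nat \<Rightarrow> 'q)
    \<Rightarrow> (nat \<Rightarrow>\<^sub>0 ('n, 'k) mpoly) \<Rightarrow> 'q" where
  "aug sc F g u = (\<Sum>b<rk F 0. sc (lookup u b) (g b))"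

lemma aug_lin:
  assumes "module sc"
  shows "aug sc F g (lin r p u) = (\<Sum>c<r. sc (lookup u c) (aug sc F g (p c)))"
proof -
  interpret module sc by fact
  show ?thesis
    unfolding aug_def lookup_lin
    by (simp add: scale_sum_left scale_sum_right) (rule sum.swap)
qed

text \<open>
  The notion of a graded free resolution in the form in which diagram chases use it: homogeneity is
  a property of the columns of the matrices, exactness is stated for elements, and the generators \<open>g\<close>
  of the resolved module are explicit.
\<close>

definition resolves :: "('n::finite, 'k::field) free_seq \<Rightarrow> (('n, 'k) mpoly \<Rightarrow> 'q::ab_group_add \<Rightarrow> 'q) \<Rightarrow>
    (int \<Rightarrow> 'q set) \<Rightarrow> (nat \<Rightarrow> 'q) \<Rightarrow> bool" where
  "resolves F sc N g \<longleftrightarrow>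
     (\<forall>i b. b < rk F (Suc i) \<longrightarrow> bdry F (*) (Suc i) (unit b) \<in> strandI F UNIV i (shift F (Suc i) b)) \<and>
     (\<forall>i j. \<forall>u \<in> strandI F UNIV (Suc i) j. bdry F (*) (Suc i) u = 0 \<longleftrightarrow>
        u \<in> bdry F (*) (Suc (Suc i)) ` strandI F UNIV (Suc (Suc i)) j) \<and>
     (\<forall>b<rk F 0. g b \<in> N (shift F 0 b)) \<and>
     (\<forall>j. aug sc F g ` strandI F UNIV 0 j = N j) \<and>
     (\<forall>j. \<forall>u \<in> strandI F UNIV 0 j. aug sc F g u = 0 \<longleftrightarrow>
        u \<in> bdry F (*) (Suc 0) ` strandI F UNIV (Suc 0) j)"

lemma graded_free_resolution_iff:
  fixes F :: "('n::finite, 'k::field) free_seq"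
  shows "graded_free_resolution F sc N \<longleftrightarrow> (\<exists>g. resolves F sc N g)"
proof -
  have hom: "(\<forall>i. \<forall>a<rk F i. \<forall>b<rk F (Suc i). diff F (Suc i) a b \<in> hom_poly (shift F (Suc i) b - shift F i a))
     \<longleftrightarrow> (\<forall>i b. b < rk F (Suc i) \<longrightarrow> bdry F (*) (Suc i) (unit b) \<in> strandI F UNIV i (shift F (Suc i) b))"
  proof -
    have *: "lookup (bdry F (*) (Suc i) (unit b)) a = (if a < rk F i then diff F (Suc i) a b else 0)"
      if "b < rk F (Suc i)" for i a b
      using that by (auto simp del: bdry.simps simp: lookup_bdry lookup_single when_def
         if_distrib[of "\<lambda>x. _ * x"] cong: if_cong)
    have "bdry F (*) (Suc i) (unit b) \<in> strandI F UNIV i (shift F (Suc i) b)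
      \<longleftrightarrow> (\<forall>a<rk F i. diff F (Suc i) a b \<in> hom_poly (shift F (Suc i) b - shift F i a))"
      if "b < rk F (Suc i)" for i b
      using *[OF that] by (auto simp del: bdry.simps simp: strand_def in_keys_iff split: if_splits)
    then show ?thesis by blast
  qed
  have strand: "bdry F (*) (Suc i) ` strandI F UNIV (Suc i) j \<subseteq> strandI F UNIV i j"
    if "\<forall>i b. b < rk F (Suc i) \<longrightarrow> bdry F (*) (Suc i) (unit b) \<in> strandI F UNIV i (shift F (Suc i) b)" for i j
  proof
    fix w assume "w \<in> bdry F (*) (Suc i) ` strandI F UNIV (Suc i) j"
    then obtain u where u: "u \<in> strandI F UNIV (Suc i) j" "w = bdry F (*) (Suc i) u" by blast
    show "w \<in> strandI F UNIV i j"
      unfolding u(2) by (subst bdry_expand, rule lin_strandI[OF is_ideal_UNIV u(1)]) (use that in blast)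
  qed
  have set_eq: "({u \<in> A. P u} = B) \<longleftrightarrow> (\<forall>u\<in>A. P u \<longleftrightarrow> u \<in> B)" if "B \<subseteq> A" for A B :: "'x set" and P
    using that by blast
  have conjT: "(P \<and> Q) = Q" if P for P Q using that by simp
  have UN: "strandI F UNIV = strand F hom_poly" by simp
  show ?thesis
  proof (cases "\<forall>i b. b < rk F (Suc i) \<longrightarrow> bdry F (*) (Suc i) (unit b) \<in> strandI F UNIV i (shift F (Suc i) b)")
    case True
    have "graded_free_resolution F sc N \<longleftrightarrow>
     (\<forall>i j. \<forall>u \<in> strandI F UNIV (Suc i) j. bdry F (*) (Suc i) u = 0 \<longleftrightarrow>
        u \<in> bdry F (*) (Suc (Suc i)) ` strandI F UNIV (Suc (Suc i)) j) \<and>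
     (\<exists>g. (\<forall>b<rk F 0. g b \<in> N (shift F 0 b)) \<and>
     (\<forall>j. aug sc F g ` strandI F UNIV 0 j = N j) \<and>
     (\<forall>j. \<forall>u \<in> strandI F UNIV 0 j. aug sc F g u = 0 \<longleftrightarrow>
        u \<in> bdry F (*) (Suc 0) ` strandI F UNIV (Suc 0) j))"
      unfolding graded_free_resolution_def Let_def aug_def[symmetric] hom UN[symmetric]
      unfolding set_eq[OF strand[OF True]] by (rule conjT[OF True])
    then show ?thesis unfolding resolves_def conjT[OF True] by (simp only: ex_simps)
  next
    case False
    then show ?thesis unfolding graded_free_resolution_def resolves_def hom by (simp only: simp_thms)
  qed
qed

lemmas resolves_hom = resolves_def[THEN iffD1, THEN conjunct1, rule_format]
lemmas resolves_exact = resolves_def[THEN iffD1, THEN conjunct2, THEN conjunct1, rule_format]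
lemmas resolves_gens = resolves_def[THEN iffD1, THEN conjunct2, THEN conjunct2, THEN conjunct1, rule_format]
lemmas resolves_onto = resolves_def[THEN iffD1, THEN conjunct2, THEN conjunct2, THEN conjunct2, THEN conjunct1, rule_format]
lemmas resolves_aug_exact = resolves_def[THEN iffD1, THEN conjunct2, THEN conjunct2, THEN conjunct2, THEN conjunct2, rule_format]

context
  fixes F :: "('n::finite, 'k::field) free_seq" and sc :: "('n, 'k) mpoly \<Rightarrow> 'q::ab_group_add \<Rightarrow> 'q" and N g
  assumes F: "resolves F sc N g" and sc: "module sc"
begin

lemma bdry_strandI:
  assumes "is_ideal I" "u \<in> strandI F I (Suc i) j"
  shows "bdry F (*) (Suc i) u \<in> strandI F I i j"
proof -
  have "lin (rk F (Suc i)) (\<lambda>b. bdry F (*) (Suc i) (unit b)) u \<in> strandI F I i j"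
    by (rule lin_strandI[OF assms resolves_hom[OF F]])
  then show ?thesis by (simp only: bdry_expand[of F i u])
qed

lemma bdry_exact:
  assumes "u \<in> strandI F UNIV (Suc i) j"
  shows "bdry F (*) (Suc i) u = 0 \<longleftrightarrow> u \<in> bdry F (*) (Suc (Suc i)) ` strandI F UNIV (Suc (Suc i)) j"
  by (rule resolves_exact[OF F assms])

lemma aug_exact:
  assumes "u \<in> strandI F UNIV 0 j"
  shows "aug sc F g u = 0 \<longleftrightarrow> u \<in> bdry F (*) (Suc 0) ` strandI F UNIV (Suc 0) j"
  by (rule resolves_aug_exact[OF F assms])

lemma bdry_bdry: "bdry F (*) (Suc i) (bdry F (*) (Suc (Suc i)) u) = 0"
proof -
  have "bdry F (*) (Suc i) (bdry F (*) (Suc (Suc i)) (unit b)) = 0" if "b < rk F (Suc (Suc i))" for b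
    using bdry_exact[OF bdry_strandI[OF is_ideal_UNIV unit_strand[OF that]]] unit_strand[OF that] by blast
  then have "lin (rk F (Suc (Suc i))) (\<lambda>b. bdry F (*) (Suc i) (bdry F (*) (Suc (Suc i)) (unit b))) u
      = lin (rk F (Suc (Suc i))) (\<lambda>b. 0) u" by (intro lin_cong) auto
  also have "\<dots> = 0" by (simp add: lin_def smul_simps)
  finally show ?thesis
    by (subst bdry_expand[of F "Suc i"]) (simp add: slin_lin_comp[OF slin_bdry] del: bdry.simps)
qed

lemma aug_bdry: "aug sc F g (bdry F (*) (Suc 0) u) = 0"
proof -
  interpret module sc by (rule sc)
  have "aug sc F g (bdry F (*) (Suc 0) (unit b)) = 0" if "b < rk F (Suc 0)" for b
    using aug_exact[OF bdry_strandI[OF is_ideal_UNIV unit_strand[OF that]]] unit_strand[OF that] by blast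
  then show ?thesis
    by (subst bdry_expand[of F "0"]) (simp add: aug_lin[OF sc] del: bdry.simps)
qed

end

lemma image_ex: "x \<in> f ` A \<Longrightarrow> \<exists>w. w \<in> A \<and> f w = x"
  by blast

text \<open>
  A degree-preserving chain map into the exact complex \<open>F\<close> can be built one homological degree at a
  time, because every value that has to be hit is a cycle.
\<close>

lemma chain_map_exists:
  assumes F: "resolves F sc N g" and F': "resolves F' sc N g'" and sc: "module sc"
  obtains p where
    "\<And>i b. b < rk F' i \<Longrightarrow> p i b \<in> strandI F UNIV i (shift F' i b)"
    "\<And>i u. bdry F (*) (Suc i) (lin (rk F' (Suc i)) (p (Suc i)) u) = lin (rk F' i) (p i) (bdry F' (*) (Suc i) u)"
    "\<And>u. aug sc F g (lin (rk F' 0) (p 0) u) = aug sc F' g' u"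
proof -
  interpret module sc by (rule sc)
  define P where "P i p \<longleftrightarrow> (\<forall>b<rk F' i. p b \<in> strandI F UNIV i (shift F' i b)) \<and>
    (\<forall>b<rk F' (Suc i). lin (rk F' i) p (bdry F' (*) (Suc i) (unit b))
        \<in> bdry F (*) (Suc i) ` strandI F UNIV (Suc i) (shift F' (Suc i) b)) \<and>
    (i = 0 \<longrightarrow> (\<forall>b<rk F' 0. aug sc F g (p b) = g' b))" for i p
  define Q where "Q i p p' \<longleftrightarrow> (\<forall>b<rk F' (Suc i).
    bdry F (*) (Suc i) (p' b) = lin (rk F' i) p (bdry F' (*) (Suc i) (unit b)))" for i p p'
  have "\<exists>p. P 0 p"
  proof -
    have "\<forall>b\<in>{..<rk F' 0}. \<exists>w. w \<in> strandI F UNIV 0 (shift F' 0 b) \<and> aug sc F g w = g' b"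
    proof
      fix b assume "b \<in> {..<rk F' 0}"
      then have "g' b \<in> aug sc F g ` strandI F UNIV 0 (shift F' 0 b)"
        using resolves_gens[OF F'] resolves_onto[OF F] by simp
      then show "\<exists>w. w \<in> strandI F UNIV 0 (shift F' 0 b) \<and> aug sc F g w = g' b"
        by (rule image_ex)
    qed
    from bchoice[OF this] obtain p where
      p: "\<And>b. b < rk F' 0 \<Longrightarrow> p b \<in> strandI F UNIV 0 (shift F' 0 b)"
         "\<And>b. b < rk F' 0 \<Longrightarrow> aug sc F g (p b) = g' b" by auto
    have "lin (rk F' 0) p (bdry F' (*) (Suc 0) (unit b))
        \<in> bdry F (*) (Suc 0) ` strandI F UNIV (Suc 0) (shift F' (Suc 0) b)" if b: "b < rk F' (Suc 0)" for b
    proof -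
      let ?w = "bdry F' (*) (Suc 0) (unit b)"
      have w: "?w \<in> strandI F' UNIV 0 (shift F' (Suc 0) b)"
        by (rule bdry_strandI[OF F' sc is_ideal_UNIV unit_strand[OF b]])
      have "lin (rk F' 0) p ?w \<in> strandI F UNIV 0 (shift F' (Suc 0) b)"
        by (rule lin_strandI[OF is_ideal_UNIV w p(1)])
      moreover have "aug sc F g (lin (rk F' 0) p ?w) = aug sc F' g' ?w"
        unfolding aug_lin[OF sc] unfolding aug_def[of sc F'] using p(2) by (simp del: bdry.simps)
      ultimately show ?thesis
        using iffD1[OF aug_exact[OF F sc]] unfolding aug_bdry[OF F' sc] by simp
    qed
    then have "P 0 p" unfolding P_def using p by blast
    then show ?thesis by (intro exI[of _ p])
  qed
  moreover have "\<exists>p'. P (Suc i) p' \<and> Q i p p'" if P: "P i p" for i p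
  proof -
    have "\<forall>b\<in>{..<rk F' (Suc i)}. \<exists>w. w \<in> strandI F UNIV (Suc i) (shift F' (Suc i) b) \<and>
      bdry F (*) (Suc i) w = lin (rk F' i) p (bdry F' (*) (Suc i) (unit b))"
      using P[unfolded P_def, THEN conjunct2, THEN conjunct1] by (intro ballI image_ex) simp
    from bchoice[OF this] obtain p' where
      p': "\<And>b. b < rk F' (Suc i) \<Longrightarrow> p' b \<in> strandI F UNIV (Suc i) (shift F' (Suc i) b)"
         "\<And>b. b < rk F' (Suc i) \<Longrightarrow>
            bdry F (*) (Suc i) (p' b) = lin (rk F' i) p (bdry F' (*) (Suc i) (unit b))" by auto
    have "lin (rk F' (Suc i)) p' (bdry F' (*) (Suc (Suc i)) (unit b))
        \<in> bdry F (*) (Suc (Suc i)) ` strandI F UNIV (Suc (Suc i)) (shift F' (Suc (Suc i)) b)"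
      if b: "b < rk F' (Suc (Suc i))" for b
    proof -
      let ?w = "bdry F' (*) (Suc (Suc i)) (unit b)"
      have w: "?w \<in> strandI F' UNIV (Suc i) (shift F' (Suc (Suc i)) b)"
        by (rule bdry_strandI[OF F' sc is_ideal_UNIV unit_strand[OF b]])
      have 1: "lin (rk F' (Suc i)) p' ?w \<in> strandI F UNIV (Suc i) (shift F' (Suc (Suc i)) b)"
        by (rule lin_strandI[OF is_ideal_UNIV w p'(1)])
      have "bdry F (*) (Suc i) (lin (rk F' (Suc i)) p' ?w)
          = lin (rk F' (Suc i)) (\<lambda>c. lin (rk F' i) p (bdry F' (*) (Suc i) (unit c))) ?w"
        unfolding slin_lin_comp[OF slin_bdry] by (rule lin_cong) (rule p'(2))
      also have "\<dots> = lin (rk F' i) p (bdry F' (*) (Suc i) ?w)"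
        by (subst bdry_expand[of F' i ?w]) (rule slin_lin_comp[OF slin_lin, symmetric])
      also have "\<dots> = 0"
        unfolding bdry_bdry[OF F' sc] by (rule slin_zero[OF slin_lin])
      finally show ?thesis by (rule iffD1[OF bdry_exact[OF F sc 1]])
    qed
    then have "P (Suc i) p'" unfolding P_def using p'(1) by blast
    then show ?thesis unfolding Q_def using p'(2) by blast
  qed
  ultimately obtain p where p: "\<And>i. P i (p i)" "\<And>i. Q i (p i) (p (Suc i))"
    using dependent_nat_choice[of P Q] by blast
  show thesis
  proof (rule that)
    show "p i b \<in> strandI F UNIV i (shift F' i b)" if "b < rk F' i" for i b
      using p(1) that unfolding P_def by blast
    show "bdry F (*) (Suc i) (lin (rk F' (Suc i)) (p (Suc i)) u) = lin (rk F' i) (p i) (bdry F' (*) (Suc i) u)" for i u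
    proof -
      have "bdry F (*) (Suc i) (lin (rk F' (Suc i)) (p (Suc i)) u)
          = lin (rk F' (Suc i)) (\<lambda>c. lin (rk F' i) (p i) (bdry F' (*) (Suc i) (unit c))) u"
        unfolding slin_lin_comp[OF slin_bdry] using p(2)[of i] unfolding Q_def by (intro lin_cong) blast
      also have "\<dots> = lin (rk F' i) (p i) (bdry F' (*) (Suc i) u)"
        by (subst bdry_expand[of F' i u]) (rule slin_lin_comp[OF slin_lin, symmetric])
      finally show ?thesis .
    qed
    show "aug sc F g (lin (rk F' 0) (p 0) u) = aug sc F' g' u" for u
      unfolding aug_lin[OF sc] unfolding aug_def[of sc F'] using p(1)[of 0] unfolding P_def by simp
  qed
qed

text \<open>A chain map over the zero map of the resolved module is contracted by the same kind of lifting.\<close>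

lemma homotopy_exists:
  assumes F: "resolves F sc N g" and sc: "module sc"
    and th: "\<And>i. slin (\<theta> i)"
    and hom: "\<And>i b. b < rk F i \<Longrightarrow> \<theta> i (unit b) \<in> strandI F UNIV i (shift F i b)"
    and comm: "\<And>i u. bdry F (*) (Suc i) (\<theta> (Suc i) u) = \<theta> i (bdry F (*) (Suc i) u)"
    and aug: "\<And>u. aug sc F g (\<theta> 0 u) = 0"
  obtains s where
    "\<And>i b. b < rk F i \<Longrightarrow> s i b \<in> strandI F UNIV (Suc i) (shift F i b)"
    "\<And>b. b < rk F 0 \<Longrightarrow> bdry F (*) (Suc 0) (s 0 b) = \<theta> 0 (unit b)"
    "\<And>i b. b < rk F (Suc i) \<Longrightarrow> bdry F (*) (Suc (Suc i)) (s (Suc i) b)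
        = \<theta> (Suc i) (unit b) - lin (rk F i) (s i) (bdry F (*) (Suc i) (unit b))"
proof -
  define P where "P i s \<longleftrightarrow> (\<forall>b<rk F i. s b \<in> strandI F UNIV (Suc i) (shift F i b)) \<and>
    (\<forall>b<rk F (Suc i). \<theta> (Suc i) (unit b) - lin (rk F i) s (bdry F (*) (Suc i) (unit b))
        \<in> bdry F (*) (Suc (Suc i)) ` strandI F UNIV (Suc (Suc i)) (shift F (Suc i) b)) \<and>
    (i = 0 \<longrightarrow> (\<forall>b<rk F 0. bdry F (*) (Suc 0) (s b) = \<theta> 0 (unit b)))" for i s
  define Q where "Q i s s' \<longleftrightarrow> (\<forall>b<rk F (Suc i). bdry F (*) (Suc (Suc i)) (s' b)
    = \<theta> (Suc i) (unit b) - lin (rk F i) s (bdry F (*) (Suc i) (unit b)))" for i s s'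
  \<comment> \<open>If \<open>\<partial>s + s\<partial> = \<theta>\<close> holds up to degree \<open>i\<close>, the obstruction to the next degree is a cycle.\<close>
  have lift: "\<theta> (Suc i) (unit b) - lin (rk F i) s (bdry F (*) (Suc i) (unit b))
        \<in> bdry F (*) (Suc (Suc i)) ` strandI F UNIV (Suc (Suc i)) (shift F (Suc i) b)"
    if s: "\<And>b. b < rk F i \<Longrightarrow> s b \<in> strandI F UNIV (Suc i) (shift F i b)"
      and eq: "lin (rk F i) (\<lambda>c. bdry F (*) (Suc i) (s c)) (bdry F (*) (Suc i) (unit b))
           = \<theta> i (bdry F (*) (Suc i) (unit b))"
      and b: "b < rk F (Suc i)" for i s b
  proof -
    let ?w = "bdry F (*) (Suc i) (unit b)"
    have w: "?w \<in> strandI F UNIV i (shift F (Suc i) b)"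
      by (rule bdry_strandI[OF F sc is_ideal_UNIV unit_strand[OF b]])
    have 1: "\<theta> (Suc i) (unit b) - lin (rk F i) s ?w \<in> strandI F UNIV (Suc i) (shift F (Suc i) b)"
      by (intro strandI_minus is_ideal_UNIV hom b lin_strandI[OF is_ideal_UNIV w s])
    have "bdry F (*) (Suc i) (\<theta> (Suc i) (unit b) - lin (rk F i) s ?w) = 0"
      unfolding slin_minus[OF slin_bdry] comm slin_lin_comp[OF slin_bdry] eq by simp
    then show ?thesis by (rule iffD1[OF bdry_exact[OF F sc 1]])
  qed
  have "\<exists>s. P 0 s"
  proof -
    have "\<theta> 0 (unit b) \<in> bdry F (*) (Suc 0) ` strandI F UNIV (Suc 0) (shift F 0 b)" if "b < rk F 0" for b
      by (rule iffD1[OF aug_exact[OF F sc hom[OF that]] aug])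
    then have "\<forall>b\<in>{..<rk F 0}. \<exists>w. w \<in> strandI F UNIV (Suc 0) (shift F 0 b)
        \<and> bdry F (*) (Suc 0) w = \<theta> 0 (unit b)"
      by (intro ballI image_ex) simp
    from bchoice[OF this] obtain s where
      s: "\<And>b. b < rk F 0 \<Longrightarrow> s b \<in> strandI F UNIV (Suc 0) (shift F 0 b)"
         "\<And>b. b < rk F 0 \<Longrightarrow> bdry F (*) (Suc 0) (s b) = \<theta> 0 (unit b)" by auto
    have "lin (rk F 0) (\<lambda>c. bdry F (*) (Suc 0) (s c)) (bdry F (*) (Suc 0) (unit b))
           = \<theta> 0 (bdry F (*) (Suc 0) (unit b))" if b: "b < rk F (Suc 0)" for b
    proof -
      have "lin (rk F 0) (\<lambda>c. bdry F (*) (Suc 0) (s c)) (bdry F (*) (Suc 0) (unit b))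
          = lin (rk F 0) (\<lambda>c. \<theta> 0 (unit c)) (bdry F (*) (Suc 0) (unit b))"
        using s(2) by (intro lin_cong) 
      also have "\<dots> = \<theta> 0 (bdry F (*) (Suc 0) (unit b))"
        by (rule slin_expand[symmetric, OF th
            strandI_keys[OF bdry_strandI[OF F sc is_ideal_UNIV unit_strand[OF b]]]])
      finally show ?thesis .
    qed
    then have "P 0 s" unfolding P_def using s lift[OF s(1)] by blast
    then show ?thesis by (intro exI[of _ s])
  qed
  moreover have "\<exists>s'. P (Suc i) s' \<and> Q i s s'" if P: "P i s" for i s
  proof -
    have "\<forall>b\<in>{..<rk F (Suc i)}. \<exists>w. w \<in> strandI F UNIV (Suc (Suc i)) (shift F (Suc i) b) \<and>
      bdry F (*) (Suc (Suc i)) w = \<theta> (Suc i) (unit b) - lin (rk F i) s (bdry F (*) (Suc i) (unit b))"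
      using P[unfolded P_def, THEN conjunct2, THEN conjunct1] by (intro ballI image_ex) simp
    from bchoice[OF this] obtain s' where
      s': "\<And>b. b < rk F (Suc i) \<Longrightarrow> s' b \<in> strandI F UNIV (Suc (Suc i)) (shift F (Suc i) b)"
         "\<And>b. b < rk F (Suc i) \<Longrightarrow> bdry F (*) (Suc (Suc i)) (s' b)
            = \<theta> (Suc i) (unit b) - lin (rk F i) s (bdry F (*) (Suc i) (unit b))" by auto
    have "lin (rk F (Suc i)) (\<lambda>c. bdry F (*) (Suc (Suc i)) (s' c)) (bdry F (*) (Suc (Suc i)) (unit b))
           = \<theta> (Suc i) (bdry F (*) (Suc (Suc i)) (unit b))" if b: "b < rk F (Suc (Suc i))" for b
    proof -
      let ?w = "bdry F (*) (Suc (Suc i)) (unit b)"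
      have "lin (rk F (Suc i)) (\<lambda>c. bdry F (*) (Suc (Suc i)) (s' c)) ?w
          = lin (rk F (Suc i)) (\<lambda>c. \<theta> (Suc i) (unit c) - lin (rk F i) s (bdry F (*) (Suc i) (unit c))) ?w"
        using s'(2) by (intro lin_cong) 
      also have "\<dots> = lin (rk F (Suc i)) (\<lambda>c. \<theta> (Suc i) (unit c)) ?w
          - lin (rk F i) s (lin (rk F (Suc i)) (\<lambda>c. bdry F (*) (Suc i) (unit c)) ?w)"
        unfolding lin_diff_fun slin_lin_comp[OF slin_lin] ..
      also have "lin (rk F (Suc i)) (\<lambda>c. \<theta> (Suc i) (unit c)) ?w = \<theta> (Suc i) ?w"
        by (rule slin_expand[symmetric, OF th
            strandI_keys[OF bdry_strandI[OF F sc is_ideal_UNIV unit_strand[OF b]]]])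
      also have "lin (rk F (Suc i)) (\<lambda>c. bdry F (*) (Suc i) (unit c)) ?w = 0"
        unfolding bdry_expand[symmetric] by (rule bdry_bdry[OF F sc])
      finally show ?thesis by (simp add: slin_zero[OF slin_lin] del: bdry.simps)
    qed
    then have "P (Suc i) s'" unfolding P_def using s' lift[OF s'(1)] by blast
    then show ?thesis unfolding Q_def using s'(2) by blast
  qed
  ultimately obtain s where s: "\<And>i. P i (s i)" "\<And>i. Q i (s i) (s (Suc i))"
    using dependent_nat_choice[of P Q] by blast
  show thesis
  proof (rule that)
    show "s i b \<in> strandI F UNIV (Suc i) (shift F i b)" if "b < rk F i" for i b
      using s(1) that unfolding P_def by blast
    show "bdry F (*) (Suc 0) (s 0 b) = \<theta> 0 (unit b)" if "b < rk F 0" for b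
      using s(1)[of 0] that unfolding P_def by blast
    show "bdry F (*) (Suc (Suc i)) (s (Suc i) b)
        = \<theta> (Suc i) (unit b) - lin (rk F i) (s i) (bdry F (*) (Suc i) (unit b))" if "b < rk F (Suc i)" for i b
      using s(2)[of i] that unfolding Q_def by blast
  qed
qed

abbreviation kscale :: "'k::field \<Rightarrow> (nat \<Rightarrow>\<^sub>0 ('n, 'k) mpoly) \<Rightarrow> (nat \<Rightarrow>\<^sub>0 ('n, 'k) mpoly)" where
  "kscale \<equiv> (\<lambda>c. Poly_Mapping.map ((*) (const c)))"

lemma kscale_eq: "kscale = (\<lambda>c. smul (const c))"
  by (simp add: fun_eq_iff smul_def)

lemma kscale_smul: "kscale c u = smul (const c) u"
  by (simp add: smul_def)

lemma vector_space_kscale: "vector_space kscale"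
  unfolding kscale_eq by unfold_locales (simp_all add: smul_simps const_simps)

lemma linear_kscale: "slin f \<Longrightarrow> Vector_Spaces.linear kscale kscale f"
  by (intro Vector_Spaces.linear.intro module_hom.intro module_hom_axioms.intro vector_space_kscale
      vector_space_kscale[unfolded module_iff_vector_space[symmetric]])
    (simp_all only: kscale_smul slin_add slin_smul)

lemma finite_mdeg: "finite {m :: 'n::finite \<Rightarrow>\<^sub>0 nat. mdeg m \<le> d}"
proof -
  have "lookup ` {m :: 'n \<Rightarrow>\<^sub>0 nat. mdeg m \<le> d}
      \<subseteq> {f. \<forall>v. (v \<in> UNIV \<longrightarrow> f v \<in> {..d}) \<and> (v \<notin> UNIV \<longrightarrow> f v = 0)}"
  proof -
    have "lookup m v \<le> mdeg m" for m :: "'n \<Rightarrow>\<^sub>0 nat" and v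
      unfolding mdeg_def by (rule member_le_sum) auto
    then show ?thesis by (auto intro: le_trans)
  qed
  then have "finite (lookup ` {m :: 'n \<Rightarrow>\<^sub>0 nat. mdeg m \<le> d})"
    by (rule finite_subset) (intro finite_set_of_finite_funs, auto)
  moreover have "inj_on lookup {m :: 'n \<Rightarrow>\<^sub>0 nat. mdeg m \<le> d}"
    by (intro inj_onI poly_mapping_eqI) simp
  ultimately show ?thesis by (rule finite_imageD)
qed

lemma strandI_finite_dim:
  fixes F :: "('n::finite, 'k::field) free_seq"
  obtains T where "finite T" "strandI F I i j \<subseteq> module.span kscale T"
proof -
  interpret vector_space "kscale :: 'k \<Rightarrow> (nat \<Rightarrow>\<^sub>0 ('n, 'k) mpoly) \<Rightarrow> _" by (rule vector_space_kscale)
  define T :: "(nat \<Rightarrow>\<^sub>0 ('n, 'k) mpoly) set" where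
    "T = (\<Union>b<rk F i. (\<lambda>m. single b (single m 1)) ` {m. mdeg m \<le> nat (j - shift F i b)})"
  have "u \<in> span T" if u: "u \<in> strandI F I i j" for u
  proof -
    have "u = (\<Sum>b<rk F i. \<Sum>m\<in>keys (lookup u b).
        kscale (lookup (lookup u b) m) (single b (single m 1)))"
    proof (rule poly_mapping_eqI, rule poly_mapping_eqI)
      fix a n
      have "(\<Sum>m\<in>keys (lookup u b).
         lookup (lookup (kscale (lookup (lookup u b) m)
            (single b (single m 1))) a) n)
        = (if b = a then lookup (lookup u a) n else 0)" for b
      proof -
        have "(\<Sum>m\<in>keys (lookup u b).
         lookup (lookup (kscale (lookup (lookup u b) m)
            (single b (single m 1))) a) n)
          = (\<Sum>m\<in>keys (lookup u b).
             if m = n then (if b = a then lookup (lookup u a) n else 0) else 0)"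
          by (intro sum.cong) (auto simp: kscale_smul const_def lookup_single when_def mult_single)
        then show ?thesis by (auto simp: sum.delta in_keys_iff)
      qed
      then have "(\<Sum>b<rk F i. \<Sum>m\<in>keys (lookup u b).
         lookup (lookup (kscale (lookup (lookup u b) m)
            (single b (single m 1))) a) n)
         = (if a < rk F i then lookup (lookup u a) n else 0)"
        by simp
      then show "lookup (lookup u a) n
        = lookup (lookup (\<Sum>b<rk F i. \<Sum>m\<in>keys (lookup u b).
        kscale (lookup (lookup u b) m) (single b (single m 1))) a) n"
        using strandI_zeros[OF u, of a] by (auto simp: lookup_sum)
    qed
    also have "\<dots> \<in> span T"
    proof (intro span_sum span_scale span_base)
      fix b m assume b: "b \<in> {..<rk F i}" and m: "m \<in> keys (lookup u b)"
      have "int (mdeg m) = j - shift F i b"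
        using u b m unfolding strand_def hom_poly_def by auto
      then have "mdeg m \<le> nat (j - shift F i b)" by linarith
      then show "single b (single m 1) \<in> T" unfolding T_def using b by blast
    qed
    finally show ?thesis .
  qed
  moreover have "finite T" unfolding T_def by (auto intro: finite_mdeg)
  ultimately show ?thesis using that by blast
qed

text \<open>
  Let \<open>p : F \<rightarrow> F'\<close> and \<open>q : F' \<rightarrow> F\<close> lift the identity of the resolved module. Then \<open>q \<circ> p\<close> is homotopic
  to the identity, and since all maps are linear over the polynomial ring, this remains true for tuples
  with entries in \<open>I\<close>. So \<open>p\<close> is injective on homology. Exchanging \<open>F\<close> and \<open>F'\<close> gives equality.
\<close>

lemma homology_dim_le:
  fixes F F' :: "('n::finite, 'k::field) free_seq"
  assumes F: "resolves F sc N g" and F': "resolves F' sc N g'" and sc: "module sc" and I: "is_ideal I"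
  shows "homology_dim F (*) (\<lambda>d. I \<inter> hom_poly d) i j \<le> homology_dim F' (*) (\<lambda>d. I \<inter> hom_poly d) i j"
proof -
  interpret V: vector_space "kscale :: 'k \<Rightarrow> (nat \<Rightarrow>\<^sub>0 ('n, 'k) mpoly) \<Rightarrow> _" by (rule vector_space_kscale)
  obtain p where p: "\<And>i b. b < rk F i \<Longrightarrow> p i b \<in> strandI F' UNIV i (shift F i b)"
    "\<And>i u. bdry F' (*) (Suc i) (lin (rk F (Suc i)) (p (Suc i)) u) = lin (rk F i) (p i) (bdry F (*) (Suc i) u)"
    "\<And>u. aug sc F' g' (lin (rk F 0) (p 0) u) = aug sc F g u"
    using chain_map_exists[OF F' F sc] by blast
  obtain q where q: "\<And>i b. b < rk F' i \<Longrightarrow> q i b \<in> strandI F UNIV i (shift F' i b)"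
    "\<And>i u. bdry F (*) (Suc i) (lin (rk F' (Suc i)) (q (Suc i)) u) = lin (rk F' i) (q i) (bdry F' (*) (Suc i) u)"
    "\<And>u. aug sc F g (lin (rk F' 0) (q 0) u) = aug sc F' g' u"
    using chain_map_exists[OF F F' sc] by blast
  define \<theta> where "\<theta> i u = lin (rk F' i) (q i) (lin (rk F i) (p i) u) - u" for i u
  have th: "slin (\<theta> i)" for i
    unfolding slin_def \<theta>_def slin_add[OF slin_lin] slin_smul[OF slin_lin]
    by (simp add: smul_diff)
  have th_hom: "\<theta> i (unit b) \<in> strandI F UNIV i (shift F i b)" if b: "b < rk F i" for i b
    unfolding \<theta>_def
    by (intro strandI_minus is_ideal_UNIV lin_strandI[OF is_ideal_UNIV lin_strandI[OF is_ideal_UNIV]]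
        unit_strand b p q)
  have th_comm: "bdry F (*) (Suc i) (\<theta> (Suc i) u) = \<theta> i (bdry F (*) (Suc i) u)" for i u
    unfolding \<theta>_def slin_minus[OF slin_bdry] q p ..
  have th_aug: "aug sc F g (\<theta> 0 u) = 0" for u
  proof -
    interpret module sc by (rule sc)
    have "aug sc F g (a - b) = aug sc F g a - aug sc F g b" for a b
      by (simp add: aug_def lookup_minus scale_left_diff_distrib sum_subtractf)
    then show ?thesis by (simp add: \<theta>_def q(3) p(3))
  qed
  obtain s where s: "\<And>i b. b < rk F i \<Longrightarrow> s i b \<in> strandI F UNIV (Suc i) (shift F i b)"
    "\<And>b. b < rk F 0 \<Longrightarrow> bdry F (*) (Suc 0) (s 0 b) = \<theta> 0 (unit b)"
    "\<And>i b. b < rk F (Suc i) \<Longrightarrow> bdry F (*) (Suc (Suc i)) (s (Suc i) b)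
        = \<theta> (Suc i) (unit b) - lin (rk F i) (s i) (bdry F (*) (Suc i) (unit b))"
    using homotopy_exists[of F sc N g \<theta>, OF F sc th th_hom th_comm th_aug] by blast
  have homotopy: "bdry F (*) (Suc i) (lin (rk F i) (s i) z) = \<theta> i z"
    if "z \<in> strandI F I i j" "bdry F (*) i z = 0" for i z
  proof (cases i)
    case 0
    have "bdry F (*) (Suc 0) (lin (rk F 0) (s 0) z) = lin (rk F 0) (\<lambda>b. \<theta> 0 (unit b)) z"
      unfolding slin_lin_comp[OF slin_bdry] using s(2) by (rule lin_cong)
    then show ?thesis using slin_expand[OF th strandI_keys[OF that(1)], of 0] 0 by simp
  next
    case (Suc i')
    have "bdry F (*) (Suc i) (lin (rk F i) (s i) z)
        = lin (rk F i) (\<lambda>b. \<theta> i (unit b) - lin (rk F i') (s i') (bdry F (*) i (unit b))) z"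
      unfolding slin_lin_comp[OF slin_bdry] Suc using s(3) by (rule lin_cong)
    also have "\<dots> = \<theta> i z - lin (rk F i') (s i') (lin (rk F i) (\<lambda>b. bdry F (*) i (unit b)) z)"
      unfolding lin_diff_fun slin_lin_comp[OF slin_lin]
      unfolding slin_expand[OF th strandI_keys[OF that(1)], symmetric] ..
    also have "lin (rk F i) (\<lambda>b. bdry F (*) i (unit b)) z = 0"
      unfolding Suc bdry_expand[symmetric] using that(2) Suc by simp
    finally show ?thesis by (simp add: slin_zero[OF slin_lin])
  qed
  let ?Z = "\<lambda>F. {u \<in> strandI F I i j. bdry F (*) i u = 0}"
  let ?B = "\<lambda>F. bdry F (*) (Suc i) ` strandI F I (Suc i) j"
  have sub_strand: "V.subspace (strandI F I i j)" for F :: "('n, 'k) free_seq" and i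
    unfolding V.subspace_def kscale_smul
    using strandI_zero[OF I] strandI_add[OF I] strandI_const_smul[OF I] by blast
  have subZ: "V.subspace (?Z F)" for F :: "('n, 'k) free_seq"
    using sub_strand[of F i] unfolding V.subspace_def kscale_smul
    by (auto simp: slin_zero[OF slin_bdry] slin_add[OF slin_bdry] slin_smul[OF slin_bdry] smul_simps)
  have subB: "V.subspace (?B F)" for F :: "('n, 'k) free_seq"
    by (rule module_hom.subspace_image[OF Vector_Spaces.linear.axioms(3)[OF linear_kscale[OF slin_bdry]] sub_strand])
  have BZ: "?B F \<subseteq> ?Z F" if "resolves F sc N g" for F g
  proof -
    have "bdry F (*) i (bdry F (*) (Suc i) u) = 0" for u
      using bdry_bdry[OF that sc] by (cases i) (auto simp del: bdry.simps(2))
    then show ?thesis using bdry_strandI[OF that sc I] by blast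
  qed
  obtain T where T: "finite T" "strandI F I i j \<subseteq> V.span T" by (rule strandI_finite_dim)
  obtain T' where T': "finite T'" "strandI F' I i j \<subseteq> V.span T'" by (rule strandI_finite_dim)
  have "V.dim (?Z F) - V.dim (?B F) \<le> V.dim (?Z F') - V.dim (?B F')"
  proof (rule dim_quotient_le[OF linear_kscale[OF slin_lin] subB BZ[OF F] _ T(1) subB BZ[OF F'] _ T'(1) _ subZ])
    show "?Z F \<subseteq> V.span T" "?Z F' \<subseteq> V.span T'" using T T' by auto
    have "bdry F' (*) i (lin (rk F i) (p i) u) = 0" if "bdry F (*) i u = 0" for u
      using that p(2) by (cases i) (auto simp: slin_zero[OF slin_lin] simp del: bdry.simps(2))
    then show "lin (rk F i) (p i) ` ?Z F \<subseteq> ?Z F'"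
      using lin_strandI[OF I _ p(1)] by blast
    fix z assume z: "z \<in> ?Z F" and "lin (rk F i) (p i) z \<in> ?B F'"
    then obtain y where y: "y \<in> strandI F' I (Suc i) j" "lin (rk F i) (p i) z = bdry F' (*) (Suc i) y"
      by blast
    let ?x = "lin (rk F' (Suc i)) (q (Suc i)) y - lin (rk F i) (s i) z"
    have "bdry F (*) (Suc i) ?x = lin (rk F' i) (q i) (lin (rk F i) (p i) z) - \<theta> i z"
      unfolding slin_minus[OF slin_bdry] q(2) y(2) using homotopy z by simp
    also have "\<dots> = z" by (simp add: \<theta>_def)
    finally have "z = bdry F (*) (Suc i) ?x" by simp
    moreover have "?x \<in> strandI F I (Suc i) j"
      using z by (intro strandI_minus I lin_strandI[OF I y(1) q(1)] lin_strandI[OF I _ s(1)]) auto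
    ultimately show "z \<in> ?B F" by blast
  qed
  then show ?thesis unfolding homology_dim_def Let_def .
qed

section \<open>Koszul chains over an arbitrary ring\<close>

text \<open>The exponent vector of \<open>x\<^sub>v\<close> is written with the numeral \<open>1\<close> throughout.\<close>

declare One_nat_def [simp del]

definition vnum :: "'n::finite \<Rightarrow> nat" where
  "vnum = (SOME f. inj f)"

lemma inj_vnum: "inj (vnum :: 'n::finite \<Rightarrow> nat)"
proof -
  have "\<exists>f :: 'n \<Rightarrow> nat. inj f"
    using finite_imp_inj_to_nat_seg[OF finite_UNIV] by blast
  then show ?thesis unfolding vnum_def by (rule someI_ex)
qed

definition ksgn :: "'n::finite \<Rightarrow> 'n set \<Rightarrow> 'r::comm_ring_1" where
  "ksgn v \<sigma> = (- 1) ^ card {w\<in>\<sigma>. vnum w < vnum v}"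

lemma ksgn_square [simp]: "ksgn v \<sigma> * (ksgn v \<sigma> * x) = x"
  by (simp add: ksgn_def mult.assoc[symmetric] power_add[symmetric])

lemma ksgn_insert:
  "w \<notin> \<sigma> \<Longrightarrow> ksgn v (insert w \<sigma>) = (if vnum w < vnum v then - ksgn v \<sigma> else ksgn v \<sigma>)"
proof -
  assume "w \<notin> \<sigma>"
  then have "card {u\<in>insert w \<sigma>. vnum u < vnum v}
     = (if vnum w < vnum v then Suc (card {u\<in>\<sigma>. vnum u < vnum v}) else card {u\<in>\<sigma>. vnum u < vnum v})"
    by (subst card_insert_disjoint[symmetric]) (auto intro!: arg_cong[of _ _ card])
  then show ?thesis by (simp add: ksgn_def)
qed

lemma ksgn_swap:
  assumes "v \<notin> \<sigma>" "w \<notin> \<sigma>" "v \<noteq> w"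
  shows "ksgn w (insert v \<sigma>) * (ksgn v (insert w \<sigma>) * x) = - (ksgn v \<sigma> * (ksgn w \<sigma> * x))"
    and "ksgn v \<sigma> * (ksgn w (insert v \<sigma>) * x) = - (ksgn w \<sigma> * (ksgn v (insert w \<sigma>) * x))"
  using assms inj_vnum[THEN injD, of v w] by (auto simp: ksgn_insert linorder_neq_iff mult.left_commute)

lemma of_int_ksgn: "of_int (ksgn v \<sigma>) = ksgn v \<sigma>"
  by (simp add: ksgn_def)

type_synonym 'n cell = "('n \<Rightarrow>\<^sub>0 nat) \<times> 'n set"

text \<open>
  A function on cells stands for the element \<open>\<Sum> f(m,\<sigma>) x\<^sup>m e\<^sub>\<sigma>\<close> of the Koszul complex.
\<close>

definition kbd :: "('n::finite cell \<Rightarrow> 'r::comm_ring_1) \<Rightarrow> 'n cell \<Rightarrow> 'r" where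
  "kbd f = (\<lambda>(m, \<sigma>). \<Sum>v | v \<notin> \<sigma> \<and> lookup m v \<ge> 1.
     ksgn v \<sigma> * f (m - single v 1, insert v \<sigma>))"

definition mdgr :: "('n \<Rightarrow>\<^sub>0 nat) \<Rightarrow> 'n set \<Rightarrow> 'n \<Rightarrow> nat" where
  "mdgr m \<sigma> v = lookup m v + (if v \<in> \<sigma> then 1 else 0)"

text \<open>
  In multidegree \<open>a\<close>, multiplication by \<open>e\<^sub>v/x\<^sub>v\<close> with \<open>v = \<chi> a\<close>. The choice of \<open>v\<close> may depend on \<open>a\<close>
  because the differential preserves multidegrees.
\<close>

definition kh :: "(('n \<Rightarrow> nat) \<Rightarrow> 'n::finite) \<Rightarrow> ('n cell \<Rightarrow> 'r::comm_ring_1) \<Rightarrow> 'n cell \<Rightarrow> 'r" where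
  "kh \<chi> f = (\<lambda>(m, \<sigma>). let v = \<chi> (mdgr m \<sigma>) in
     if v \<in> \<sigma> then ksgn v (\<sigma> - {v}) * f (m + single v 1, \<sigma> - {v}) else 0)"

lemma kbd_add: "kbd (f + g) = kbd f + kbd g"
  by (auto simp: kbd_def fun_eq_iff algebra_simps sum.distrib)

lemma kbd_diff: "kbd (f - g) = kbd f - kbd g"
  by (auto simp: kbd_def fun_eq_iff algebra_simps sum_subtractf)

lemma kbd_zero: "kbd 0 = 0"
  by (auto simp: kbd_def fun_eq_iff)

lemma kbd_fscale: "kbd (fscale c f) = fscale c (kbd f)"
  by (auto simp: kbd_def fscale_def fun_eq_iff algebra_simps sum_distrib_left)

lemma kbd_red: "kbd (red w) = red (kbd w)"
  by (auto simp: kbd_def red_def fun_eq_iff of_int_ksgn)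

lemma kh_add: "kh \<chi> (f + g) = kh \<chi> f + kh \<chi> g"
  by (auto simp: kh_def Let_def fun_eq_iff algebra_simps)

lemma kh_fscale: "kh \<chi> (fscale c f) = fscale c (kh \<chi> f)"
  by (auto simp: kh_def Let_def fscale_def fun_eq_iff algebra_simps)

lemma kh_red: "kh \<chi> (red w) = red (kh \<chi> w)"
  by (auto simp: kh_def Let_def red_def fun_eq_iff of_int_ksgn)

lemma kh_zero: "kh \<chi> 0 = 0"
  by (auto simp: kh_def Let_def fun_eq_iff)

lemma mdgr_shift:
  assumes "v \<notin> \<sigma>" "lookup m v \<ge> 1"
  shows "mdgr (m - single v 1) (insert v \<sigma>) = mdgr m \<sigma>"
  using assms by (auto simp: mdgr_def fun_eq_iff lookup_minus lookup_single when_def)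

lemma mdgr_shift':
  assumes "v \<in> \<sigma>"
  shows "mdgr (m + single v 1) (\<sigma> - {v}) = mdgr m \<sigma>"
  using assms by (auto simp: mdgr_def fun_eq_iff lookup_add lookup_single when_def)

lemma kbd_kbd: "kbd (kbd f) = 0"
proof
  fix c :: "'a cell"
  obtain m \<sigma> where c: "c = (m, \<sigma>)" by fastforce
  define V where "V = {v. v \<notin> \<sigma> \<and> lookup m v \<ge> 1}"
  define t where "t v w = ksgn v \<sigma> * (ksgn w (insert v \<sigma>) *
      f (m - single v 1 - single w 1, insert w (insert v \<sigma>)))" for v w
  have inner: "{w. w \<notin> insert v \<sigma> \<and> lookup (m - single v 1) w \<ge> 1} = V - {v}" for v
    by (auto simp: V_def lookup_minus lookup_single when_def)
  have swap: "t v w = - t w v" if "v \<in> V" "w \<in> V" "v \<noteq> w" for v w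
    using that ksgn_swap(2)[of v \<sigma> w] unfolding t_def V_def
    by (simp add: diff_right_commute insert_commute)
  have "kbd (kbd f) c = (\<Sum>v\<in>V. \<Sum>w\<in>V - {v}. t v w)"
    unfolding c kbd_def split V_def[symmetric] inner t_def by (simp add: sum_distrib_left)
  also have "\<dots> = (\<Sum>v\<in>V. (\<Sum>w | w \<in> V \<and> vnum w < vnum v. t v w) + (\<Sum>w | w \<in> V \<and> vnum v < vnum w. t v w))"
  proof (rule sum.cong[OF refl])
    fix v
    have split: "V - {v} = {w. w \<in> V \<and> vnum w < vnum v} \<union> {w. w \<in> V \<and> vnum v < vnum w}"
      by (auto simp: not_less le_less inj_eq[OF inj_vnum])
    show "(\<Sum>w\<in>V - {v}. t v w) =
       (\<Sum>w | w \<in> V \<and> vnum w < vnum v. t v w) + (\<Sum>w | w \<in> V \<and> vnum v < vnum w. t v w)"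
      unfolding split by (rule sum.union_disjoint) auto
  qed
  also have "\<dots> = (\<Sum>v\<in>V. \<Sum>w | w \<in> V \<and> vnum w < vnum v. t v w)
     + (\<Sum>v\<in>V. \<Sum>w | w \<in> V \<and> vnum v < vnum w. t v w)"
    by (rule sum.distrib)
  also have "(\<Sum>v\<in>V. \<Sum>w | w \<in> V \<and> vnum v < vnum w. t v w)
     = (\<Sum>w\<in>V. \<Sum>v | v \<in> V \<and> vnum v < vnum w. t v w)"
    using sum.swap_restrict[of V V t "\<lambda>v w. vnum v < vnum w"] by simp
  also have "\<dots> = (\<Sum>w\<in>V. \<Sum>v | v \<in> V \<and> vnum v < vnum w. - t w v)"
    by (intro sum.cong refl) (use swap in auto)
  finally show "kbd (kbd f) c = 0 c" by (simp add: sum_negf)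
qed

text \<open>
  The Koszul differential is a derivation with \<open>e\<^sub>v \<mapsto> x\<^sub>v\<close>, so multiplication by \<open>e\<^sub>v/x\<^sub>v\<close> is a contracting
  homotopy. It is available in the multidegrees in which \<open>v\<close> occurs.
\<close>

lemma koszul_homotopy:
  assumes "mdgr m \<sigma> (\<chi> (mdgr m \<sigma>)) \<ge> 1"
  shows "kbd (kh \<chi> f) (m, \<sigma>) + kh \<chi> (kbd f) (m, \<sigma>) = f (m, \<sigma>)"
proof -
  define v where "v = \<chi> (mdgr m \<sigma>)"
  let ?V = "{w. w \<notin> \<sigma> \<and> lookup m w \<ge> 1}"
  have 1: "kbd (kh \<chi> f) (m, \<sigma>) = (\<Sum>w\<in>?V. ksgn w \<sigma> * (if v \<in> insert w \<sigma> then
      ksgn v (insert w \<sigma> - {v}) * f (m - single w 1 + single v 1, insert w \<sigma> - {v}) else 0))"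
    unfolding kbd_def split
    by (rule sum.cong) (auto simp: kh_def Let_def mdgr_shift v_def)
  show ?thesis
  proof (cases "v \<in> \<sigma>")
    case False
    then have mv: "lookup m v \<ge> 1" using assms by (auto simp: mdgr_def v_def)
    have "kbd (kh \<chi> f) (m, \<sigma>) = (\<Sum>w\<in>?V. if w = v then f (m, \<sigma>) else 0)"
      unfolding 1
    proof (rule sum.cong[OF refl])
      fix w assume "w \<in> ?V"
      have e: "m - single v 1 + single v 1 = m"
        using mv by (intro poly_mapping_eqI) (auto simp: lookup_add lookup_minus lookup_single when_def)
      show "ksgn w \<sigma> * (if v \<in> insert w \<sigma> then
        ksgn v (insert w \<sigma> - {v}) * f (m - single w 1 + single v 1, insert w \<sigma> - {v}) else 0)
        = (if w = v then f (m, \<sigma>) else 0)"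
        using False e by auto
    qed
    also have "\<dots> = f (m, \<sigma>)" using False mv by simp
    finally show ?thesis using False by (simp add: kh_def Let_def v_def)
  next
    case True
    define \<rho> where "\<rho> = \<sigma> - {v}"
    have \<rho>: "\<sigma> = insert v \<rho>" "v \<notin> \<rho>" using True by (auto simp: \<rho>_def)
    let ?t = "\<lambda>w. ksgn v \<rho> * (ksgn w \<rho> * f (m + single v 1 - single w 1, insert w \<rho>))"
    have V: "{w. w \<notin> \<rho> \<and> lookup (m + single v 1) w \<ge> 1} = insert v ?V"
      using \<rho> by (auto simp: lookup_add lookup_single when_def split: if_splits)
    have "kh \<chi> (kbd f) (m, \<sigma>) = (\<Sum>w\<in>insert v ?V. ?t w)"
      using True unfolding kh_def split Let_def v_def[symmetric] kbd_def
      by (simp only: \<rho>_def[symmetric] V sum_distrib_left if_True)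
    also have "\<dots> = ?t v + (\<Sum>w\<in>?V. ?t w)"
      by (rule sum.insert) (use True in auto)
    also have "?t v = f (m, \<sigma>)" using \<rho> by simp
    finally have 2: "kh \<chi> (kbd f) (m, \<sigma>) = f (m, \<sigma>) + (\<Sum>w\<in>?V. ?t w)" .
    have "kbd (kh \<chi> f) (m, \<sigma>) = (\<Sum>w\<in>?V. - ?t w)"
      unfolding 1
    proof (rule sum.cong[OF refl])
      fix w assume w: "w \<in> ?V"
      have e: "m - single w 1 + single v 1
          = m + single v 1 - single w 1"
        using w True by (intro poly_mapping_eqI) (auto simp: lookup_add lookup_minus lookup_single when_def)
      have "w \<notin> \<rho>" "v \<noteq> w" "insert w \<sigma> - {v} = insert w \<rho>" using w True by (auto simp: \<rho>_def)
      then show "ksgn w \<sigma> * (if v \<in> insert w \<sigma> then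
        ksgn v (insert w \<sigma> - {v}) * f (m - single w 1 + single v 1, insert w \<sigma> - {v}) else 0)
        = - ?t w"
        using True ksgn_swap(1)[OF \<rho>(2), of w] unfolding e \<rho>(1) by simp
    qed
    then show ?thesis using 2 by (simp add: sum_negf)
  qed
qed

definition kcells :: "('n::finite \<Rightarrow>\<^sub>0 nat) set \<Rightarrow> nat \<Rightarrow> nat \<Rightarrow> 'n cell set" where
  "kcells M i j = {(m, \<sigma>). m \<in> M \<and> card \<sigma> = i \<and> mdeg m + i = j}"

definition kch :: "('n::finite \<Rightarrow>\<^sub>0 nat) set \<Rightarrow> nat \<Rightarrow> nat \<Rightarrow> ('n cell \<Rightarrow> 'r::comm_ring_1) set" where
  "kch M i j = {f. \<forall>c. f c \<noteq> 0 \<longrightarrow> c \<in> kcells M i j}"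

lemma kchI: "(\<And>m \<sigma>. f (m, \<sigma>) \<noteq> 0 \<Longrightarrow> m \<in> M \<and> card \<sigma> = i \<and> mdeg m + i = j) \<Longrightarrow> f \<in> kch M i j"
  by (auto simp: kch_def kcells_def)

lemma kchD: "f \<in> kch M i j \<Longrightarrow> f (m, \<sigma>) \<noteq> 0 \<Longrightarrow> m \<in> M \<and> card \<sigma> = i \<and> mdeg m + i = j"
  by (auto simp: kch_def kcells_def)

lemma finite_kcells: "finite (kcells M i j)"
proof -
  have "kcells M i j \<subseteq> {m. mdeg m \<le> j} \<times> UNIV" by (auto simp: kcells_def)
  then show ?thesis by (rule finite_subset) (intro finite_cartesian_product finite_mdeg finite_UNIV)
qed

lemma kch_mono: "M \<subseteq> M' \<Longrightarrow> f \<in> kch M i j \<Longrightarrow> f \<in> kch M' i j"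
  by (auto simp: kch_def kcells_def)

lemma kch_add: "f \<in> kch M i j \<Longrightarrow> g \<in> kch M i j \<Longrightarrow> f + g \<in> kch M i j"
  and kch_diff: "f \<in> kch M i j \<Longrightarrow> g \<in> kch M i j \<Longrightarrow> f - g \<in> kch M i j"
  and kch_zero: "0 \<in> kch M i j"
  and kch_fscale: "f \<in> kch M i j \<Longrightarrow> fscale c f \<in> kch M i j"
  and kch_red: "w \<in> kch M i j \<Longrightarrow> red w \<in> kch M i j"
      apply (auto simp: kch_def fscale_def red_def)
  apply (metis add.left_neutral)
  apply (metis diff_self)
  apply (metis mult_zero_right)
  apply (metis of_int_0)
  done

definition upclosed :: "('n \<Rightarrow>\<^sub>0 nat) set \<Rightarrow> bool" where
  "upclosed M \<longleftrightarrow> (\<forall>m\<in>M. \<forall>q. m + q \<in> M)"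

lemma upclosedD: "upclosed M \<Longrightarrow> m \<in> M \<Longrightarrow> m + q \<in> M"
  by (simp add: upclosed_def)

lemma minus_single_plus:
  "lookup m v \<ge> 1 \<Longrightarrow> m - single v (1::nat) + single v 1 = m"
  by (intro poly_mapping_eqI) (auto simp: lookup_add lookup_minus lookup_single when_def)

lemma mdeg_single [simp]: "mdeg (single v n) = n"
  by (simp add: mdeg_def lookup_single when_def)

lemma kbd_nonzero:
  assumes "kbd f (m, \<sigma>) \<noteq> 0"
  obtains v where "v \<notin> \<sigma>" "lookup m v \<ge> 1" "f (m - single v 1, insert v \<sigma>) \<noteq> 0"
  using assms unfolding kbd_def split by (metis (mono_tags, lifting) mem_Collect_eq mult_zero_right sum.neutral)

lemma kbd_kch:
  assumes "upclosed M" "f \<in> kch M (Suc i) j"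
  shows "kbd f \<in> kch M i j"
proof (rule kchI)
  fix m \<sigma> assume "kbd f (m, \<sigma>) \<noteq> 0"
  then obtain v where v: "v \<notin> \<sigma>" "lookup m v \<ge> 1"
    "f (m - single v 1, insert v \<sigma>) \<noteq> 0" by (rule kbd_nonzero)
  have m: "m - single v 1 + single v 1 = m" by (rule minus_single_plus[OF v(2)])
  have f: "m - single v 1 \<in> M" "card (insert v \<sigma>) = Suc i"
    "mdeg (m - single v 1) + Suc i = j" using kchD[OF assms(2) v(3)] by auto
  have "m \<in> M" using upclosedD[OF assms(1) f(1), of "single v 1"] m by simp
  moreover have "mdeg m = mdeg (m - single v 1) + 1"
    using mdeg_add[of "m - single v 1" "single v 1"] m by simp
  ultimately show "m \<in> M \<and> card \<sigma> = i \<and> mdeg m + i = j" using f v(1) by simp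
qed

lemma kbd_kch_0:
  fixes f :: "'n::finite cell \<Rightarrow> 'r::comm_ring_1"
  assumes f: "f \<in> kch M 0 j"
  shows "kbd f = 0"
proof
  fix c :: "'n cell"
  obtain m \<sigma> where c: "c = (m, \<sigma>)" by fastforce
  show "kbd f c = 0 c"
  proof (rule ccontr)
    assume "kbd f c \<noteq> 0 c"
    then have "kbd f (m, \<sigma>) \<noteq> 0" by (simp add: c)
    then obtain v where "f (m - single v 1, insert v \<sigma>) \<noteq> 0" by (rule kbd_nonzero)
    then show False using kchD[OF f] by fastforce
  qed
qed

lemma kh_kch:
  assumes "f \<in> kch M i j"
    and "\<And>m \<sigma>. m + single (\<chi> (mdgr m \<sigma>)) 1 \<in> M \<Longrightarrow> \<chi> (mdgr m \<sigma>) \<in> \<sigma> \<Longrightarrow>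
      f (m + single (\<chi> (mdgr m \<sigma>)) 1, \<sigma> - {\<chi> (mdgr m \<sigma>)}) \<noteq> 0 \<Longrightarrow> m \<in> M'"
  shows "kh \<chi> f \<in> kch M' (Suc i) j"
proof (rule kchI)
  fix m \<sigma> assume nz: "kh \<chi> f (m, \<sigma>) \<noteq> 0"
  let ?v = "\<chi> (mdgr m \<sigma>)"
  have v: "?v \<in> \<sigma>" and f: "f (m + single ?v 1, \<sigma> - {?v}) \<noteq> 0"
    using nz by (auto simp: kh_def Let_def split: if_splits)
  have "card \<sigma> = Suc (card (\<sigma> - {?v}))" using v by (metis card.remove finite)
  then show "m \<in> M' \<and> card \<sigma> = Suc i \<and> mdeg m + Suc i = j"
    using kchD[OF assms(1) f] assms(2)[OF _ v f] by (auto simp: mdeg_add)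
qed

section \<open>Integral cycles\<close>

text \<open>
  Equivalently, the integral homology of the cells over \<open>M\<close>, tensored with the field, maps onto the
  homology over the field.
\<close>

definition cycles_lift :: "'k::field itself \<Rightarrow> ('n::finite \<Rightarrow>\<^sub>0 nat) set \<Rightarrow> bool" where
  "cycles_lift k M \<longleftrightarrow> (\<forall>i j. \<forall>z \<in> (kch M i j :: ('n cell \<Rightarrow> 'k) set). kbd z = 0 \<longrightarrow>
     z \<in> fs.span (red ` {w \<in> kch M i j. kbd w = 0}))"

lemma cycles_liftD:
  assumes "cycles_lift TYPE('k::field) M" "z \<in> kch M i j" "kbd z = 0"
  shows "(z :: 'n::finite cell \<Rightarrow> 'k) \<in> fs.span (red ` {w \<in> kch M i j. kbd w = 0})"
  using assms by (simp add: cycles_lift_def)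

lemma span_cycles_mono:
  assumes "M \<subseteq> M'" "z \<in> fs.span (red ` {w \<in> kch M i j. kbd w = 0})"
  shows "z \<in> fs.span (red ` {w \<in> kch M' i j. kbd w = 0})"
  using assms(2) by (rule set_mp[OF fs.span_mono, rotated]) (use kch_mono[OF assms(1)] in auto)

lemma kh_nonzero:
  assumes "kh \<chi> f (m, \<sigma>) \<noteq> 0"
  obtains v where "v \<in> \<sigma>" "f (m + single v 1, \<sigma> - {v}) \<noteq> 0"
proof -
  have "\<chi> (mdgr m \<sigma>) \<in> \<sigma>" "f (m + single (\<chi> (mdgr m \<sigma>)) 1, \<sigma> - {\<chi> (mdgr m \<sigma>)}) \<noteq> 0"
    using assms by (auto simp: kh_def Let_def split: if_splits)
  then show thesis by (rule that)
qed

text \<open>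
  If \<open>x\<^sub>v\<close> divides all monomials of \<open>M\<close>, then \<open>v\<close> occurs in every multidegree of a chain on \<open>M\<close>, and a cycle
  bounds its cone over \<open>v\<close>.
\<close>

lemma cone_cycle:
  assumes f: "f \<in> kch M i j" "kbd f = 0" and v: "\<And>m. m \<in> M \<Longrightarrow> lookup m v \<ge> 1"
  shows "kbd (kh (\<lambda>_. v) f) = f"
proof (rule ext, clarify)
  fix m \<sigma>
  show "kbd (kh (\<lambda>_. v) f) (m, \<sigma>) = f (m, \<sigma>)"
  proof (cases "mdgr m \<sigma> v \<ge> 1")
    case True
    then show ?thesis
      using koszul_homotopy[of m \<sigma> "\<lambda>_. v" f] f(2) by (simp add: kh_zero)
  next
    case False
    then have v0: "v \<notin> \<sigma>" "\<not> lookup m v \<ge> 1" by (auto simp: mdgr_def split: if_splits)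
    then have "f (m, \<sigma>) = 0" using v kchD[OF f(1)] by blast
    moreover have "kbd (kh (\<lambda>_. v) f) (m, \<sigma>) = 0"
    proof (rule ccontr)
      assume "kbd (kh (\<lambda>_. v) f) (m, \<sigma>) \<noteq> 0"
      then obtain w where "lookup m w \<ge> 1"
        "kh (\<lambda>_. v) f (m - single w 1, insert w \<sigma>) \<noteq> 0" by (rule kbd_nonzero)
      then show False using v0 by (auto simp: kh_def split: if_splits)
    qed
    ultimately show ?thesis by simp
  qed
qed

lemma cone_kch:
  assumes "f \<in> kch M i j" and "\<And>m. m \<in> M \<Longrightarrow> m - single v 1 \<in> M'"
  shows "kh (\<lambda>_. v) f \<in> kch M' (Suc i) j"
proof (rule kh_kch[OF assms(1)])
  fix m assume "m + single v 1 \<in> M"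
  then show "m \<in> M'" using assms(2)[of "m + single v 1"] by simp
qed

lemma kch_Int: "f \<in> kch A i j \<Longrightarrow> f \<in> kch B i j \<Longrightarrow> f \<in> kch (A \<inter> B) i j"
  by (auto simp: kch_def kcells_def)

text \<open>
  A Mayer--Vietoris argument. The two cones make both maps out of the homology of \<open>A \<inter> B\<close> vanish, and
  they do so over the integers. Hence a cycle on \<open>A \<union> B\<close> splits into a cycle on \<open>A\<close>, one on \<open>B\<close>, and the
  union of the two cones over an integral cycle of \<open>A \<inter> B\<close>.
\<close>

lemma cycles_lift_union:
  fixes A B :: "('n::finite \<Rightarrow>\<^sub>0 nat) set"
  assumes up: "upclosed A" "upclosed B"
    and lift: "cycles_lift TYPE('k::field) A" "cycles_lift TYPE('k) B" "cycles_lift TYPE('k) (A \<inter> B)"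
    and v: "\<And>m. m \<in> A \<inter> B \<Longrightarrow> lookup m v \<ge> 1"
      "\<And>m. m \<in> A \<inter> B \<Longrightarrow> m - single v 1 \<in> A"
    and w: "\<And>m. m \<in> A \<inter> B \<Longrightarrow> lookup m w \<ge> 1"
      "\<And>m. m \<in> A \<inter> B \<Longrightarrow> m - single w 1 \<in> B"
  shows "cycles_lift TYPE('k) (A \<union> B)"
  unfolding cycles_lift_def
proof (intro allI ballI impI)
  fix i j and z :: "'n cell \<Rightarrow> 'k" assume z: "z \<in> kch (A \<union> B) i j" "kbd z = 0"
  let ?S = "fs.span (red ` {w \<in> kch (A \<union> B) i j. kbd w = 0}) :: ('n cell \<Rightarrow> 'k) set"
  define a where "a = (\<lambda>(m, \<sigma>). if m \<in> A then z (m, \<sigma>) else 0)"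
  define b where "b = z - a"
  have a: "a \<in> kch A i j" using kchD[OF z(1)] by (intro kchI) (auto simp: a_def split: if_splits)
  have b: "b \<in> kch B i j"
  proof (rule kchI)
    fix m \<sigma> assume "b (m, \<sigma>) \<noteq> 0"
    then have "z (m, \<sigma>) \<noteq> 0" "m \<notin> A" by (auto simp: b_def a_def split: if_splits)
    then show "m \<in> B \<and> card \<sigma> = i \<and> mdeg m + i = j" using kchD[OF z(1)] by blast
  qed
  have AS: "x \<in> ?S" if "x \<in> kch A i j" "kbd x = 0" for x
    by (rule span_cycles_mono[OF _ cycles_liftD[OF lift(1) that]]) auto
  have BS: "x \<in> ?S" if "x \<in> kch B i j" "kbd x = 0" for x
    by (rule span_cycles_mono[OF _ cycles_liftD[OF lift(2) that]]) auto
  have kb: "kbd b = - kbd a" using z(2) by (simp add: b_def kbd_diff)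
  show "z \<in> ?S"
  proof (cases i)
    case 0
    then have "kbd a = 0" "kbd b = 0" using a b kbd_kch_0 by metis+
    then have "a + b \<in> ?S" by (intro fs.span_add AS BS a b)
    then show ?thesis by (simp add: b_def)
  next
    case (Suc i')
    define c where "c = kbd a"
    let ?h = "kh (\<lambda>_. v)" and ?h' = "kh (\<lambda>_. w)"
    have "c \<in> kch A i' j" unfolding c_def using kbd_kch[OF up(1)] a Suc by blast
    moreover have "c \<in> kch B i' j"
    proof -
      have "c = 0 - kbd b" using kb by (simp add: c_def)
      then show ?thesis using kch_diff[OF kch_zero kbd_kch[OF up(2)]] b Suc by blast
    qed
    ultimately have c: "c \<in> kch (A \<inter> B) i' j" by (rule kch_Int)
    have kc: "kbd c = 0" by (simp add: c_def kbd_kbd)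
    have hA: "?h x \<in> kch A i j" and hB: "?h' x \<in> kch B i j" if "x \<in> kch (A \<inter> B) i' j" for x :: "'n cell \<Rightarrow> 'r::comm_ring_1"
      using cone_kch[OF that, of v A] cone_kch[OF that, of w B] v(2) w(2) Suc by auto
    have hc: "kbd (?h c) = c" "kbd (?h' c) = c"
      by (rule cone_cycle[OF c kc v(1)], assumption) (rule cone_cycle[OF c kc w(1)])
    have 1: "a - ?h c \<in> ?S"
      by (intro AS kch_diff a hA[OF c]) (simp add: kbd_diff hc c_def[symmetric])
    have 2: "b + ?h' c \<in> ?S"
      by (intro BS kch_add b hB[OF c]) (simp add: kbd_add kb hc c_def[symmetric])
    have "x \<in> fs.span (red ` {w \<in> kch (A \<inter> B) i' j. kbd w = 0}) \<Longrightarrow> ?h x - ?h' x \<in> ?S" for x :: "'n cell \<Rightarrow> 'k"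
    proof (induction rule: fs.span_induct)
      case base
      show ?case
        unfolding fs.subspace_def mem_Collect_eq
      proof (intro conjI ballI allI)
        show "?h 0 - ?h' 0 \<in> ?S" by (simp add: kh_zero fs.span_zero)
      next
        fix x y :: "'n cell \<Rightarrow> 'k" assume "x \<in> {x. ?h x - ?h' x \<in> ?S}" "y \<in> {x. ?h x - ?h' x \<in> ?S}"
        then have "(?h x - ?h' x) + (?h y - ?h' y) \<in> ?S" by (intro fs.span_add) auto
        then show "?h (x + y) - ?h' (x + y) \<in> ?S" by (simp add: kh_add algebra_simps)
      next
        fix r and x :: "'n cell \<Rightarrow> 'k" assume "x \<in> {x. ?h x - ?h' x \<in> ?S}"
        then have "fscale r (?h x - ?h' x) \<in> ?S" by (intro fs.span_scale) auto
        then show "?h (fscale r x) - ?h' (fscale r x) \<in> ?S"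
          by (simp add: kh_fscale fs.scale_right_diff_distrib)
      qed
    next
      case (step x)
      then obtain y where y: "x = red y" "y \<in> kch (A \<inter> B) i' j" "kbd y = 0" by auto
      have hy: "kbd (?h y) = y" "kbd (?h' y) = y"
        by (rule cone_cycle[OF y(2,3) v(1)], assumption) (rule cone_cycle[OF y(2,3) w(1)])
      have "?h y - ?h' y \<in> kch (A \<union> B) i j"
        by (rule kch_diff; rule kch_mono[rotated], rule hA hB, rule y(2)) auto
      moreover have "kbd (?h y - ?h' y) = 0"
        by (simp add: kbd_diff hy)
      ultimately have "red (?h y - ?h' y) \<in> ?S" by (intro fs.span_base) auto
      moreover have "red (?h y - ?h' y) = ?h x - ?h' x"
        unfolding y(1) kh_red by (auto simp: red_def fun_eq_iff)
      ultimately show ?case by (simp only:)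
    qed
    then have 3: "?h c - ?h' c \<in> ?S" using cycles_liftD[OF lift(3) c kc] by blast
    have eq: "z = (a - ?h c) + (b + ?h' c) + (?h c - ?h' c)" by (simp add: b_def)
    show ?thesis by (subst eq) (intro fs.span_add 1 2 3)
  qed
qed

section \<open>Linear quotients\<close>

definition up :: "('n \<Rightarrow>\<^sub>0 nat) \<Rightarrow> ('n \<Rightarrow>\<^sub>0 nat) set" where
  "up u = {m. \<forall>v. lookup u v \<le> lookup m v}"

lemma upclosed_up: "upclosed (up u)"
  by (auto simp: upclosed_def up_def lookup_add trans_le_add1)

lemma upclosed_Un: "upclosed A \<Longrightarrow> upclosed B \<Longrightarrow> upclosed (A \<union> B)"
  by (auto simp: upclosed_def)

lemma up_mdeg: "m \<in> up u \<Longrightarrow> mdeg u \<le> mdeg m"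
  by (auto simp: up_def mdeg_def intro: sum_mono)

lemma up_mdeg_eq:
  assumes "m \<in> up u" "mdeg m = mdeg u"
  shows "m = u"
proof (rule poly_mapping_eqI)
  fix v
  have "\<not> (\<exists>v. lookup u v < lookup m v)"
    using assms sum_strict_mono_ex1[of UNIV "lookup u" "lookup m"]
    by (auto simp: up_def mdeg_def)
  then show "lookup m v = lookup u v"
    using assms(1) by (auto simp: up_def not_less intro: antisym)
qed

text \<open>
  The monomial ideal is built from generators \<open>u\<close> of one degree such that each colon ideal
  \<open>M : u\<close> by the generators before \<open>u\<close> is generated by the variables in a set \<open>A\<close>.
\<close>

inductive linear_quotients :: "nat \<Rightarrow> ('n::finite \<Rightarrow>\<^sub>0 nat) set \<Rightarrow> bool" for g where
  empty: "linear_quotients g {}"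
| add: "linear_quotients g M \<Longrightarrow> mdeg u = g \<Longrightarrow>
    (\<And>m. m \<in> up u \<Longrightarrow> m \<in> M \<longleftrightarrow> (\<exists>v\<in>A. lookup u v < lookup m v)) \<Longrightarrow>
    linear_quotients g (M \<union> up u)"

lemma linear_quotients_upclosed: "linear_quotients g M \<Longrightarrow> upclosed M"
  by (induction rule: linear_quotients.induct) (auto intro!: upclosed_Un upclosed_up, auto simp: upclosed_def)

text \<open>
  The cells of \<open>up u\<close> outside \<open>M\<close> carry, up to a shift, the Koszul complex of the polynomial ring in
  the variables outside \<open>A\<close>, tensored with the exterior algebra on \<open>A\<close>. Its homology is carried by the
  cells with the monomial \<open>u\<close> itself, so that cycles of any other degree can be moved into \<open>M\<close>.
\<close>

lemma push_into_colon:
  fixes z :: "'n::finite cell \<Rightarrow> 'r::comm_ring_1"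
  assumes M: "upclosed M"
    and colon: "\<And>m. m \<in> up u \<Longrightarrow> m \<in> M \<longleftrightarrow> (\<exists>v\<in>A. lookup u v < lookup m v)"
    and z: "z \<in> kch (M \<union> up u) i j" "kbd z = 0" and j: "j \<noteq> i + mdeg u"
  obtains y where "y \<in> kch (M \<union> up u) (Suc i) j" "z - kbd y \<in> kch M i j"
proof -
  define R where "R = up u - M"
  \<comment> \<open>In a good multidegree some variable outside \<open>A\<close> can be divided out without leaving \<open>up u\<close>.\<close>
  define good where "good a \<longleftrightarrow> (\<exists>v. v \<notin> A \<and> lookup u v < a v)" for a
  define \<chi> where "\<chi> a = (SOME v. v \<notin> A \<and> lookup u v < a v)" for a
  have \<chi>: "\<chi> a \<notin> A" "lookup u (\<chi> a) < a (\<chi> a)" if "good a" for a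
    using someI_ex[OF that[unfolded good_def]] unfolding \<chi>_def by auto
  define zg where "zg = (\<lambda>(m, \<sigma>). if m \<in> R \<and> good (mdgr m \<sigma>) then z (m, \<sigma>) else 0)"
  define y where "y = kh \<chi> zg"
  have RA: "lookup m v = lookup u v" if "m \<in> R" "v \<in> A" for m v
    using that colon[of m] unfolding R_def up_def by (auto simp: not_less intro: antisym)
  have zg: "zg \<in> kch R i j"
    using kchD[OF z(1)] by (intro kchI) (auto simp: zg_def split: if_splits)
  have y: "y \<in> kch (M \<union> up u) (Suc i) j"
    unfolding y_def
  proof (rule kh_kch[OF zg])
    fix m \<sigma>
    let ?v = "\<chi> (mdgr m \<sigma>)"
    assume R: "m + single ?v 1 \<in> R" and v: "?v \<in> \<sigma>"
      and nz: "zg (m + single ?v 1, \<sigma> - {?v}) \<noteq> 0"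
    have "good (mdgr m \<sigma>)" using nz by (auto simp: zg_def mdgr_shift'[OF v] split: if_splits)
    then have "lookup u ?v \<le> lookup m ?v"
      using \<chi>(2)[of "mdgr m \<sigma>"] v by (simp add: mdgr_def)
    moreover have "lookup u w \<le> lookup m w" if "w \<noteq> ?v" for w
      using R that unfolding R_def up_def by (auto simp: lookup_add lookup_single when_def dest!: spec[of _ w])
    ultimately have "lookup u w \<le> lookup m w" for w
      by (cases "w = ?v") simp_all
    then have "m \<in> up u" by (simp add: up_def)
    then show "m \<in> M \<union> up u" by simp
  qed
  have kzg: "kbd zg (m, \<sigma>) = 0" if m: "m \<in> R" and g: "good (mdgr m \<sigma>)" for m \<sigma>
  proof -
    have "kbd zg (m, \<sigma>) = kbd z (m, \<sigma>)"
      unfolding kbd_def split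
    proof (rule sum.cong[OF refl])
      fix w assume w: "w \<in> {v. v \<notin> \<sigma> \<and> 1 \<le> lookup m v}"
      let ?m = "m - single w 1"
      have "?m \<notin> M" using upclosedD[OF M, of ?m "single w 1"] minus_single_plus[of m w] w m
        by (auto simp: R_def)
      then have "z (?m, insert w \<sigma>) = 0 \<or> ?m \<in> R" using kchD[OF z(1)] by (auto simp: R_def)
      then show "ksgn w \<sigma> * zg (?m, insert w \<sigma>) = ksgn w \<sigma> * z (?m, insert w \<sigma>)"
        using w g by (auto simp: zg_def mdgr_shift)
    qed
    then show ?thesis using z(2) by simp
  qed
  have "z - kbd y \<in> kch M i j"
  proof (rule kchI)
    fix m \<sigma> assume nz: "(z - kbd y) (m, \<sigma>) \<noteq> 0"
    have "z - kbd y \<in> kch (M \<union> up u) i j"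
      by (intro kch_diff z(1) kbd_kch[OF upclosed_Un[OF M upclosed_up] y])
    then have m: "m \<in> M \<union> up u" "card \<sigma> = i \<and> mdeg m + i = j" 
      using kchD[of "z - kbd y", OF _ nz] by auto
    have "m \<in> M"
    proof (rule ccontr)
      assume "m \<notin> M"
      then have mR: "m \<in> R" using m by (simp add: R_def)
      have "(z - kbd y) (m, \<sigma>) = 0"
      proof (cases "good (mdgr m \<sigma>)")
        case True
        let ?v = "\<chi> (mdgr m \<sigma>)"
        have "kh \<chi> (kbd zg) (m, \<sigma>) = 0"
        proof (cases "?v \<in> \<sigma>")
          case v: True
          have "m + single ?v 1 \<in> up u" using mR by (intro upclosedD[OF upclosed_up]) (simp add: R_def)
          moreover have "m + single ?v 1 \<notin> M"
            using colon[OF calculation] RA[OF mR] \<chi>(1)[OF True]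
            by (auto simp: lookup_add lookup_single when_def split: if_splits)
          ultimately have "kbd zg (m + single ?v 1, \<sigma> - {?v}) = 0"
            by (intro kzg) (simp_all add: R_def mdgr_shift'[OF v] True)
          then show ?thesis by (simp add: kh_def Let_def)
        qed (simp add: kh_def)
        moreover have "mdgr m \<sigma> ?v \<ge> 1" using \<chi>(2)[OF True] by linarith
        ultimately show ?thesis using koszul_homotopy[of m \<sigma> \<chi> zg] mR True
          by (simp add: y_def zg_def)
      next
        case False
        have "m = u"
        proof (rule poly_mapping_eqI)
          fix v
          have "lookup m v \<le> lookup u v" if "v \<notin> A"
          proof -
            have "mdgr m \<sigma> v \<le> lookup u v" using that False by (auto simp: good_def not_less)
            then show ?thesis by (simp add: mdgr_def)
          qed
          then show "lookup m v = lookup u v"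
            using RA[OF mR] mR by (cases "v \<in> A") (auto simp: R_def up_def intro: antisym)
        qed
        then have "z (m, \<sigma>) = 0" using m(2) j by auto
        moreover have "kbd y (m, \<sigma>) = 0"
        proof (rule ccontr)
          assume "kbd y (m, \<sigma>) \<noteq> 0"
          then obtain w where w: "w \<notin> \<sigma>" "lookup m w \<ge> 1"
            "y (m - single w 1, insert w \<sigma>) \<noteq> 0" by (rule kbd_nonzero)
          then obtain v where "v \<in> insert w \<sigma>"
            "zg (m - single w 1 + single v 1, insert w \<sigma> - {v}) \<noteq> 0"
            unfolding y_def by (auto elim: kh_nonzero)
          then show False using False by (auto simp: zg_def mdgr_shift'  mdgr_shift w split: if_splits)
        qed
        ultimately show ?thesis by simp
      qed
      then show False using nz by simp
    qed
    then show "m \<in> M \<and> card \<sigma> = i \<and> mdeg m + i = j" using m by simp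
  qed
  then show thesis using that y by blast
qed

text \<open>
  A cycle outside the linear strand is pushed down through the generators, the last one first, until
  nothing is left. The argument applies to the field and to the integers alike.
\<close>

lemma linear_quotients_acyclic:
  fixes z :: "'n::finite cell \<Rightarrow> 'r::comm_ring_1"
  assumes "linear_quotients g M" "z \<in> kch M i j" "kbd z = 0" "j \<noteq> i + g"
  obtains y where "y \<in> kch M (Suc i) j" "kbd y = z"
proof -
  have "\<exists>y \<in> kch M (Suc i) j. kbd y = z"
    using assms
  proof (induction arbitrary: z rule: linear_quotients.induct)
    case empty
    then have "z = 0" by (intro ext) (auto simp: kch_def kcells_def)
    then show ?case by (intro bexI[of _ 0]) (simp_all only: kch_zero kbd_zero)
  next
    case (add M u A)
    obtain y where y: "y \<in> kch (M \<union> up u) (Suc i) j" "z - kbd y \<in> kch M i j"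
      using push_into_colon[OF linear_quotients_upclosed[OF add.hyps(1)] add.hyps(3) add.prems(1,2)]
        add.prems(3) add.hyps(2) by auto
    have "kbd (z - kbd y) = 0" by (simp only: kbd_diff add.prems(2) kbd_kbd diff_self)
    then obtain y' where y': "y' \<in> kch M (Suc i) j" "kbd y' = z - kbd y"
      using add.IH[OF y(2)] add.prems(3) by blast
    have "y' + y \<in> kch (M \<union> up u) (Suc i) j"
      by (rule kch_add[OF kch_mono[OF _ y'(1)] y(1)]) auto
    moreover have "kbd (y' + y) = z" by (simp add: kbd_add y'(2))
    ultimately show ?case by blast
  qed
  then show thesis using that by blast
qed

definition delta :: "'c \<Rightarrow> 'c \<Rightarrow> int" where
  "delta c = (\<lambda>x. if x = c then 1 else 0)"

lemma delta_kch: "c \<in> kcells M i j \<Longrightarrow> delta c \<in> kch M i j"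
  by (auto simp: kch_def delta_def)

lemma kch_span_delta:
  fixes f :: "'n::finite cell \<Rightarrow> 'k::field"
  assumes "f \<in> kch M i j"
  shows "f \<in> fs.span (red ` delta ` kcells M i j)"
proof -
  have "f = (\<Sum>c\<in>kcells M i j. fscale (f c) (red (delta c)))"
  proof
    fix x
    have "(\<Sum>c\<in>kcells M i j. fscale (f c) (red (delta c))) x = (\<Sum>c\<in>kcells M i j. if c = x then f x else 0)"
      by (auto simp: sum_apply fscale_def red_def delta_def intro!: sum.cong)
    also have "\<dots> = f x"
    proof -
      have "x \<notin> kcells M i j \<Longrightarrow> f x = 0" using assms unfolding kch_def by blast
      then show ?thesis by (auto simp: finite_kcells)
    qed
    finally show "f x = (\<Sum>c\<in>kcells M i j. fscale (f c) (red (delta c))) x" by simp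
  qed
  also have "\<dots> \<in> fs.span (red ` delta ` kcells M i j)"
    by (intro fs.span_sum fs.span_scale fs.span_base) auto
  finally show ?thesis .
qed

lemma linear_kbd: "Vector_Spaces.linear fscale fscale (kbd :: ('n::finite cell \<Rightarrow> 'k::field) \<Rightarrow> _)"
  by (intro Vector_Spaces.linear.intro module_hom.intro module_hom_axioms.intro vector_space_fscale
      vector_space_fscale[unfolded module_iff_vector_space[symmetric]] kbd_add kbd_fscale)

lemma kbd_span:
  fixes f :: "'n::finite cell \<Rightarrow> 'k::field"
  assumes "f \<in> kch M i j"
  shows "kbd f \<in> fs.span (red ` (\<lambda>c. kbd (delta c)) ` kcells M i j)"
proof -
  interpret Vector_Spaces.linear fscale fscale "kbd :: ('n::finite cell \<Rightarrow> 'k::field) \<Rightarrow> _" by (rule linear_kbd)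
  have "kbd f \<in> kbd ` fs.span (red ` delta ` kcells M i j)"
    using kch_span_delta[OF assms] by blast
  also have "\<dots> = fs.span (kbd ` red ` delta ` kcells M i j)" by (rule span_image[symmetric])
  finally show ?thesis by (simp add: image_image kbd_red)
qed

lemma kch_subset:
  assumes "f \<in> kch M' i j" "\<And>m \<sigma>. m \<in> M' \<Longrightarrow> m \<notin> M \<Longrightarrow> f (m, \<sigma>) = 0"
  shows "f \<in> kch M i j"
  using assms kchD[OF assms(1)] by (intro kchI) blast

text \<open>
  In the linear strand, a cycle that involves the last generator \<open>u\<close> does so in cells \<open>x\<^sup>u e\<^sub>\<sigma>\<close> with
  \<open>\<sigma> \<subseteq> A\<close>. The boundary of such a cell lies over the earlier generators and leaves the linear strand there, so it
  bounds an integral chain. Hence each of these cells completes to an integral cycle.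
\<close>

lemma linear_quotients_cycles_lift:
  fixes M :: "('n::finite \<Rightarrow>\<^sub>0 nat) set"
  assumes "linear_quotients g M"
  shows "cycles_lift TYPE('k::field) M"
proof -
  have top: "z \<in> fs.span (red ` {w \<in> kch M i (i + g). kbd w = 0})"
    if "z \<in> kch M i (i + g)" "kbd z = 0" for i and z :: "'n cell \<Rightarrow> 'k"
    using assms that
  proof (induction arbitrary: z rule: linear_quotients.induct)
    case empty
    then have "z = 0" by (intro ext) (auto simp: kch_def kcells_def)
    then show ?case by (simp only: fs.span_zero)
  next
    case (add M u A)
    let ?S = "fs.span (red ` {w \<in> kch (M \<union> up u) i (i + g). kbd w = 0}) :: ('n cell \<Rightarrow> 'k) set"
    have uup: "u \<in> up u" by (simp add: up_def)
    have uM: "u \<notin> M" using add.hyps(3)[OF uup] by simp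
    have upM: "upclosed M" by (rule linear_quotients_upclosed[OF add.hyps(1)])
    have only_u: "m = u" if "m \<in> M \<union> up u" "m \<notin> M" "mdeg m = g" for m
      using that up_mdeg_eq[of m u] add.hyps(2) by auto
    have vA: "v \<in> A" if "u + single v 1 \<in> M" for v
      using add.hyps(3)[OF upclosedD[OF upclosed_up uup], of "single v 1"] that
      by (auto simp: lookup_add lookup_single when_def split: if_splits)
    have sub: "\<sigma> \<subseteq> A" if nz: "z (u, \<sigma>) \<noteq> 0" for \<sigma>
    proof
      fix v assume v: "v \<in> \<sigma>"
      show "v \<in> A"
      proof (rule ccontr)
        assume "v \<notin> A"
        then have uv: "u + single v 1 \<notin> M" using vA by blast
        let ?m = "u + single v 1" and ?s = "\<sigma> - {v}"
        have "kbd z (?m, ?s) = (\<Sum>w | w \<notin> ?s \<and> lookup ?m w \<ge> 1.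
            if w = v then ksgn v ?s * z (u, \<sigma>) else 0)"
          unfolding kbd_def split
        proof (rule sum.cong[OF refl])
          fix w assume w: "w \<in> {w. w \<notin> ?s \<and> lookup ?m w \<ge> 1}"
          show "ksgn w ?s * z (?m - single w 1, insert w ?s)
             = (if w = v then ksgn v ?s * z (u, \<sigma>) else 0)"
          proof (cases "w = v")
            case True
            then show ?thesis using v by (simp add: insert_absorb)
          next
            case False
            have m: "?m - single w 1 + single w 1 = ?m"
              using minus_single_plus[of ?m w] w by simp
            have "z (?m - single w 1, insert w ?s) = 0"
            proof (rule ccontr)
              assume "z (?m - single w 1, insert w ?s) \<noteq> 0"
              then have k: "?m - single w 1 \<in> M \<union> up u" "mdeg (?m - single w 1) = g"
                using kchD[OF add.prems(1)] by auto
              have "?m - single w 1 \<notin> M"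
                using upclosedD[OF upM, of "?m - single w 1" "single w 1"] m uv by auto
              then have "?m - single w 1 = u" using only_u k by blast
              then have "u + single w 1 = u + single v 1" using m by simp
              then have "lookup (single w (1::nat)) v
                 = lookup (single v 1) v" by simp
              then show False using False by (simp add: lookup_single)
            qed
            then show ?thesis using False by simp
          qed
        qed
        also have "\<dots> = ksgn v ?s * z (u, \<sigma>)" by (simp add: lookup_add)
        finally have "ksgn v ?s * z (u, \<sigma>) = 0" using fun_cong[OF add.prems(2)] by (simp only: zero_fun_def)
        then have "ksgn v ?s * (ksgn v ?s * z (u, \<sigma>)) = 0" by (simp only: mult_zero_right)
        then show False using nz by (simp only: ksgn_square)
      qed
    qed
    define S where "S = {\<sigma>. card \<sigma> = i \<and> \<sigma> \<subseteq> A}"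
    have "\<exists>y \<in> kch M i (i + g). kbd y = kbd (delta (u, \<sigma>))" if \<sigma>: "\<sigma> \<in> S" for \<sigma>
    proof -
      have dk: "delta (u, \<sigma>) \<in> kch (M \<union> up u) i (i + g)"
        using \<sigma> uup add.hyps(2) by (intro delta_kch) (auto simp: kcells_def S_def)
      show ?thesis
      proof (cases i)
        case 0
        then have "kbd (delta (u, \<sigma>)) = 0" using kbd_kch_0 dk by metis
        then show ?thesis using kch_zero kbd_zero by metis
      next
        case (Suc i')
        have "kbd (delta (u, \<sigma>)) \<in> kch (M \<union> up u) i' (i + g)"
          using kbd_kch[OF upclosed_Un[OF upM upclosed_up]] dk Suc by metis
        then have "kbd (delta (u, \<sigma>)) \<in> kch M i' (i + g)"
        proof (rule kch_subset)
          fix m \<tau> assume "m \<notin> M"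
          show "kbd (delta (u, \<sigma>)) (m, \<tau>) = 0"
          proof (rule ccontr)
            assume "kbd (delta (u, \<sigma>)) (m, \<tau>) \<noteq> 0"
            then obtain v where v: "lookup m v \<ge> 1"
              "delta (u, \<sigma>) (m - single v 1, insert v \<tau>) \<noteq> 0" by (rule kbd_nonzero)
            then have "m - single v 1 = u" "v \<in> \<sigma>" by (auto simp: delta_def split: if_splits)
            then have "m = u + single v 1" "v \<in> A"
              using minus_single_plus[OF v(1)] \<sigma> by (auto simp: S_def)
            then have "m \<in> M"
              using add.hyps(3)[OF upclosedD[OF upclosed_up uup], of "single v 1"]
              by (auto simp: lookup_add lookup_single when_def)
            then show False using \<open>m \<notin> M\<close> by blast
          qed
        qed
        then show ?thesis
          using linear_quotients_acyclic[OF add.hyps(1), of "kbd (delta (u, \<sigma>))" i' "i + g"] Suc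
          by (metis add_Suc kbd_kbd n_not_Suc_n)
      qed
    qed
    then obtain y where y: "\<And>\<sigma>. \<sigma> \<in> S \<Longrightarrow> y \<sigma> \<in> kch M i (i + g)"
        "\<And>\<sigma>. \<sigma> \<in> S \<Longrightarrow> kbd (y \<sigma>) = kbd (delta (u, \<sigma>))"
      by metis
    define c where "c \<sigma> = delta (u, \<sigma>) - y \<sigma>" for \<sigma>
    have c: "c \<sigma> \<in> kch (M \<union> up u) i (i + g)" "kbd (c \<sigma>) = 0" if "\<sigma> \<in> S" for \<sigma>
    proof -
      have "delta (u, \<sigma>) \<in> kch (M \<union> up u) i (i + g)"
        using that uup add.hyps(2) by (intro delta_kch) (auto simp: kcells_def S_def)
      then show "c \<sigma> \<in> kch (M \<union> up u) i (i + g)"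
        unfolding c_def using kch_mono[OF _ y(1)[OF that], of "M \<union> up u"] by (intro kch_diff) auto
      show "kbd (c \<sigma>) = 0" by (simp add: c_def kbd_diff y(2)[OF that])
    qed
    define t where "t = (\<Sum>\<sigma>\<in>S. fscale (z (u, \<sigma>)) (red (c \<sigma>)) :: 'n cell \<Rightarrow> 'k)"
    have finS: "finite S" by simp
    have tS: "t \<in> ?S" unfolding t_def
      by (intro fs.span_sum fs.span_scale fs.span_base) (use c in auto)
    have tk: "t \<in> kch (M \<union> up u) i (i + g)"
    proof -
      have "(\<Sum>\<sigma>\<in>T. fscale (z (u, \<sigma>)) (red (c \<sigma>)) :: 'n cell \<Rightarrow> 'k) \<in> kch (M \<union> up u) i (i + g)" if "T \<subseteq> S" for T
        using finite_subset[OF that finS] that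
        by (induction T rule: finite_induct) (auto intro!: kch_zero kch_add kch_fscale kch_red c)
      then show ?thesis unfolding t_def by blast
    qed
    have kt: "kbd t = 0"
    proof -
      interpret Vector_Spaces.linear fscale fscale "kbd :: ('n::finite cell \<Rightarrow> 'k::field) \<Rightarrow> _" by (rule linear_kbd)
      show ?thesis unfolding t_def sum
      proof (rule sum.neutral, rule ballI)
        fix \<sigma> assume "\<sigma> \<in> S"
        then show "kbd (fscale (z (u, \<sigma>)) (red (c \<sigma>))) = 0"
          unfolding kbd_fscale kbd_red using c(2) by (auto simp: red_def fscale_def fun_eq_iff)
      qed
    qed
    have "z - t \<in> kch M i (i + g)"
    proof (rule kch_subset)
      show "z - t \<in> kch (M \<union> up u) i (i + g)" by (intro kch_diff add.prems(1) tk)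
      fix m \<sigma> assume m: "m \<in> M \<union> up u" "m \<notin> M"
      show "(z - t) (m, \<sigma>) = 0"
      proof (cases "m = u \<and> card \<sigma> = i")
        case False
        then have "z (m, \<sigma>) = 0" "t (m, \<sigma>) = 0"
          using kchD[OF add.prems(1), of m \<sigma>] kchD[OF tk, of m \<sigma>] only_u[OF m] by auto
        then show ?thesis by simp
      next
        case True
        have "t (m, \<sigma>) = (\<Sum>\<tau>\<in>S. if \<tau> = \<sigma> then z (u, \<sigma>) else 0)"
          unfolding t_def sum_apply
        proof (rule sum.cong[OF refl])
          fix \<tau> assume "\<tau> \<in> S"
          then have "y \<tau> (u, \<sigma>) = 0" using kchD[OF y(1)] uM by blast
          then show "fscale (z (u, \<tau>)) (red (c \<tau>)) (m, \<sigma>) = (if \<tau> = \<sigma> then z (u, \<sigma>) else 0)"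
            using True by (auto simp: fscale_def red_def c_def delta_def)
        qed
        also have "\<dots> = z (u, \<sigma>)" using True sub[of \<sigma>] by (auto simp: S_def)
        finally show ?thesis using True by simp
      qed
    qed
    moreover have "kbd (z - t) = 0" by (simp only: kbd_diff add.prems(2) kt diff_self)
    ultimately have "z - t \<in> ?S" by (intro span_cycles_mono[OF _ add.IH]) blast
    then have "(z - t) + t \<in> ?S" by (rule fs.span_add[OF _ tS])
    then show ?case by (simp only: diff_add_cancel)
  qed
  show ?thesis
    unfolding cycles_lift_def
  proof (intro allI ballI impI)
    fix i j and z :: "'n cell \<Rightarrow> 'k" assume z: "z \<in> kch M i j" "kbd z = 0"
    show "z \<in> fs.span (red ` {w \<in> kch M i j. kbd w = 0})"
    proof (cases "j = i + g")
      case True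
      then show ?thesis using top z by blast
    next
      case False
      obtain y where y: "y \<in> kch M (Suc i) j" "kbd y = z"
        using linear_quotients_acyclic[OF assms z False] .
      have "(\<lambda>c. kbd (delta c)) ` kcells M (Suc i) j \<subseteq> {w \<in> kch M i j. kbd w = 0}"
        using kbd_kch[OF linear_quotients_upclosed[OF assms] delta_kch] kbd_kbd by auto
      then have "fs.span (red ` (\<lambda>c. kbd (delta c)) ` kcells M (Suc i) j)
         \<subseteq> (fs.span (red ` {w \<in> kch M i j. kbd w = 0}) :: ('n cell \<Rightarrow> 'k) set)"
        by (intro fs.span_mono image_mono)
      then show ?thesis using kbd_span[OF y(1)] y(2) by blast
    qed
  qed
qed

section \<open>Edge multisets and their degree vectors\<close>

text \<open>
  The sets in \<open>CC\<close> are the vertex sets of the connected components with at least one edge. The numbering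
  \<open>\<rho>\<close> is such that each vertex of a component but the first has an earlier neighbour, as in a graph search.
\<close>

locale edge_search =
  fixes E :: "'n::finite set set" and CC :: "'n set set" and \<rho> :: "'n \<Rightarrow> nat"
  assumes simple: "simple_graph E"
    and disj: "c \<in> CC \<Longrightarrow> c' \<in> CC \<Longrightarrow> c \<noteq> c' \<Longrightarrow> c \<inter> c' = {}"
    and edge_comp: "e \<in> E \<Longrightarrow> \<exists>c\<in>CC. e \<subseteq> c"
    and covered: "c \<in> CC \<Longrightarrow> v \<in> c \<Longrightarrow> \<exists>e\<in>E. v \<in> e"
    and nonempty: "c \<in> CC \<Longrightarrow> c \<noteq> {}"
    and inj: "inj \<rho>"
    and search: "c \<in> CC \<Longrightarrow> v \<in> c \<Longrightarrow> (\<exists>z. {v, z} \<in> E \<and> \<rho> z < \<rho> v) \<or> (\<forall>w\<in>c. \<rho> v \<le> \<rho> w)"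
begin

definition edeg :: "('n set \<Rightarrow> nat) \<Rightarrow> 'n \<Rightarrow> nat" where
  "edeg \<mu> v = (\<Sum>e | e \<in> E \<and> v \<in> e. \<mu> e)"

definition cnt :: "('n set \<Rightarrow> nat) \<Rightarrow> 'n set \<Rightarrow> nat" where
  "cnt \<mu> c = (\<Sum>e | e \<in> E \<and> e \<subseteq> c. \<mu> e)"

definition inc :: "('n set \<Rightarrow> nat) \<Rightarrow> 'n set \<Rightarrow> 'n set \<Rightarrow> nat" where
  "inc \<mu> e = \<mu>(e := \<mu> e + 1)"

lemma edge_pair:
  assumes "e \<in> E" "x \<in> e"
  obtains y where "e = {x, y}" "x \<noteq> y"
proof -
  have "card e = 2" using simple assms(1) by (simp add: simple_graph_def)
  then obtain a b where "e = {a, b}" "a \<noteq> b" by (meson card_2_iff)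
  then show thesis using assms(2) that by fastforce
qed

lemma edge_nonempty: "e \<in> E \<Longrightarrow> e \<noteq> {}"
  using simple by (auto simp: simple_graph_def)

lemma edge_in_comp:
  assumes "e \<in> E" "x \<in> e" "c \<in> CC" "x \<in> c"
  shows "e \<subseteq> c"
  using edge_comp[OF assms(1)] disj[OF _ assms(3)] assms(2,4) by blast

lemma edge_comp_unique: "e \<in> E \<Longrightarrow> e \<subseteq> c \<Longrightarrow> e \<subseteq> c' \<Longrightarrow> c \<in> CC \<Longrightarrow> c' \<in> CC \<Longrightarrow> c = c'"
  using disj[of c c'] edge_nonempty[of e] by blast

lemma sum_inc:
  assumes "finite S"
  shows "(\<Sum>e'\<in>S. inc \<mu> e e') = (\<Sum>e'\<in>S. \<mu> e') + (if e \<in> S then 1 else 0)"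
proof -
  have "(\<Sum>e'\<in>S. inc \<mu> e e') = (\<Sum>e'\<in>S. \<mu> e' + (if e' = e then 1 else 0))"
    by (intro sum.cong) (auto simp: inc_def)
  then show ?thesis using assms by (simp add: sum.distrib)
qed

lemma edeg_inc: "e \<in> E \<Longrightarrow> edeg (inc \<mu> e) v = edeg \<mu> v + (if v \<in> e then 1 else 0)"
  by (simp add: edeg_def sum_inc)

lemma edeg_inc_pair:
  "{x, y} \<in> E \<Longrightarrow> x \<noteq> y \<Longrightarrow> edeg (inc \<mu> {x, y}) z = edeg \<mu> z + of_bool (z = x) + of_bool (z = y)"
  by (simp add: edeg_inc)

lemma cnt_inc: "e \<in> E \<Longrightarrow> cnt (inc \<mu> e) c = cnt \<mu> c + (if e \<subseteq> c then 1 else 0)"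
  by (simp add: cnt_def sum_inc)

lemma inc_dec: "\<mu> e > 0 \<Longrightarrow> \<mu> = inc (\<mu>(e := \<mu> e - 1)) e"
  by (auto simp: inc_def fun_eq_iff)

lemma edeg_le_cnt:
  assumes "c \<in> CC" "v \<in> c"
  shows "edeg \<mu> v \<le> cnt \<mu> c"
  unfolding edeg_def cnt_def by (rule sum_mono2) (use edge_in_comp assms in auto)

lemma edeg_outside: "v \<notin> \<Union>CC \<Longrightarrow> edeg \<mu> v = 0"
  using edge_comp by (auto simp: edeg_def intro!: sum.neutral)

lemma sum_edeg:
  assumes "c \<in> CC"
  shows "(\<Sum>v\<in>c. edeg \<mu> v) = 2 * cnt \<mu> c"
proof -
  have "(\<Sum>v\<in>c. edeg \<mu> v) = (\<Sum>v\<in>c. \<Sum>e | e \<in> E \<and> e \<subseteq> c \<and> v \<in> e. \<mu> e)"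
    unfolding edeg_def using edge_in_comp assms by (intro sum.cong refl arg_cong[of _ _ "sum \<mu>"]) blast
  also have "\<dots> = (\<Sum>v\<in>c. \<Sum>e | e \<in> {e. e \<in> E \<and> e \<subseteq> c} \<and> v \<in> e. \<mu> e)"
    by (intro sum.cong refl arg_cong[of _ _ "sum \<mu>"]) auto
  also have "\<dots> = (\<Sum>e | e \<in> E \<and> e \<subseteq> c. \<Sum>v | v \<in> c \<and> v \<in> e. \<mu> e)"
    by (rule sum.swap_restrict) auto
  also have "\<dots> = (\<Sum>e | e \<in> E \<and> e \<subseteq> c. 2 * \<mu> e)"
  proof (rule sum.cong[OF refl])
    fix e assume e: "e \<in> {e. e \<in> E \<and> e \<subseteq> c}"
    then have "{v. v \<in> c \<and> v \<in> e} = e" by auto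
    moreover have "card e = 2" using e simple by (simp add: simple_graph_def)
    ultimately show "(\<Sum>v | v \<in> c \<and> v \<in> e. \<mu> e) = 2 * \<mu> e" by simp
  qed
  finally show ?thesis by (simp add: cnt_def sum_distrib_left)
qed

lemma sum_edeg_total: "(\<Sum>v\<in>UNIV. edeg \<mu> v) = 2 * (\<Sum>c\<in>CC. cnt \<mu> c)"
proof -
  have "(\<Sum>v\<in>UNIV. edeg \<mu> v) = (\<Sum>v\<in>\<Union>CC. edeg \<mu> v)"
    by (rule sum.mono_neutral_right) (use edeg_outside in auto)
  also have "\<dots> = (\<Sum>c\<in>CC. \<Sum>v\<in>c. edeg \<mu> v)"
    using sum.UNION_disjoint[of CC "\<lambda>c. c" "edeg \<mu>"] disj by simp
  finally show ?thesis by (simp add: sum_edeg sum_distrib_left)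
qed

lemma sum_cnt: "(\<Sum>c\<in>CC. cnt \<mu> c) = (\<Sum>e\<in>E. \<mu> e)"
proof -
  have "(\<Sum>e\<in>E. \<mu> e) = (\<Sum>e\<in>(\<Union>c\<in>CC. {e. e \<in> E \<and> e \<subseteq> c}). \<mu> e)"
    using edge_comp by (intro sum.cong) auto
  also have "\<dots> = (\<Sum>c\<in>CC. \<Sum>e | e \<in> E \<and> e \<subseteq> c. \<mu> e)"
    by (rule sum.UNION_disjoint) (use edge_comp_unique in auto)
  finally show ?thesis by (simp add: cnt_def)
qed

lemma edeg_less_witness:
  assumes "edeg \<mu> v < edeg \<mu>' v"
  obtains e where "e \<in> E" "v \<in> e" "\<mu> e < \<mu>' e"
proof -
  have "\<exists>e\<in>{e. e \<in> E \<and> v \<in> e}. \<mu> e < \<mu>' e"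
  proof (rule ccontr)
    assume "\<not> ?thesis"
    then have "edeg \<mu>' v \<le> edeg \<mu> v" unfolding edeg_def by (intro sum_mono) (auto simp: not_less)
    then show False using assms by simp
  qed
  then show thesis using that by blast
qed

text \<open>
  Starting from \<open>v\<close>, walk along edges that alternately occur more often in \<open>\<mu>\<close> and more often in
  \<open>\<mu>'\<close>, removing the former and adding the latter. Each step brings the multiset closer to \<open>\<mu>'\<close>, so the
  walk ends, either after an addition or after a removal.
\<close>

lemma alternating_walk:
  assumes c: "c \<in> CC" "x \<in> c"
    and dv: "edeg \<mu>' v < edeg \<mu> v"
    and \<nu>: "\<And>y. edeg \<nu> y + of_bool (y = v) + of_bool (y = x) = edeg \<mu> y"
    and n: "\<And>c'. c' \<in> CC \<Longrightarrow> cnt \<nu> c' + of_bool (c' = c) = cnt \<mu> c'"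
  shows "\<exists>\<nu> w. w \<in> c \<and>
     (edeg \<mu> w < edeg \<mu>' w \<and> (\<forall>y. edeg \<nu> y + of_bool (y = v) = edeg \<mu> y + of_bool (y = w)) \<and>
        (\<forall>c'\<in>CC. cnt \<nu> c' = cnt \<mu> c') \<or>
      edeg \<mu>' w < edeg \<mu> w \<and> (\<forall>y. edeg \<nu> y + of_bool (y = v) + of_bool (y = w) = edeg \<mu> y) \<and>
        (\<forall>c'\<in>CC. cnt \<nu> c' + of_bool (c' = c) = cnt \<mu> c'))"
  using assms(2,4,5)
proof (induction "\<Sum>e\<in>E. (\<nu> e - \<mu>' e) + (\<mu>' e - \<nu> e)" arbitrary: \<nu> x rule: less_induct)
  case less
  note xc = less.prems(1) and \<nu> = less.prems(2) and n = less.prems(3)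
  show ?case
  proof (cases "edeg \<mu>' x \<le> edeg \<nu> x")
    case True
    then have "edeg \<mu>' x < edeg \<mu> x" using \<nu>[of x] by simp
    then show ?thesis using xc \<nu> n by blast
  next
    case False
    then obtain e where e: "e \<in> E" "x \<in> e" "\<nu> e < \<mu>' e"
      using edeg_less_witness[of \<nu> x \<mu>'] by auto
    obtain y where y: "e = {x, y}" "x \<noteq> y" using edge_pair[OF e(1,2)] .
    have ec: "e \<subseteq> c" using edge_in_comp[OF e(1,2) c(1) xc] .
    have unique: "e' \<subseteq> c' \<longleftrightarrow> c' = c" if "e' \<in> E" "e' \<subseteq> c" "c' \<in> CC" for e' c'
      using edge_comp_unique[OF that(1)] that c(1) by blast
    define \<nu>1 where "\<nu>1 = inc \<nu> e"
    have \<nu>1: "edeg \<nu>1 z + of_bool (z = v) = edeg \<mu> z + of_bool (z = y)" for z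
      using \<nu>[of z] edeg_inc_pair[OF e(1)[unfolded y(1)] y(2), of \<nu> z] unfolding \<nu>1_def y(1) by simp
    have n1: "cnt \<nu>1 c' = cnt \<mu> c'" if "c' \<in> CC" for c'
      using n[OF that] unique[OF e(1) ec that] unfolding \<nu>1_def cnt_inc[OF e(1)] by (cases "c' = c") simp_all
    have yc: "y \<in> c" using ec y by auto
    show ?thesis
    proof (cases "edeg \<nu>1 y \<le> edeg \<mu>' y")
      case True
      have "y \<noteq> v" using True \<nu>1[of y] dv by auto
      then have "edeg \<mu> y < edeg \<mu>' y" using True \<nu>1[of y] by simp
      then show ?thesis using yc \<nu>1 n1 by blast
    next
      case False
      then obtain e' where e': "e' \<in> E" "y \<in> e'" "\<mu>' e' < \<nu>1 e'"
        using edeg_less_witness[of \<mu>' y \<nu>1] by auto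
      obtain x' where x': "e' = {y, x'}" "y \<noteq> x'" using edge_pair[OF e'(1,2)] .
      have ec': "e' \<subseteq> c" using edge_in_comp[OF e'(1,2) c(1) yc] .
      have ne: "e' \<noteq> e" using e(3) e'(3) by (auto simp: \<nu>1_def inc_def)
      define \<nu>2 where "\<nu>2 = \<nu>1(e' := \<nu>1 e' - 1)"
      have inc2: "\<nu>1 = inc \<nu>2 e'" unfolding \<nu>2_def by (rule inc_dec) (use e'(3) in simp)
      have \<nu>2: "edeg \<nu>2 z + of_bool (z = v) + of_bool (z = x') = edeg \<mu> z" for z
      proof -
        have "edeg \<nu>1 z = edeg \<nu>2 z + of_bool (z = y) + of_bool (z = x')"
          unfolding inc2 x'(1) by (rule edeg_inc_pair[OF e'(1)[unfolded x'(1)] x'(2)])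
        then show ?thesis using \<nu>1[of z] by simp
      qed
      have n2: "cnt \<nu>2 c' + of_bool (c' = c) = cnt \<mu> c'" if "c' \<in> CC" for c'
      proof -
        have "cnt \<nu>1 c' = cnt \<nu>2 c' + of_bool (e' \<subseteq> c')"
          unfolding inc2 cnt_inc[OF e'(1)] by simp
        then show ?thesis using n1[OF that] unique[OF e'(1) ec' that] by simp
      qed
      have "(\<Sum>d\<in>E. (\<nu>2 d - \<mu>' d) + (\<mu>' d - \<nu>2 d)) < (\<Sum>d\<in>E. (\<nu> d - \<mu>' d) + (\<mu>' d - \<nu> d))"
      proof (rule sum_strict_mono_ex1)
        show "\<forall>d\<in>E. (\<nu>2 d - \<mu>' d) + (\<mu>' d - \<nu>2 d) \<le> (\<nu> d - \<mu>' d) + (\<mu>' d - \<nu> d)"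
          using e(3) e'(3) ne by (auto simp: \<nu>2_def \<nu>1_def inc_def)
        show "\<exists>d\<in>E. (\<nu>2 d - \<mu>' d) + (\<mu>' d - \<nu>2 d) < (\<nu> d - \<mu>' d) + (\<mu>' d - \<nu> d)"
          using e(1,3) ne by (intro bexI[of _ e]) (auto simp: \<nu>2_def \<nu>1_def inc_def)
      qed simp
      then show ?thesis using less.hyps[of \<nu>2 x'] \<nu>2 n2 ec' x' by blast
    qed
  qed
qed

text \<open>
  Walk from \<open>v\<close>. If the walk ends with an addition at \<open>w\<close>, then \<open>w\<close> precedes \<open>v\<close> and the exchange is done. If
  it ends with a removal at \<open>w\<close>, one edge is missing. It is put back at \<open>w\<close>, towards the root, or, if \<open>w\<close>
  is the root, along the edge from the root to the second vertex. The latter precedes \<open>v\<close> because some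
  vertex other than the root at which \<open>\<mu>'\<close> is larger precedes \<open>v\<close>.
\<close>

lemma exchange_down:
  assumes cnt: "\<And>c. c \<in> CC \<Longrightarrow> cnt \<mu> c = cnt \<mu>' c"
    and dv: "edeg \<mu>' v < edeg \<mu> v"
    and last: "\<And>w. \<rho> v < \<rho> w \<Longrightarrow> edeg \<mu> w = edeg \<mu>' w"
  obtains z \<nu> where "\<rho> z < \<rho> v"
    "\<And>y. edeg \<nu> y + of_bool (y = v) = edeg \<mu> y + of_bool (y = z)"
    "\<And>c. c \<in> CC \<Longrightarrow> cnt \<nu> c = cnt \<mu> c"
proof -
  note result = that
  have le: "\<rho> w \<le> \<rho> v" if "edeg \<mu> w \<noteq> edeg \<mu>' w" for w
    using last[of w] that by (meson not_le)
  obtain e where e: "e \<in> E" "v \<in> e" "\<mu>' e < \<mu> e" using edeg_less_witness[OF dv] .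
  obtain x where x: "e = {v, x}" "v \<noteq> x" using edge_pair[OF e(1,2)] .
  obtain c where c: "c \<in> CC" "e \<subseteq> c" using edge_comp[OF e(1)] by blast
  have unique: "e' \<subseteq> c' \<longleftrightarrow> c' = c" if "e' \<in> E" "e' \<subseteq> c" "c' \<in> CC" for e' c'
    using edge_comp_unique[OF that(1)] that c(1) by blast
  define \<nu>0 where "\<nu>0 = \<mu>(e := \<mu> e - 1)"
  have inc0: "\<mu> = inc \<nu>0 e" unfolding \<nu>0_def by (rule inc_dec) (use e(3) in simp)
  have "edeg \<nu>0 y + of_bool (y = v) + of_bool (y = x) = edeg \<mu> y" for y
    unfolding inc0 x(1) by (rule edeg_inc_pair[OF e(1)[unfolded x(1)] x(2), symmetric])
  moreover have "cnt \<nu>0 c' + of_bool (c' = c) = cnt \<mu> c'" if "c' \<in> CC" for c'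
    unfolding inc0 cnt_inc[OF e(1)] using unique[OF e(1) c(2) that] by simp
  moreover have "x \<in> c" using x c by auto
  ultimately obtain \<nu> w where w: "w \<in> c" and
    "edeg \<mu> w < edeg \<mu>' w \<and> (\<forall>y. edeg \<nu> y + of_bool (y = v) = edeg \<mu> y + of_bool (y = w)) \<and>
        (\<forall>c'\<in>CC. cnt \<nu> c' = cnt \<mu> c') \<or>
      edeg \<mu>' w < edeg \<mu> w \<and> (\<forall>y. edeg \<nu> y + of_bool (y = v) + of_bool (y = w) = edeg \<mu> y) \<and>
        (\<forall>c'\<in>CC. cnt \<nu> c' + of_bool (c' = c) = cnt \<mu> c')"
    using alternating_walk[OF c(1) _ dv, of x \<nu>0] by blast
  then consider (add) "edeg \<mu> w < edeg \<mu>' w" "\<And>y. edeg \<nu> y + of_bool (y = v) = edeg \<mu> y + of_bool (y = w)"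
        "\<And>c'. c' \<in> CC \<Longrightarrow> cnt \<nu> c' = cnt \<mu> c'"
    | (remove) "edeg \<mu>' w < edeg \<mu> w" "\<And>y. edeg \<nu> y + of_bool (y = v) + of_bool (y = w) = edeg \<mu> y"
        "\<And>c'. c' \<in> CC \<Longrightarrow> cnt \<nu> c' + of_bool (c' = c) = cnt \<mu> c'"
    by blast
  then show thesis
  proof cases
    case add
    have "w \<noteq> v" using add(1) dv by auto
    then have "\<rho> w < \<rho> v" using le[of w] add(1) inj by (simp add: inj_def le_less) blast
    then show thesis using result add by blast
  next
    case remove
    have add_edge: thesis if z: "{w, z} \<in> E" "\<rho> z < \<rho> v" for z
    proof (rule result)
      have "card {w, z} = 2" using simple z(1) unfolding simple_graph_def by blast
      then have wz: "w \<noteq> z" by (cases "w = z") simp_all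
      have sub: "{w, z} \<subseteq> c" using edge_in_comp[OF z(1) _ c(1) w] by simp
      show "\<rho> z < \<rho> v" by (rule z)
      show "edeg (inc \<nu> {w, z}) y + of_bool (y = v) = edeg \<mu> y + of_bool (y = z)" for y
        using remove(2)[of y] edeg_inc_pair[OF z(1) wz, of \<nu> y] by simp
      show "cnt (inc \<nu> {w, z}) c' = cnt \<mu> c'" if "c' \<in> CC" for c'
        using remove(3)[OF that] unique[OF z(1) sub that] unfolding cnt_inc[OF z(1)] by (cases "c' = c") simp_all
    qed
    show thesis
    proof (cases "\<exists>z. {w, z} \<in> E \<and> \<rho> z < \<rho> w")
      case True
      then show thesis using add_edge le[of w] remove(1) by fastforce
    next
      case False
      then have root: "\<rho> w \<le> \<rho> y" if "y \<in> c" for y using search[OF c(1) w] that by blast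
      have "\<exists>y\<in>c. edeg \<mu> y < edeg \<mu>' y"
      proof (rule ccontr)
        assume "\<not> ?thesis"
        then have "(\<Sum>y\<in>c. edeg \<mu>' y) < (\<Sum>y\<in>c. edeg \<mu> y)"
          using w remove(1) by (intro sum_strict_mono_ex1) (auto simp: not_less)
        then show False using sum_edeg[OF c(1)] cnt[OF c(1)] by simp
      qed
      then obtain y where y: "y \<in> c" "edeg \<mu> y < edeg \<mu>' y" by blast
      have "y \<noteq> v" "y \<noteq> w" using y dv remove(1) by auto
      then have yv: "\<rho> y < \<rho> v" using le[of y] y inj by (simp add: inj_def le_less) blast
      \<comment> \<open>The vertex after the root is adjacent to the root.\<close>
      define r where "r = arg_min_on \<rho> (c - {w})"
      have r: "r \<in> c - {w}" "\<And>u. u \<in> c - {w} \<Longrightarrow> \<rho> r \<le> \<rho> u"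
        unfolding r_def using y \<open>y \<noteq> w\<close> arg_min_if_finite(1)[of "c - {w}" \<rho>] arg_min_least[of "c - {w}" _ \<rho>]
        by auto
      have "\<rho> w < \<rho> r"
        using r(1) root[of r] inj by (auto simp: inj_def le_less)
      then have "\<not> (\<forall>u\<in>c. \<rho> r \<le> \<rho> u)"
        using w by (meson not_le)
      then obtain u where u: "{r, u} \<in> E" "\<rho> u < \<rho> r" using search[OF c(1), of r] r(1) by blast
      have "u \<in> c" using edge_in_comp[OF u(1) _ c(1)] r(1) by blast
      then have "u = w" using r(2)[of u] u(2) by (meson DiffI not_le singletonD)
      then show thesis using add_edge[of r] u(1) r(2)[of y] y \<open>y \<noteq> w\<close> yv by (auto simp: insert_commute)
    qed
  qed
qed

section \<open>Monomials covered by edge multisets\<close>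

text \<open>
  The monomials \<open>x\<^sup>m\<close> with \<open>m \<ge> (k, \<dots>, k) - d\<close> for the degree vector \<open>d\<close> of some multiset of edges, at most
  \<open>s c\<close> of them in each component \<open>c \<in> P\<close> and at most \<open>u\<close> in the other components together.
\<close>

definition cover :: "nat \<Rightarrow> 'n set set \<Rightarrow> ('n set \<Rightarrow> nat) \<Rightarrow> nat \<Rightarrow> ('n \<Rightarrow>\<^sub>0 nat) set" where
  "cover k P s u = {m. \<exists>\<mu>. (\<forall>c\<in>P. cnt \<mu> c \<le> s c) \<and> (\<Sum>c\<in>CC - P. cnt \<mu> c) \<le> u \<and>
     (\<forall>v. k \<le> lookup m v + edeg \<mu> v)}"

lemma coverI:
  "(\<And>c. c \<in> P \<Longrightarrow> cnt \<mu> c \<le> s c) \<Longrightarrow> (\<Sum>c\<in>CC - P. cnt \<mu> c) \<le> u \<Longrightarrow>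
   (\<And>v. k \<le> lookup m v + edeg \<mu> v) \<Longrightarrow> m \<in> cover k P s u"
  unfolding cover_def by blast

lemma coverE:
  assumes "m \<in> cover k P s u"
  obtains \<mu> where "\<And>c. c \<in> P \<Longrightarrow> cnt \<mu> c \<le> s c" "(\<Sum>c\<in>CC - P. cnt \<mu> c) \<le> u"
    "\<And>v. k \<le> lookup m v + edeg \<mu> v"
  using assms unfolding cover_def by blast

lemma upclosed_cover: "upclosed (cover k P s u)"
  unfolding upclosed_def
proof (intro ballI allI)
  fix m q assume "m \<in> cover k P s u"
  then obtain \<mu> where \<mu>: "\<And>c. c \<in> P \<Longrightarrow> cnt \<mu> c \<le> s c" "(\<Sum>c\<in>CC - P. cnt \<mu> c) \<le> u"
    "\<And>v. k \<le> lookup m v + edeg \<mu> v" by (rule coverE) auto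
  show "m + q \<in> cover k P s u"
  proof (rule coverI[OF \<mu>(1,2)])
    show "k \<le> lookup (m + q) v + edeg \<mu> v" for v
      using \<mu>(3)[of v] by (simp add: lookup_add)
  qed
qed

lemma raise_counts:
  assumes "\<And>c. c \<in> CC \<Longrightarrow> cnt \<mu> c \<le> s c"
  obtains \<nu> where "\<And>c. c \<in> CC \<Longrightarrow> cnt \<nu> c = s c" "\<And>v. edeg \<mu> v \<le> edeg \<nu> v"
proof -
  define \<epsilon> where "\<epsilon> c = (SOME e. e \<in> E \<and> e \<subseteq> c)" for c
  have \<epsilon>: "\<epsilon> c \<in> E" "\<epsilon> c \<subseteq> c" if c: "c \<in> CC" for c
  proof -
    obtain v where v: "v \<in> c" using nonempty[OF c] by blast
    obtain e where e: "e \<in> E" "v \<in> e" using covered[OF c v] by blast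
    have "e \<in> E \<and> e \<subseteq> c" using e(1) edge_in_comp[OF e c v] by blast
    then have "\<epsilon> c \<in> E \<and> \<epsilon> c \<subseteq> c" unfolding \<epsilon>_def by (rule someI)
    then show "\<epsilon> c \<in> E" "\<epsilon> c \<subseteq> c" by blast+
  qed
  define \<nu> where "\<nu> e = \<mu> e + (\<Sum>c\<in>CC. if e = \<epsilon> c then s c - cnt \<mu> c else 0)" for e
  show thesis
  proof (rule that)
    fix c assume c: "c \<in> CC"
    have "cnt \<nu> c = cnt \<mu> c + (\<Sum>e | e \<in> E \<and> e \<subseteq> c. \<Sum>c'\<in>CC. if e = \<epsilon> c' then s c' - cnt \<mu> c' else 0)"
      unfolding cnt_def[of \<nu>] \<nu>_def by (simp add: sum.distrib cnt_def)
    also have "(\<Sum>e | e \<in> E \<and> e \<subseteq> c. \<Sum>c'\<in>CC. if e = \<epsilon> c' then s c' - cnt \<mu> c' else 0)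
        = (\<Sum>c'\<in>CC. \<Sum>e | e \<in> E \<and> e \<subseteq> c. if e = \<epsilon> c' then s c' - cnt \<mu> c' else 0)"
      by (rule sum.swap)
    also have "\<dots> = (\<Sum>c'\<in>CC. if c' = c then s c - cnt \<mu> c else 0)"
    proof (rule sum.cong[OF refl])
      fix c' assume c': "c' \<in> CC"
      have "\<epsilon> c' \<subseteq> c \<longleftrightarrow> c' = c" using edge_comp_unique[OF \<epsilon>(1)[OF c'] _ \<epsilon>(2)[OF c'] c c'] \<epsilon>(2)[OF c'] by auto
      then show "(\<Sum>e | e \<in> E \<and> e \<subseteq> c. if e = \<epsilon> c' then s c' - cnt \<mu> c' else 0)
          = (if c' = c then s c - cnt \<mu> c else 0)"
        using \<epsilon>(1)[OF c'] by auto
    qed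
    also have "\<dots> = s c - cnt \<mu> c" using c by simp
    finally show "cnt \<nu> c = s c" using assms[OF c] by simp
  next
    fix v
    show "edeg \<mu> v \<le> edeg \<nu> v" unfolding edeg_def \<nu>_def by (intro sum_mono) simp
  qed
qed

definition vectors :: "('n set \<Rightarrow> nat) \<Rightarrow> ('n \<Rightarrow> nat) set" where
  "vectors s = {edeg \<mu> | \<mu>. \<forall>c\<in>CC. cnt \<mu> c = s c}"

definition gen :: "nat \<Rightarrow> ('n \<Rightarrow> nat) \<Rightarrow> 'n \<Rightarrow>\<^sub>0 nat" where
  "gen k d = Abs_poly_mapping (\<lambda>v. k - d v)"

lemma lookup_gen: "lookup (gen k d) v = k - d v"
  by (simp add: gen_def)

lemma vectors_le:
  assumes "d \<in> vectors s" "\<And>c. c \<in> CC \<Longrightarrow> s c \<le> k"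
  shows "d v \<le> k"
proof -
  obtain \<mu> where \<mu>: "d = edeg \<mu>" "\<And>c. c \<in> CC \<Longrightarrow> cnt \<mu> c = s c" using assms(1) unfolding vectors_def by blast
  show ?thesis
  proof (cases "v \<in> \<Union>CC")
    case True
    then show ?thesis using \<mu> edeg_le_cnt assms(2) by (metis UnionE le_trans)
  next
    case False
    then show ?thesis using edeg_outside \<mu> by simp
  qed
qed

lemma cover_all:
  assumes "\<And>c. c \<in> CC \<Longrightarrow> s c \<le> k"
  shows "cover k CC s u = (\<Union>d\<in>vectors s. up (gen k d))"
proof (intro equalityI subsetI)
  fix m assume "m \<in> cover k CC s u"
  then obtain \<mu> where \<mu>: "\<And>c. c \<in> CC \<Longrightarrow> cnt \<mu> c \<le> s c"
    "\<And>v. k \<le> lookup m v + edeg \<mu> v" by (rule coverE) auto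
  obtain \<nu> where \<nu>: "\<And>c. c \<in> CC \<Longrightarrow> cnt \<nu> c = s c" "\<And>v. edeg \<mu> v \<le> edeg \<nu> v"
    using raise_counts[OF \<mu>(1)] by blast
  have "k - edeg \<nu> v \<le> lookup m v" for v
    using \<mu>(2)[of v] \<nu>(2)[of v] by linarith
  then have "m \<in> up (gen k (edeg \<nu>))" by (simp add: up_def lookup_gen)
  moreover have "edeg \<nu> \<in> vectors s" using \<nu>(1) by (auto simp: vectors_def)
  ultimately show "m \<in> (\<Union>d\<in>vectors s. up (gen k d))" by blast
next
  fix m assume "m \<in> (\<Union>d\<in>vectors s. up (gen k d))"
  then obtain \<mu> where \<mu>: "\<And>c. c \<in> CC \<Longrightarrow> cnt \<mu> c = s c" "m \<in> up (gen k (edeg \<mu>))"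
    unfolding vectors_def by blast
  then have "k \<le> lookup m v + edeg \<mu> v" for v
    by (auto simp: up_def lookup_gen dest!: spec[of _ v])
  then show "m \<in> cover k CC s u" using \<mu>(1) by (intro coverI[of _ \<mu>]) auto
qed

text \<open>
  Reading vectors as numerals with digits below \<open>B\<close>, later vertices being more significant, turns the
  comparison at the last difference into a comparison of natural numbers.
\<close>

definition key :: "nat \<Rightarrow> ('n \<Rightarrow> nat) \<Rightarrow> nat" where
  "key B d = (\<Sum>v\<in>UNIV. d v * B ^ \<rho> v)"

lemma sum_digits_less:
  fixes B :: nat
  assumes "\<And>v. v \<in> S \<Longrightarrow> \<rho> v < N" "\<And>v. v \<in> S \<Longrightarrow> d v < B" "B > 0"
  shows "(\<Sum>v\<in>S. d v * B ^ \<rho> v) < B ^ N"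
proof -
  have "(\<Sum>v\<in>S. d v * B ^ \<rho> v) \<le> (\<Sum>v\<in>S. (B - 1) * B ^ \<rho> v)"
  proof (rule sum_mono)
    fix v assume "v \<in> S"
    then have "d v \<le> B - 1" using assms(2)[of v] by simp
    then show "d v * B ^ \<rho> v \<le> (B - 1) * B ^ \<rho> v" by simp
  qed
  also have "\<dots> = (\<Sum>i\<in>\<rho> ` S. (B - 1) * B ^ i)"
    using inj by (subst sum.reindex) (auto simp: inj_on_def inj_def)
  also have "\<dots> \<le> (\<Sum>i<N. (B - 1) * B ^ i)"
    by (rule sum_mono2) (use assms(1) in auto)
  also have "\<dots> + 1 = B ^ N"
  proof (induction N)
    case (Suc N)
    have "(\<Sum>i<Suc N. (B - 1) * B ^ i) + 1 = B ^ N + (B - 1) * B ^ N" using Suc by simp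
    also have "\<dots> = B ^ Suc N" using assms(3) by (cases B) auto
    finally show ?case .
  qed simp
  then have "(\<Sum>i<N. (B - 1) * B ^ i) < B ^ N" by simp
  finally show ?thesis .
qed

lemma key_less:
  assumes "d v < d' v" "\<And>w. \<rho> v < \<rho> w \<Longrightarrow> d w = d' w" "\<And>w. d w < B"
  shows "key B d < key B d'"
proof -
  have B: "B > 0" using assms(3)[of v] by simp
  let ?L = "{w. \<rho> w < \<rho> v}" and ?G = "{w. \<rho> v < \<rho> w}"
  have U: "UNIV = insert v (?L \<union> ?G)" using inj by (auto simp: inj_def) (metis linorder_neqE_nat)
  have split: "key B f = f v * B ^ \<rho> v + ((\<Sum>w\<in>?L. f w * B ^ \<rho> w) + (\<Sum>w\<in>?G. f w * B ^ \<rho> w))" for f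
  proof -
    have "key B f = (\<Sum>w\<in>insert v (?L \<union> ?G). f w * B ^ \<rho> w)" unfolding key_def using U by simp
    also have "\<dots> = f v * B ^ \<rho> v + (\<Sum>w\<in>?L \<union> ?G. f w * B ^ \<rho> w)" by (rule sum.insert) auto
    also have "(\<Sum>w\<in>?L \<union> ?G. f w * B ^ \<rho> w) = (\<Sum>w\<in>?L. f w * B ^ \<rho> w) + (\<Sum>w\<in>?G. f w * B ^ \<rho> w)"
      by (rule sum.union_disjoint) auto
    finally show ?thesis .
  qed
  have 1: "(\<Sum>w\<in>?L. d w * B ^ \<rho> w) < B ^ \<rho> v" by (rule sum_digits_less) (use assms(3) B in auto)
  have 2: "(\<Sum>w\<in>?G. d w * B ^ \<rho> w) = (\<Sum>w\<in>?G. d' w * B ^ \<rho> w)" by (rule sum.cong) (use assms(2) in auto)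
  have "Suc (d v) * B ^ \<rho> v \<le> d' v * B ^ \<rho> v" using assms(1) by (intro mult_right_mono) auto
  then have "d v * B ^ \<rho> v + B ^ \<rho> v \<le> d' v * B ^ \<rho> v" by simp
  then show ?thesis unfolding split[of d] split[of d'] 2 using 1 by linarith
qed

lemma last_difference:
  assumes "d \<noteq> d'"
  obtains v where "d v \<noteq> d' v" "\<And>w. \<rho> v < \<rho> w \<Longrightarrow> d w = d' w"
proof -
  let ?S = "{v. d v \<noteq> d' v}"
  have "Max (\<rho> ` ?S) \<in> \<rho> ` ?S" by (rule Max_in) (use assms in auto)
  then obtain v where v: "v \<in> ?S" "\<rho> v = Max (\<rho> ` ?S)" by auto
  show thesis
  proof (rule that)
    show "d v \<noteq> d' v" using v(1) by simp
    show "d w = d' w" if "\<rho> v < \<rho> w" for w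
    proof (rule ccontr)
      assume "d w \<noteq> d' w"
      then have "\<rho> w \<le> Max (\<rho> ` ?S)" by (intro Max_ge) auto
      then show False using that v(2) by simp
    qed
  qed
qed

lemma key_inj: "key B d = key B d' \<Longrightarrow> (\<And>w. d w < B) \<Longrightarrow> (\<And>w. d' w < B) \<Longrightarrow> d = d'"
proof (rule ccontr)
  assume key: "key B d = key B d'" and B: "\<And>w. d w < B" "\<And>w. d' w < B" and "d \<noteq> d'"
  from this(4) obtain v where v: "d v \<noteq> d' v" "\<And>w. \<rho> v < \<rho> w \<Longrightarrow> d w = d' w" by (rule last_difference) blast
  have "d v < d' v \<or> d' v < d v" using v(1) by linarith
  then show False using key_less[of d v d' B] key_less[of d' v d B] v(2) B key by fastforce
qed

lemma key_less_witness:
  assumes "key B d' < key B d" "\<And>w. d w < B" "\<And>w. d' w < B"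
  obtains v where "d' v < d v" "\<And>w. \<rho> v < \<rho> w \<Longrightarrow> d w = d' w"
proof -
  have "d \<noteq> d'" using assms(1) by auto
  then obtain v where v: "d v \<noteq> d' v" "\<And>w. \<rho> v < \<rho> w \<Longrightarrow> d w = d' w" by (rule last_difference) blast
  have "\<not> d v < d' v" using key_less[of d v d' B] v(2) assms by force
  then show thesis using that v by force
qed

text \<open>
  The generators are added in increasing order of their degree vectors. The colon ideal at \<open>d\<close> is
  generated by the variables \<open>x\<^sub>v\<close> for which a unit of \<open>d\<close> can be moved from \<open>v\<close> to another vertex such that
  the vector decreases; against any smaller vector, the last difference provides such a \<open>v\<close>.
\<close>

lemma cover_linear_quotients:
  assumes sk: "\<And>c. c \<in> CC \<Longrightarrow> s c \<le> k"
  shows "linear_quotients (card (UNIV :: 'n set) * k - 2 * (\<Sum>c\<in>CC. s c)) (cover k CC s u)"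
proof -
  let ?g = "card (UNIV :: 'n set) * k - 2 * (\<Sum>c\<in>CC. s c)"
  \<comment> \<open>The digits are at most \<open>k\<close>; a base above \<open>1\<close> makes the powers strictly increasing.\<close>
  define B where "B = k + 2"
  define D where "D t = {d\<in>vectors s. key B d < t}" for t
  have le: "d v \<le> k" if "d \<in> vectors s" for d v using vectors_le[OF that sk] .
  have lt: "d v < B" if "d \<in> vectors s" for d v using le[OF that, of v] by (simp add: B_def)
  have LQ: "linear_quotients ?g (\<Union>d\<in>D t. up (gen k d))" for t
  proof (induction t)
    case 0
    then show ?case by (simp add: D_def linear_quotients.empty)
  next
    case (Suc t)
    show ?case
    proof (cases "\<exists>d\<in>vectors s. key B d = t")
      case False
      then have "D (Suc t) = D t" unfolding D_def using less_Suc_eq by auto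
      then show ?thesis using Suc by simp
    next
      case True
      then obtain d where d: "d \<in> vectors s" "key B d = t" by blast
      have "d' = d" if d': "d' \<in> vectors s" "key B d' = t" for d'
        by (rule key_inj[of B]) (use d d' lt in \<open>simp_all\<close>)
      then have "D (Suc t) = insert d (D t)"
        unfolding D_def less_Suc_eq using d by blast
      then have eq: "(\<Union>d\<in>D (Suc t). up (gen k d)) = (\<Union>d\<in>D t. up (gen k d)) \<union> up (gen k d)" by auto
      obtain \<mu> where \<mu>: "d = edeg \<mu>" "\<And>c. c \<in> CC \<Longrightarrow> cnt \<mu> c = s c" using d unfolding vectors_def by blast
      have deg: "mdeg (gen k d) = ?g"
      proof -
        have "mdeg (gen k d) = (\<Sum>v\<in>(UNIV :: 'n set). k) - (\<Sum>v\<in>UNIV. d v)"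
          unfolding mdeg_def lookup_gen by (rule sum_subtractf_nat) (rule le[OF d(1)])
        also have "(\<Sum>v\<in>UNIV. d v) = 2 * (\<Sum>c\<in>CC. s c)"
          unfolding \<mu>(1) sum_edeg_total using \<mu>(2) by simp
        finally show ?thesis by simp
      qed
      define A where "A = {x. \<exists>d''\<in>D t. \<exists>z. z \<noteq> x \<and> (\<forall>y. d'' y + of_bool (y = x) = d y + of_bool (y = z))}"
      have "m \<in> (\<Union>d\<in>D t. up (gen k d)) \<longleftrightarrow>
          (\<exists>v\<in>A. lookup (gen k d) v < lookup m v)" if m: "m \<in> up (gen k d)" for m
      proof
        assume "m \<in> (\<Union>d\<in>D t. up (gen k d))"
        then obtain d' where d': "d' \<in> vectors s" "key B d' < key B d" "m \<in> up (gen k d')"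
          unfolding D_def d(2) by blast
        obtain v where v: "d' v < d v" "\<And>w. \<rho> v < \<rho> w \<Longrightarrow> d w = d' w"
          by (rule key_less_witness[OF d'(2) lt[OF d(1)] lt[OF d'(1)]]) blast
        obtain \<mu>' where \<mu>': "d' = edeg \<mu>'" "\<And>c. c \<in> CC \<Longrightarrow> cnt \<mu>' c = s c"
          using d' unfolding vectors_def by blast
        obtain z \<nu> where z: "\<rho> z < \<rho> v"
          "\<And>y. edeg \<nu> y + of_bool (y = v) = edeg \<mu> y + of_bool (y = z)" "\<And>c. c \<in> CC \<Longrightarrow> cnt \<nu> c = cnt \<mu> c"
          using exchange_down[of \<mu> \<mu>' v] \<mu> \<mu>' v by auto
        have "key B (edeg \<nu>) + B ^ \<rho> v = key B d + B ^ \<rho> z"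
        proof -
          have "(\<Sum>y\<in>UNIV. (edeg \<nu> y + of_bool (y = v)) * B ^ \<rho> y) = (\<Sum>y\<in>UNIV. (d y + of_bool (y = z)) * B ^ \<rho> y)"
            using z(2) \<mu>(1) by simp
          then show ?thesis by (simp add: key_def distrib_right sum.distrib of_bool_def if_distrib[of "\<lambda>x. x * _"] cong: if_cong)
        qed
        moreover have "B ^ \<rho> z < B ^ \<rho> v" using z(1) by (simp add: B_def)
        ultimately have "edeg \<nu> \<in> D t" using z(3) \<mu>(2) d(2) unfolding D_def vectors_def by auto
        moreover have "z \<noteq> v" using z(1) by auto
        ultimately have "v \<in> A" unfolding A_def \<mu>(1) using z(2) by blast
        moreover have "lookup (gen k d) v < lookup m v"
        proof -
          have "k - d' v \<le> lookup m v" using d'(3) by (simp add: up_def lookup_gen)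
          then show ?thesis using v(1) le[OF d(1), of v] by (simp add: lookup_gen)
        qed
        ultimately show "\<exists>v\<in>A. lookup (gen k d) v < lookup m v" by blast
      next
        assume "\<exists>v\<in>A. lookup (gen k d) v < lookup m v"
        then obtain x d'' z where x: "k - d x < lookup m x" "d'' \<in> D t" "z \<noteq> x"
          "\<And>y. d'' y + of_bool (y = x) = d y + of_bool (y = z)"
          unfolding A_def lookup_gen by blast
        have "k - d'' y \<le> lookup m y" for y
          using x(1,3) x(4)[of y] m by (cases "y = x") (auto simp: up_def lookup_gen dest!: spec[of _ y])
        then have "m \<in> up (gen k d'')" by (simp add: up_def lookup_gen)
        then show "m \<in> (\<Union>d\<in>D t. up (gen k d))" using x(2) by blast
      qed
      then show ?thesis unfolding eq by (rule linear_quotients.add[OF Suc deg])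
    qed
  qed
  have "finite (vectors s)"
  proof (rule finite_subset)
    show "vectors s \<subseteq> {f. \<forall>v. (v \<in> UNIV \<longrightarrow> f v \<in> {..k}) \<and> (v \<notin> UNIV \<longrightarrow> f v = 0)}"
      using le by auto
  qed (intro finite_set_of_finite_funs, auto)
  then obtain t where "\<And>d. d \<in> vectors s \<Longrightarrow> key B d < t"
    using finite_nat_set_iff_bounded[of "key B ` vectors s"] by auto
  then have "D t = vectors s" by (auto simp: D_def)
  then show ?thesis using LQ[of t] cover_all[OF sk] by simp
qed

text \<open>An additional edge at \<open>v\<close> makes up for one factor \<open>x\<^sub>v\<close>.\<close>

lemma cover_cone:
  assumes y: "y \<in> cover k P s u" and e: "e \<in> E" "v \<in> e"
    and s': "\<And>c. c \<in> P \<Longrightarrow> s c + (if e \<subseteq> c then 1 else 0) \<le> s' c"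
    and u': "u + (if \<exists>c\<in>CC - P. e \<subseteq> c then 1 else 0) \<le> u'"
  shows "y - single v 1 \<in> cover k P s' u'"
proof -
  obtain \<mu> where \<mu>: "\<And>c. c \<in> P \<Longrightarrow> cnt \<mu> c \<le> s c" "(\<Sum>c\<in>CC - P. cnt \<mu> c) \<le> u"
    "\<And>v. k \<le> lookup y v + edeg \<mu> v" using coverE[OF y] by blast
  show ?thesis
  proof (rule coverI)
    show "cnt (inc \<mu> e) c \<le> s' c" if "c \<in> P" for c
      using \<mu>(1)[OF that] s'[OF that] by (simp add: cnt_inc[OF e(1)] split: if_splits)
    have "(\<Sum>c\<in>CC - P. cnt (inc \<mu> e) c) = (\<Sum>c\<in>CC - P. cnt \<mu> c) + (\<Sum>c\<in>CC - P. if e \<subseteq> c then 1 else 0)"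
      by (simp add: cnt_inc[OF e(1)] sum.distrib)
    also have "(\<Sum>c\<in>CC - P. if e \<subseteq> c then 1 else 0) \<le> (if \<exists>c\<in>CC - P. e \<subseteq> c then 1 else (0::nat))"
    proof (cases "\<exists>c\<in>CC - P. e \<subseteq> c")
      case True
      then obtain c where c: "c \<in> CC - P" "e \<subseteq> c" by blast
      have "(\<Sum>c'\<in>CC - P. if e \<subseteq> c' then 1 else 0) = (\<Sum>c'\<in>CC - P. if c' = c then 1 else (0::nat))"
        using edge_comp_unique[OF e(1)] c by (intro sum.cong) auto
      then show ?thesis using True by simp
    next
      case False
      then show ?thesis by (simp add: sum.neutral)
    qed
    finally show "(\<Sum>c\<in>CC - P. cnt (inc \<mu> e) c) \<le> u'" using \<mu>(2) u' by linarith
    show "k \<le> lookup (y - single v 1) w + edeg (inc \<mu> e) w" for w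
      using \<mu>(3)[of w] e(2) by (auto simp: edeg_inc[OF e(1)] lookup_minus lookup_single when_def)
  qed
qed

lemma cover_lookup_pos:
  assumes "y \<in> cover k P s u" "c \<in> CC" "v \<in> c" "(if c \<in> P then s c else u) < k"
  shows "lookup y v \<ge> 1"
proof -
  obtain \<mu> where \<mu>: "\<And>c. c \<in> P \<Longrightarrow> cnt \<mu> c \<le> s c" "(\<Sum>c\<in>CC - P. cnt \<mu> c) \<le> u"
    "\<And>v. k \<le> lookup y v + edeg \<mu> v" using coverE[OF assms(1)] by blast
  have "cnt \<mu> c < k"
  proof (cases "c \<in> P")
    case True
    then show ?thesis using \<mu>(1) assms(4) by fastforce
  next
    case False
    then have "cnt \<mu> c \<le> (\<Sum>c\<in>CC - P. cnt \<mu> c)" using assms(2) by (intro member_le_sum) auto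
    then show ?thesis using \<mu>(2) assms(4) False by simp
  qed
  then show ?thesis using \<mu>(3)[of v] edeg_le_cnt[OF assms(2,3), of \<mu>] by linarith
qed

text \<open>
  The covers are built by fixing the number of edges in one component after the other. For a
  component \<open>j\<close>, adding the multisets with one more edge in \<open>j\<close> is a Mayer--Vietoris step whose
  intersection has an edge to spare in \<open>j\<close> and also outside \<open>j\<close>, which gives the two cones.
\<close>

lemma cover_cycles_lift:
  assumes "P \<subseteq> CC" "\<And>c. c \<in> P \<Longrightarrow> s c \<le> k" "u \<le> k"
  shows "cycles_lift TYPE('k::field) (cover k P s u)"
  using assms
proof (induction "card (CC - P)" arbitrary: P s u rule: less_induct)
  case less
  show ?case
  proof (cases "CC - P = {}")
    case True
    then have "P = CC" using less.prems(1) by blast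
    then show ?thesis
      using linear_quotients_cycles_lift[OF cover_linear_quotients] less.prems(2) by blast
  next
    case False
    then obtain j where j: "j \<in> CC" "j \<notin> P" by blast
    let ?P = "insert j P"
    have card: "card (CC - ?P) < card (CC - P)"
      by (rule psubset_card_mono) (use j in auto)
    have IH: "cycles_lift TYPE('k) (cover k ?P (s(j := a)) b)" if "a \<le> k" "b \<le> k" for a b
      by (rule less.hyps[OF card]) (use less.prems j that in auto)
    have sumP: "(\<Sum>c\<in>CC - P. cnt \<mu> c) = cnt \<mu> j + (\<Sum>c\<in>CC - ?P. cnt \<mu> c)" for \<mu>
    proof -
      have "CC - P = insert j (CC - ?P)" using j by auto
      then show ?thesis by (simp add: sum.insert)
    qed
    show ?thesis
    proof (cases "CC - ?P = {}")
      case True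
      have "cover k P s u = cover k ?P (s(j := u)) 0"
        unfolding cover_def sumP True using j(2) by (intro Collect_cong ex_cong1) (auto split: if_splits)
      then show ?thesis using IH[of u 0] less.prems(3) by simp
    next
      case False
      then obtain j' where j': "j' \<in> CC" "j' \<notin> ?P" by blast
      obtain v e where e: "v \<in> j" "e \<in> E" "v \<in> e" using nonempty[OF j(1)] covered[OF j(1)] by blast
      obtain w f where f: "w \<in> j'" "f \<in> E" "w \<in> f" using nonempty[OF j'(1)] covered[OF j'(1)] by blast
      have ej: "e \<subseteq> j" "f \<subseteq> j'" using edge_in_comp e f j j' by blast+
      define X where "X a = cover k ?P (s(j := a)) (u - a)" for a
      define U where "U a = (\<Union>a'\<le>a. X a')" for a
      have upX: "upclosed (X a)" for a unfolding X_def by (rule upclosed_cover)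
      have upU: "upclosed (U a)" for a unfolding U_def using upX by (auto simp: upclosed_def)
      have int: "U a \<inter> X (Suc a) = cover k ?P (s(j := a)) (u - Suc a)" for a
      proof (intro equalityI subsetI)
        fix y assume "y \<in> U a \<inter> X (Suc a)"
        then obtain a' where a': "a' \<le> a" "y \<in> X a'" "y \<in> X (Suc a)" unfolding U_def by blast
        obtain \<mu>1 where \<mu>1: "\<And>c. c \<in> ?P \<Longrightarrow> cnt \<mu>1 c \<le> (s(j := a')) c"
          "\<And>v. k \<le> lookup y v + edeg \<mu>1 v" using coverE[OF a'(2)[unfolded X_def]] by blast
        obtain \<mu>2 where \<mu>2: "\<And>c. c \<in> ?P \<Longrightarrow> cnt \<mu>2 c \<le> (s(j := Suc a)) c" "(\<Sum>c\<in>CC - ?P. cnt \<mu>2 c) \<le> u - Suc a"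
          "\<And>v. k \<le> lookup y v + edeg \<mu>2 v" using coverE[OF a'(3)[unfolded X_def]] by blast
        define \<mu> where "\<mu> e = (if e \<subseteq> j then \<mu>1 e else \<mu>2 e)" for e
        have c1: "cnt \<mu> j = cnt \<mu>1 j" by (simp add: cnt_def \<mu>_def)
        have c2: "cnt \<mu> c = cnt \<mu>2 c" if "c \<in> CC" "c \<noteq> j" for c
          unfolding cnt_def \<mu>_def using edge_comp_unique[OF _ _ _ that(1) j(1)] that(2) by (intro sum.cong) auto
        show "y \<in> cover k ?P (s(j := a)) (u - Suc a)"
        proof (rule coverI)
          show "cnt \<mu> c \<le> (s(j := a)) c" if "c \<in> ?P" for c
            using \<mu>1(1)[of j] \<mu>2(1)[of c] c1 c2[of c] that a'(1) less.prems(1) by (auto split: if_splits)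
          have "(\<Sum>c\<in>CC - ?P. cnt \<mu> c) = (\<Sum>c\<in>CC - ?P. cnt \<mu>2 c)" using c2 by (intro sum.cong) auto
          then show "(\<Sum>c\<in>CC - ?P. cnt \<mu> c) \<le> u - Suc a" using \<mu>2(2) by simp
          show "k \<le> lookup y x + edeg \<mu> x" for x
          proof (cases "x \<in> j")
            case True
            then have "edeg \<mu> x = edeg \<mu>1 x"
              unfolding edeg_def \<mu>_def using edge_in_comp[OF _ _ j(1) True] by (intro sum.cong) auto
            then show ?thesis using \<mu>1(2) by simp
          next
            case False
            then have "edeg \<mu> x = edeg \<mu>2 x" unfolding edeg_def \<mu>_def by (intro sum.cong) auto
            then show ?thesis using \<mu>2(3) by simp
          qed
        qed
      next
        fix y assume "y \<in> cover k ?P (s(j := a)) (u - Suc a)"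
        then obtain \<mu> where \<mu>: "\<And>c. c \<in> ?P \<Longrightarrow> cnt \<mu> c \<le> (s(j := a)) c" "(\<Sum>c\<in>CC - ?P. cnt \<mu> c) \<le> u - Suc a"
          "\<And>v. k \<le> lookup y v + edeg \<mu> v" by (rule coverE) blast
        have "y \<in> X a" unfolding X_def by (rule coverI[OF \<mu>(1) _ \<mu>(3)]) (use \<mu>(2) in auto)
        moreover have "y \<in> X (Suc a)" unfolding X_def
          by (rule coverI[OF _ \<mu>(2,3)]) (use \<mu>(1) in \<open>fastforce split: if_splits\<close>)
        ultimately show "y \<in> U a \<inter> X (Suc a)" unfolding U_def by blast
      qed
      have "a \<le> u \<Longrightarrow> cycles_lift TYPE('k) (U a)" for a
      proof (induction a)
        case 0
        have "U 0 = X 0" by (simp add: U_def)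
        then show ?case unfolding X_def using IH[of 0 u] less.prems(3) by simp
      next
        case (Suc a)
        have U: "U (Suc a) = U a \<union> X (Suc a)" by (auto simp: U_def atMost_Suc)
        show ?case
          unfolding U
        proof (rule cycles_lift_union[OF upU upX, where v = w and w = v])
          show "cycles_lift TYPE('k) (U a)" using Suc by simp
          show "cycles_lift TYPE('k) (X (Suc a))"
            unfolding X_def by (rule IH) (use Suc.prems less.prems(3) in auto)
          show "cycles_lift TYPE('k) (U a \<inter> X (Suc a))"
            unfolding int by (rule IH) (use Suc.prems less.prems(3) in auto)
          fix y assume y: "y \<in> U a \<inter> X (Suc a)"
          note y = y[unfolded int]
          show "lookup y w \<ge> 1"
            by (rule cover_lookup_pos[OF y j'(1) f(1)]) (use j' Suc.prems less.prems(3) in auto)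
          show "lookup y v \<ge> 1"
            by (rule cover_lookup_pos[OF y j(1) e(1)]) (use Suc.prems less.prems(3) in auto)
          have "y - single w 1 \<in> X a"
            unfolding X_def
          proof (rule cover_cone[OF y f(2,3)])
            show "(s(j := a)) c + (if f \<subseteq> c then 1 else 0) \<le> (s(j := a)) c" if "c \<in> ?P" for c
              using edge_comp_unique[OF f(2) ej(2) _ j'(1), of c] that j' j less.prems(1) by auto
          qed (use Suc.prems in auto)
          then show "y - single w 1 \<in> U a" unfolding U_def by blast
          show "y - single v 1 \<in> X (Suc a)"
            unfolding X_def
          proof (rule cover_cone[OF y e(2,3)])
            show "(s(j := a)) c + (if e \<subseteq> c then 1 else 0) \<le> (s(j := Suc a)) c" if "c \<in> ?P" for c
            proof (cases "c = j")
              case False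
              have "c \<in> CC" using that False less.prems(1) by blast
              then have "\<not> e \<subseteq> c" using edge_comp_unique[OF e(2) ej(1) _ j(1), of c] False by blast
              then show ?thesis using False by simp
            qed simp
            have "\<not> (\<exists>c\<in>CC - ?P. e \<subseteq> c)"
            proof
              assume "\<exists>c\<in>CC - ?P. e \<subseteq> c"
              then obtain c where c: "c \<in> CC" "c \<noteq> j" "e \<subseteq> c" by auto
              then show False using edge_comp_unique[OF e(2) ej(1) c(3) j(1) c(1)] by simp
            qed
            then show "u - Suc a + (if \<exists>c\<in>CC - ?P. e \<subseteq> c then 1 else 0) \<le> u - Suc a" by simp
          qed
        qed
      qed
      moreover have "cover k P s u = U u"
      proof (intro equalityI subsetI)
        fix y assume "y \<in> cover k P s u"
        then obtain \<mu> where \<mu>: "\<And>c. c \<in> P \<Longrightarrow> cnt \<mu> c \<le> s c" "(\<Sum>c\<in>CC - P. cnt \<mu> c) \<le> u"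
          "\<And>v. k \<le> lookup y v + edeg \<mu> v" by (rule coverE) blast
        have "y \<in> X (cnt \<mu> j)" unfolding X_def
          by (rule coverI[OF _ _ \<mu>(3)]) (use \<mu>(1,2) sumP in \<open>auto split: if_splits\<close>)
        then show "y \<in> U u" unfolding U_def using \<mu>(2) sumP[of \<mu>] by auto
      next
        fix y assume "y \<in> U u"
        then obtain a where a: "a \<le> u" "y \<in> X a" unfolding U_def by blast
        obtain \<mu> where \<mu>: "\<And>c. c \<in> ?P \<Longrightarrow> cnt \<mu> c \<le> (s(j := a)) c" "(\<Sum>c\<in>CC - ?P. cnt \<mu> c) \<le> u - a"
          "\<And>v. k \<le> lookup y v + edeg \<mu> v" using coverE[OF a(2)[unfolded X_def]] by blast
        show "y \<in> cover k P s u"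
        proof (rule coverI[OF _ _ \<mu>(3)])
          show "cnt \<mu> c \<le> s c" if "c \<in> P" for c using \<mu>(1)[of c] that j(2) by (auto split: if_splits)
          show "(\<Sum>c\<in>CC - P. cnt \<mu> c) \<le> u" unfolding sumP using \<mu>(1)[of j] \<mu>(2) a(1) by simp
        qed
      qed
      ultimately show ?thesis by simp
    qed
  qed
qed

end

section \<open>Search orders\<close>

text \<open>
  Number the vertices by their distance from a chosen root of their component, breaking ties
  arbitrarily; the vertex before \<open>v\<close> on a shortest path from the root to \<open>v\<close> is an earlier neighbour of \<open>v\<close>.
\<close>

lemma edge_search_exists:
  fixes E :: "'n::finite set set"
  assumes simple: "simple_graph E"
  obtains CC \<rho> where "edge_search E CC \<rho>"
proof -
  define R where "R = {(u, v). {u, v} \<in> E}"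
  have sym: "sym (R\<^sup>*)" by (rule sym_rtrancl) (auto simp: R_def sym_def insert_commute)
  define comp where "comp v = {w. (v, w) \<in> R\<^sup>*}" for v
  have self: "v \<in> comp v" for v by (simp add: comp_def)
  have comp_eq: "comp u = comp v" if "u \<in> comp v" for u v
    using that sym unfolding comp_def by (auto dest: symD intro: rtrancl_trans)
  define CC where "CC = comp ` {v. \<exists>e\<in>E. v \<in> e}"
  define root where "root c = (SOME w. w \<in> c)" for c :: "'n set"
  define dist where "dist v = (LEAST n. (root (comp v), v) \<in> R ^^ n)" for v
  define N where "N = Suc (Max (range (vnum :: 'n \<Rightarrow> nat)))"
  define \<rho> where "\<rho> v = dist v * N + vnum v" for v :: 'n
  have vN: "vnum v < N" for v :: 'n unfolding N_def by (simp add: less_Suc_eq_le)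
  have root: "root (comp v) \<in> comp v" for v unfolding root_def using self by (rule someI)
  have dist: "(root (comp v), v) \<in> R ^^ dist v" for v
  proof -
    have "(root (comp v), v) \<in> R\<^sup>*" using root[of v] sym unfolding comp_def by (auto dest: symD)
    then obtain n where "(root (comp v), v) \<in> R ^^ n" using rtrancl_imp_relpow by metis
    then show ?thesis unfolding dist_def by (rule LeastI)
  qed
  have less: "\<rho> u < \<rho> v" if "dist u < dist v" for u v
  proof -
    have "\<rho> u < Suc (dist u) * N" using vN[of u] by (simp add: \<rho>_def)
    also have "\<dots> \<le> dist v * N" using that by (intro mult_right_mono) auto
    also have "\<dots> \<le> \<rho> v" by (simp add: \<rho>_def)
    finally show ?thesis .
  qed
  have pair: "\<exists>a b. e = {a, b} \<and> a \<noteq> b" if "e \<in> E" for e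
    using simple that unfolding simple_graph_def by (meson card_2_iff)
  have "edge_search E CC \<rho>"
  proof
    show "simple_graph E" by (rule simple)
    show "c \<inter> c' = {}" if c: "c \<in> CC" "c' \<in> CC" "c \<noteq> c'" for c c'
    proof (rule ccontr)
      assume "c \<inter> c' \<noteq> {}"
      then obtain u where u: "u \<in> c" "u \<in> c'" by blast
      obtain v v' where v: "c = comp v" "c' = comp v'" using c unfolding CC_def by blast
      show False using comp_eq[of u v] comp_eq[of u v'] u v c(3) by simp
    qed
    show "\<exists>c\<in>CC. e \<subseteq> c" if e: "e \<in> E" for e
    proof -
      obtain a b where ab: "e = {a, b}" using pair[OF e] by blast
      have "e \<subseteq> comp a" using e self[of a] unfolding ab comp_def R_def by (auto intro!: r_into_rtrancl)
      moreover have "comp a \<in> CC" unfolding CC_def using e ab by blast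
      ultimately show ?thesis by blast
    qed
    show "\<exists>e\<in>E. v \<in> e" if c: "c \<in> CC" "v \<in> c" for c v
    proof -
      obtain u where u: "c = comp u" "\<exists>e\<in>E. u \<in> e" using c(1) unfolding CC_def by blast
      have "(u, v) \<in> R\<^sup>*" using c(2) u(1) by (simp add: comp_def)
      then show ?thesis
      proof (cases rule: rtranclE)
        case base
        then show ?thesis using u(2) by simp
      next
        case (step y)
        then show ?thesis unfolding R_def by blast
      qed
    qed
    show "c \<noteq> {}" if "c \<in> CC" for c using that self unfolding CC_def by blast
    show "inj \<rho>"
    proof (rule injI)
      fix u v assume "\<rho> u = \<rho> v"
      then have "\<rho> u mod N = \<rho> v mod N" by simp
      then have "vnum u = vnum v" using vN[of u] vN[of v] by (simp add: \<rho>_def)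
      then show "u = v" by (rule injD[OF inj_vnum])
    qed
    show "(\<exists>z. {v, z} \<in> E \<and> \<rho> z < \<rho> v) \<or> (\<forall>w\<in>c. \<rho> v \<le> \<rho> w)" if c: "c \<in> CC" "v \<in> c" for c v
    proof -
      obtain u where u: "c = comp u" using c(1) unfolding CC_def by blast
      have cw: "comp w = c" if "w \<in> c" for w using comp_eq[of w u] that u by simp
      show ?thesis
      proof (cases "dist v")
        case 0
        have "\<rho> v \<le> \<rho> w" if w: "w \<in> c" for w
        proof (cases "dist w")
          case d: 0
          have "v = root c" "w = root c" using dist[of v] dist[of w] 0 d cw[OF c(2)] cw[OF w] by simp_all
          then show ?thesis by simp
        next
          case (Suc n)
          then show ?thesis using less[of v w] 0 by simp
        qed
        then show ?thesis by blast
      next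
        case (Suc n)
        then obtain z where z: "(root c, z) \<in> R ^^ n" "(z, v) \<in> R"
          using dist[of v] cw[OF c(2)] by auto
        have "z \<in> c"
        proof -
          have "(v, z) \<in> R\<^sup>*" using z(2) sym by (meson r_into_rtrancl symD)
          then show ?thesis using cw[OF c(2)] unfolding comp_def by auto
        qed
        then have "dist z \<le> n" unfolding dist_def using z(1) cw[of z] by (intro Least_le) simp
        then have "\<rho> z < \<rho> v" using less[of z v] Suc by simp
        then show ?thesis using z(2) unfolding R_def by (auto simp: insert_commute)
      qed
    qed
  qed
  then show thesis by (rule that)
qed

section \<open>Powers of the complementary edge ideal\<close>

lemma module_mult: "module ((*) :: 'a::comm_ring_1 \<Rightarrow> 'a \<Rightarrow> 'a)"
  by unfold_locales (simp_all add: algebra_simps)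

definition supported :: "('n \<Rightarrow>\<^sub>0 nat) set \<Rightarrow> ('n, 'k::comm_ring_1) mpoly set" where
  "supported M = {f. keys f \<subseteq> M}"

lemma supported_add: "f \<in> supported M \<Longrightarrow> g \<in> supported M \<Longrightarrow> f + g \<in> supported M"
  using keys_add[of f g] by (auto simp: supported_def)

lemma supported_mult: "upclosed M \<Longrightarrow> f \<in> supported M \<Longrightarrow> c * f \<in> supported M"
  using keys_mult[of c f] by (fastforce simp: supported_def upclosed_def add.commute)

lemma supported_ideal: "upclosed M \<Longrightarrow> is_ideal (supported M)"
  unfolding is_ideal_def by (intro conjI ballI allI supported_add supported_mult) (simp add: supported_def)

lemma sum_single: "(\<Sum>m\<in>keys f. single m (lookup f m)) = f"
  by (rule poly_mapping_eqI) (auto simp: lookup_sum lookup_single when_def in_keys_iff)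

text \<open>A monomial ideal is spanned by the monomials that it contains.\<close>

lemma ideal_gen_eq_supported:
  fixes X :: "('n, 'k::comm_ring_1) mpoly set"
  assumes "upclosed M" "X \<subseteq> supported M"
    and "\<And>m c. m \<in> M \<Longrightarrow> single m c \<in> ideal_gen X"
  shows "ideal_gen X = supported M"
proof -
  interpret module "(*) :: ('n, 'k) mpoly \<Rightarrow> _" by (rule module_mult)
  show ?thesis
  proof (intro equalityI subsetI)
    fix f assume "f \<in> span X"
    moreover have "subspace (supported M :: ('n, 'k) mpoly set)"
      using supported_ideal[OF assms(1)] unfolding is_ideal_def subspace_def by blast
    ultimately show "f \<in> supported M" using span_minimal[OF assms(2)] by blast
  next
    fix f :: "('n, 'k) mpoly" assume f: "f \<in> supported M"
    have "(\<Sum>m\<in>keys f. single m (lookup f m)) \<in> span X"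
      by (intro span_sum assms(3)) (use f in \<open>auto simp: supported_def\<close>)
    then show "f \<in> span X" by (simp only: sum_single)
  qed
qed

lemma ideal_mult_supported:
  fixes A B :: "('n \<Rightarrow>\<^sub>0 nat) set"
  assumes "upclosed A"
  shows "ideal_mult (supported A :: ('n, 'k::comm_ring_1) mpoly set) (supported B)
     = supported {a + b | a b. a \<in> A \<and> b \<in> B}"
  unfolding ideal_mult_def
proof (rule ideal_gen_eq_supported)
  interpret module "(*) :: ('n, 'k) mpoly \<Rightarrow> _" by (rule module_mult)
  show "upclosed {a + b | a b. a \<in> A \<and> b \<in> B}"
    unfolding upclosed_def
  proof clarify
    fix a b q assume "a \<in> A" "b \<in> B"
    then have "a + b + q = (a + q) + b \<and> a + q \<in> A \<and> b \<in> B"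
      using upclosedD[OF assms] by (simp add: ac_simps)
    then show "\<exists>a' b'. a + b + q = a' + b' \<and> a' \<in> A \<and> b' \<in> B" by blast
  qed
  show "{f * g | f g. f \<in> supported A \<and> g \<in> supported B}
      \<subseteq> (supported {a + b | a b. a \<in> A \<and> b \<in> B} :: ('n, 'k) mpoly set)"
    unfolding supported_def using keys_mult by fastforce
  fix m and c :: 'k assume "m \<in> {a + b | a b. a \<in> A \<and> b \<in> B}"
  then obtain a b where "m = a + b" "a \<in> A" "b \<in> B" by blast
  then have "single m c = single a c * single b 1"
    "single a c \<in> supported A" "(single b 1 :: ('n, 'k) mpoly) \<in> supported B"
    by (auto simp: mult_single supported_def split: if_splits)
  then show "single m c \<in> span {f * g | f g. f \<in> supported A \<and> g \<in> supported B}"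
    by (intro span_base) blast
qed

definition ind :: "'n set \<Rightarrow> ('n \<Rightarrow>\<^sub>0 nat)" where
  "ind S = (\<Sum>v\<in>S. single v 1)"

lemma lookup_ind: "lookup (ind S) v = of_bool (v \<in> S)" for S :: "'n::finite set"
  by (simp add: ind_def lookup_sum lookup_single when_def)

lemma prod_var: "(\<Prod>v\<in>S. var v) = single (ind S) 1" for S :: "'n::finite set"
proof -
  have "finite S" by simp
  then show ?thesis by induction (simp_all add: ind_def var_def mult_single)
qed

text \<open>
  The multiples of the products of \<open>k\<close> generators: such a product has exponent vector \<open>(k, \<dots>, k) - d\<close>, where
  \<open>d\<close> is the degree vector of the multiset \<open>\<mu>\<close> of edges.
\<close>

definition multi_edge_monomials :: "'n set set \<Rightarrow> nat \<Rightarrow> ('n \<Rightarrow>\<^sub>0 nat) set" where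
  "multi_edge_monomials E k = {m. \<exists>\<mu>. (\<Sum>e\<in>E. \<mu> e) = k \<and>
     (\<forall>v. k \<le> lookup m v + (\<Sum>e | e \<in> E \<and> v \<in> e. \<mu> e))}"

lemma comp_edge_ideal_supported:
  fixes E :: "'n::finite set set"
  shows "(comp_edge_ideal E :: ('n, 'k::field) mpoly set) = supported (\<Union>e\<in>E. up (ind (UNIV - e)))"
  unfolding comp_edge_ideal_def
proof (rule ideal_gen_eq_supported)
  interpret module "(*) :: ('n, 'k) mpoly \<Rightarrow> _" by (rule module_mult)
  show "upclosed (\<Union>e\<in>E. up (ind (UNIV - e)))"
    using upclosed_up unfolding upclosed_def by blast
  show "(\<lambda>e. \<Prod>v\<in>UNIV - e. var v) ` E \<subseteq> (supported (\<Union>e\<in>E. up (ind (UNIV - e))) :: ('n, 'k) mpoly set)"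
    by (auto simp: prod_var supported_def up_def)
  fix m and c :: 'k assume "m \<in> (\<Union>e\<in>E. up (ind (UNIV - e)))"
  then obtain e where e: "e \<in> E" "m \<in> up (ind (UNIV - e))" by blast
  have "m = (m - ind (UNIV - e)) + ind (UNIV - e)"
    using e(2) by (intro poly_mapping_eqI) (simp add: up_def lookup_add lookup_minus)
  then have "single m c = single (m - ind (UNIV - e)) c * (\<Prod>v\<in>UNIV - e. var v)"
    unfolding prod_var mult_single by simp
  then show "single m c \<in> span ((\<lambda>e. \<Prod>v\<in>UNIV - e. var v) ` E)"
    using e(1) by (simp only:) (intro span_scale span_base imageI)
qed

text \<open>
  One edge \<open>e\<close> of the multiset is split off. A vertex outside \<open>e\<close> is covered by at most \<open>k\<close> of the
  \<open>k + 1\<close> edges, so its variable still divides the monomial.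
\<close>

lemma multi_edge_monomials_Suc:
  fixes E :: "'n::finite set set"
  shows "{a + b | a b. a \<in> (\<Union>e\<in>E. up (ind (UNIV - e))) \<and> b \<in> multi_edge_monomials E k}
    = multi_edge_monomials E (Suc k)"
proof (intro equalityI subsetI)
  fix m assume "m \<in> {a + b | a b. a \<in> (\<Union>e\<in>E. up (ind (UNIV - e))) \<and> b \<in> multi_edge_monomials E k}"
  then obtain a b e where m: "m = a + b" "e \<in> E" "a \<in> up (ind (UNIV - e))" "b \<in> multi_edge_monomials E k" by blast
  then obtain \<mu> where \<mu>: "(\<Sum>e\<in>E. \<mu> e) = k"
    "\<And>v. k \<le> lookup b v + (\<Sum>e | e \<in> E \<and> v \<in> e. \<mu> e)"
    unfolding multi_edge_monomials_def by blast
  define \<nu> where "\<nu> d = \<mu> d + of_bool (d = e)" for d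
  have \<nu>: "(\<Sum>d\<in>S. \<nu> d) = (\<Sum>d\<in>S. \<mu> d) + of_bool (e \<in> S)" for S :: "'n set set"
    by (simp add: \<nu>_def sum.distrib of_bool_def)
  have "Suc k \<le> lookup m v + (\<Sum>d | d \<in> E \<and> v \<in> d. \<nu> d)" for v
  proof -
    have "of_bool (v \<notin> e) \<le> lookup a v"
      using m(3) by (auto simp: up_def lookup_ind dest: spec[of _ v])
    then show ?thesis using \<mu>(2)[of v] m(1,2) unfolding \<nu> by (cases "v \<in> e") (simp_all add: lookup_add)
  qed
  moreover have "(\<Sum>d\<in>E. \<nu> d) = Suc k" using \<mu>(1) m(2) unfolding \<nu> by simp
  ultimately show "m \<in> multi_edge_monomials E (Suc k)" unfolding multi_edge_monomials_def by blast
next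
  fix m assume "m \<in> multi_edge_monomials E (Suc k)"
  then obtain \<mu> where \<mu>: "(\<Sum>e\<in>E. \<mu> e) = Suc k"
    "\<And>v. Suc k \<le> lookup m v + (\<Sum>e | e \<in> E \<and> v \<in> e. \<mu> e)"
    unfolding multi_edge_monomials_def by blast
  have "\<exists>e\<in>E. \<mu> e \<noteq> 0" using \<mu>(1) by (metis nat.distinct(1) sum.neutral)
  then obtain e where e: "e \<in> E" "\<mu> e \<noteq> 0" by blast
  define \<nu> where "\<nu> = \<mu>(e := \<mu> e - 1)"
  have \<mu>\<nu>: "(\<Sum>d\<in>S. \<mu> d) = (\<Sum>d\<in>S. \<nu> d) + of_bool (e \<in> S)" for S :: "'n set set"
  proof -
    have "(\<Sum>d\<in>S. \<mu> d) = (\<Sum>d\<in>S. \<nu> d + of_bool (d = e))"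
      using e(2) by (intro sum.cong) (auto simp: \<nu>_def)
    then show ?thesis by (simp add: sum.distrib of_bool_def)
  qed
  have \<nu>k: "(\<Sum>d\<in>E. \<nu> d) = k" using \<mu>(1) e(1) unfolding \<mu>\<nu> by simp
  have pos: "of_bool (v \<notin> e) \<le> lookup m v" for v
  proof (cases "v \<in> e")
    case False
    have "(\<Sum>d | d \<in> E \<and> v \<in> d. \<nu> d) \<le> (\<Sum>d\<in>E. \<nu> d)" by (rule sum_mono2) auto
    then show ?thesis using \<mu>(2)[of v] \<nu>k False unfolding \<mu>\<nu> by simp
  qed simp
  then have me: "m \<in> up (ind (UNIV - e))" by (simp add: up_def lookup_ind)
  have "k \<le> lookup (m - ind (UNIV - e)) v + (\<Sum>d | d \<in> E \<and> v \<in> d. \<nu> d)" for v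
    using \<mu>(2)[of v] e(1) pos[of v] unfolding \<mu>\<nu> by (cases "v \<in> e") (simp_all add: lookup_minus lookup_ind)
  then have "m - ind (UNIV - e) \<in> multi_edge_monomials E k"
    unfolding multi_edge_monomials_def using \<nu>k by blast
  moreover have "m = ind (UNIV - e) + (m - ind (UNIV - e))"
    using me by (intro poly_mapping_eqI) (simp add: up_def lookup_add lookup_minus)
  moreover have "ind (UNIV - e) \<in> (\<Union>e\<in>E. up (ind (UNIV - e)))" using e(1) by (auto simp: up_def)
  ultimately show "m \<in> {a + b | a b. a \<in> (\<Union>e\<in>E. up (ind (UNIV - e))) \<and> b \<in> multi_edge_monomials E k}"
    by blast
qed

lemma ideal_power_supported:
  fixes E :: "'n::finite set set"
  shows "ideal_power (comp_edge_ideal E :: ('n, 'k::field) mpoly set) k = supported (multi_edge_monomials E k)"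
proof (induction k)
  case 0
  have "multi_edge_monomials E 0 = UNIV"
    unfolding multi_edge_monomials_def by (auto intro: exI[of _ "\<lambda>_. 0"])
  then show ?case by (simp add: supported_def)
next
  case (Suc k)
  have "upclosed (\<Union>e\<in>E. up (ind (UNIV - e)))"
    using upclosed_up unfolding upclosed_def by blast
  then show ?case
    unfolding ideal_power.simps Suc unfolding comp_edge_ideal_supported
    by (subst ideal_mult_supported) (simp_all only: multi_edge_monomials_Suc)
qed

lemma upclosed_multi_edge_monomials: "upclosed (multi_edge_monomials E k)"
  unfolding upclosed_def
proof (intro ballI allI)
  fix m q assume "m \<in> multi_edge_monomials E k"
  then obtain \<mu> where \<mu>: "(\<Sum>e\<in>E. \<mu> e) = k"
    "\<And>v. k \<le> lookup m v + (\<Sum>e | e \<in> E \<and> v \<in> e. \<mu> e)"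
    unfolding multi_edge_monomials_def by blast
  have "k \<le> lookup (m + q) v + (\<Sum>e | e \<in> E \<and> v \<in> e. \<mu> e)" for v
    using \<mu>(2)[of v] by (simp add: lookup_add)
  then show "m + q \<in> multi_edge_monomials E k"
    unfolding multi_edge_monomials_def using \<mu>(1) by blast
qed

lemma multi_edge_monomials_cycles_lift:
  fixes E :: "'n::finite set set"
  assumes "simple_graph E" "k \<ge> 1"
  shows "cycles_lift TYPE('k::field) (multi_edge_monomials E k)"
proof (cases "E = {}")
  case True
  then have "multi_edge_monomials E k = {}" using assms(2) by (simp add: multi_edge_monomials_def)
  then show ?thesis using linear_quotients_cycles_lift[OF linear_quotients.empty] by simp
next
  case False
  then obtain e where e: "e \<in> E" by blast
  obtain CC \<rho> where "edge_search E CC \<rho>" using edge_search_exists[OF assms(1)] .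
  then interpret edge_search E CC \<rho> .
  have "multi_edge_monomials E k = cover k {} (\<lambda>_. 0) k"
  proof (intro equalityI subsetI)
    fix m assume "m \<in> multi_edge_monomials E k"
    then obtain \<mu> where \<mu>: "(\<Sum>e\<in>E. \<mu> e) = k"
      "\<And>v. k \<le> lookup m v + (\<Sum>e | e \<in> E \<and> v \<in> e. \<mu> e)"
      unfolding multi_edge_monomials_def by blast
    show "m \<in> cover k {} (\<lambda>_. 0) k"
      by (rule coverI[of _ \<mu>]) (use \<mu> in \<open>simp_all add: sum_cnt edeg_def\<close>)
  next
    fix m assume "m \<in> cover k {} (\<lambda>_. 0) k"
    then obtain \<mu> where \<mu>: "(\<Sum>c\<in>CC - {}. cnt \<mu> c) \<le> k" "\<And>v. k \<le> lookup m v + edeg \<mu> v"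
      by (rule coverE) blast
    then have le: "(\<Sum>d\<in>E. \<mu> d) \<le> k" by (simp add: sum_cnt)
    define \<nu> where "\<nu> d = \<mu> d + (if d = e then k - (\<Sum>d\<in>E. \<mu> d) else 0)" for d
    have "(\<Sum>d\<in>E. \<nu> d) = (\<Sum>d\<in>E. \<mu> d) + (\<Sum>d\<in>E. if d = e then k - (\<Sum>d\<in>E. \<mu> d) else 0)"
      unfolding \<nu>_def by (rule sum.distrib)
    then have "(\<Sum>d\<in>E. \<nu> d) = k" using le e by simp
    moreover have "k \<le> lookup m v + (\<Sum>d | d \<in> E \<and> v \<in> d. \<nu> d)" for v
    proof -
      have "edeg \<mu> v \<le> (\<Sum>d | d \<in> E \<and> v \<in> d. \<nu> d)" unfolding edeg_def by (rule sum_mono) (simp add: \<nu>_def)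
      then show ?thesis using \<mu>(2)[of v] by linarith
    qed
    ultimately show "m \<in> multi_edge_monomials E k" unfolding multi_edge_monomials_def by blast
  qed
  then show ?thesis using cover_cycles_lift[of "{}" "\<lambda>_. 0" k k] by simp
qed

section \<open>Dimensions of cycles and boundaries\<close>

lemma kch_subspace: "fs.subspace (kch M i j :: ('n::finite cell \<Rightarrow> 'k::field) set)"
  unfolding fs.subspace_def using kch_zero kch_add kch_fscale by blast

lemma kch_span: "(kch M i j :: ('n::finite cell \<Rightarrow> 'k::field) set) \<subseteq> fs.span (red ` delta ` kcells M i j)"
  using kch_span_delta by blast

lemma dim_kch: "fs.dim (kch M i j :: ('n::finite cell \<Rightarrow> 'k::field) set) = card (kcells M i j)"
proof (rule antisym)
  have "fs.dim (kch M i j :: ('n cell \<Rightarrow> 'k) set) \<le> card (red ` delta ` kcells M i j :: ('n cell \<Rightarrow> 'k) set)"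
    by (rule fs.dim_le_card[OF kch_span]) (simp add: finite_kcells)
  also have "\<dots> \<le> card (kcells M i j)"
    unfolding image_image by (rule card_image_le[OF finite_kcells])
  finally show "fs.dim (kch M i j :: ('n cell \<Rightarrow> 'k) set) \<le> card (kcells M i j)" .
  have "fs.dim {0 :: 'n cell \<Rightarrow> 'k} + card (kcells M i j) \<le> fs.dim (kch M i j :: ('n cell \<Rightarrow> 'k) set)"
  proof (rule fs.dim_plus_card_le[where g = "\<lambda>c. red (delta c)", OF _ _ kch_span _ finite_kcells])
    fix a :: "'n cell \<Rightarrow> 'k"
    assume "(\<Sum>d\<in>kcells M i j. fscale (a d) (red (delta d))) \<in> {0 :: 'n cell \<Rightarrow> 'k}"
    then have sum0: "(\<Sum>d\<in>kcells M i j. fscale (a d) (red (delta d))) = (0 :: 'n cell \<Rightarrow> 'k)" by blast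
    have s: "(\<Sum>d\<in>kcells M i j. a d * red (delta d) x) = 0" for x
      using fun_cong[OF sum0, of x] by (simp add: sum_apply fscale_def)
    show "\<forall>d\<in>kcells M i j. a d = 0"
    proof
      fix d assume d: "d \<in> kcells M i j"
      have "(\<Sum>c\<in>kcells M i j. a c * red (delta c) d) = (\<Sum>c\<in>kcells M i j. if c = d then a d else 0)"
        by (intro sum.cong) (auto simp: red_def delta_def)
      then show "a d = 0" using s[of d] d by (simp add: finite_kcells)
    qed
  qed (auto simp: kch_zero finite_kcells intro: kch_red delta_kch)
  then show "card (kcells M i j) \<le> fs.dim (kch M i j :: ('n cell \<Rightarrow> 'k) set)" by simp
qed

text \<open>
  Integral cycles and boundaries that are independent over the field are independent over the rationals,
  so both dimensions can only grow in passing to the rationals; but their sum is the number of cells.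
\<close>

lemma dim_cycles_rat:
  fixes M :: "('n::finite \<Rightarrow>\<^sub>0 nat) set"
  assumes "upclosed M" "cycles_lift TYPE('k::field) M"
  shows "fs.dim {f \<in> kch M i j. kbd f = (0 :: 'n cell \<Rightarrow> 'k)} = fs.dim {f \<in> kch M i j. kbd f = (0 :: 'n cell \<Rightarrow> rat)}"
    and "fs.dim (kbd ` kch M i j :: ('n cell \<Rightarrow> 'k) set) = fs.dim (kbd ` kch M i j :: ('n cell \<Rightarrow> rat) set)"
proof -
  let ?I = "{w \<in> kch M i j. kbd w = 0} :: ('n cell \<Rightarrow> int) set"
  let ?J = "(\<lambda>c. kbd (delta c)) ` kcells M i j"
  let ?ZK = "{f \<in> kch M i j. kbd f = (0 :: 'n cell \<Rightarrow> 'k)}" and ?ZQ = "{f \<in> kch M i j. kbd f = (0 :: 'n cell \<Rightarrow> rat)}"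
  let ?BK = "kbd ` kch M i j :: ('n cell \<Rightarrow> 'k) set" and ?BQ = "kbd ` kch M i j :: ('n cell \<Rightarrow> rat) set"
  have fin: "finite (red ` delta ` kcells M i j)" "finite (red ` ?J)" by (simp_all add: finite_kcells)
  have red0: "red 0 = 0" by (auto simp: red_def fun_eq_iff)
  have IK: "red ` ?I \<subseteq> (kch M i j :: ('n cell \<Rightarrow> 'k) set)" by (auto intro: kch_red)
  have IKs: "fs.span (red ` ?I) \<subseteq> (fs.span (red ` delta ` kcells M i j) :: ('n cell \<Rightarrow> 'k) set)"
    by (rule fs.span_minimal[OF subset_trans[OF IK kch_span] fs.subspace_span])
  have IZ: "red ` ?I \<subseteq> ?ZQ"
  proof
    fix f :: "'n cell \<Rightarrow> rat" assume "f \<in> red ` ?I"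
    then obtain w where w: "f = red w" "w \<in> kch M i j" "kbd w = 0" by blast
    then show "f \<in> ?ZQ" using kch_red[OF w(2)] by (simp only: kbd_red red0 mem_Collect_eq)
  qed
  have ZQ: "?ZQ \<subseteq> fs.span (red ` delta ` kcells M i j)"
    by (rule subset_trans[OF _ kch_span]) blast
  have "fs.dim ?ZK \<le> fs.dim (fs.span (red ` ?I) :: ('n cell \<Rightarrow> 'k) set)"
    by (rule fs.dim_le_dim[OF _ IKs fin(1)], rule subsetI, rule cycles_liftD[OF assms(2)]) simp_all
  also have "\<dots> = fs.dim (red ` ?I :: ('n cell \<Rightarrow> 'k) set)" by (rule fs.dim_span)
  also have "\<dots> \<le> fs.dim ?ZQ"
    by (rule dim_span_red_le[OF IZ ZQ fin(1) IKs fin(1)])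
  finally have Z: "fs.dim ?ZK \<le> fs.dim ?ZQ" .
  have BK: "?BK \<subseteq> fs.span (red ` ?J)" and BQ: "?BQ \<subseteq> fs.span (red ` ?J)" using kbd_span by blast+
  have "fs.dim ?BK \<le> fs.dim (fs.span (red ` ?J) :: ('n cell \<Rightarrow> 'k) set)"
    by (rule fs.dim_le_dim[OF BK subset_refl fin(2)])
  also have "\<dots> = fs.dim (red ` ?J :: ('n cell \<Rightarrow> 'k) set)" by (rule fs.dim_span)
  also have "\<dots> \<le> fs.dim ?BQ"
  proof (rule dim_span_red_le[OF _ BQ fin(2) subset_refl fin(2)])
    show "red ` ?J \<subseteq> ?BQ"
    proof clarify
      fix m \<sigma> assume "(m, \<sigma>) \<in> kcells M i j"
      then show "red (kbd (delta (m, \<sigma>))) \<in> ?BQ"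
        unfolding kbd_red[symmetric] by (intro imageI kch_red delta_kch)
    qed
  qed
  finally have B: "fs.dim ?BK \<le> fs.dim ?BQ" .
  have "fs.dim ?ZK + fs.dim ?BK = card (kcells M i j)"
    by (rule trans[OF rank_nullity[OF linear_kbd kch_subspace kch_span fin(1)] dim_kch])
  moreover have "fs.dim ?ZQ + fs.dim ?BQ = card (kcells M i j)"
    by (rule trans[OF rank_nullity[OF linear_kbd kch_subspace kch_span fin(1)] dim_kch])
  ultimately show "fs.dim ?ZK = fs.dim ?ZQ" "fs.dim ?BK = fs.dim ?BQ" using Z B by linarith+
qed

section \<open>The Koszul complex as a graded free resolution\<close>

text \<open>
  The basis of the \<open>i\<close>-th module is indexed by numbers, so the \<open>i\<close>-element sets are enumerated; \<open>kix\<close> is the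
  inverse of the enumeration.
\<close>

definition kenum :: "nat \<Rightarrow> nat \<Rightarrow> 'n::finite set" where
  "kenum i = (SOME h. bij_betw h {..<card {\<sigma> :: 'n set. card \<sigma> = i}} {\<sigma>. card \<sigma> = i})"

definition kix :: "'n::finite set \<Rightarrow> nat" where
  "kix \<sigma> = the_inv_into {..<card {\<tau> :: 'n set. card \<tau> = card \<sigma>}} (kenum (card \<sigma>)) \<sigma>"

lemma kenum_bij: "bij_betw (kenum i) {..<card {\<sigma> :: 'n::finite set. card \<sigma> = i}} {\<sigma> :: 'n set. card \<sigma> = i}"
proof -
  have "\<exists>h. bij_betw h {..<card {\<sigma> :: 'n set. card \<sigma> = i}} {\<sigma> :: 'n set. card \<sigma> = i}"
    using ex_bij_betw_nat_finite[of "{\<sigma> :: 'n set. card \<sigma> = i}"] by (simp add: atLeast0LessThan)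
  then show ?thesis unfolding kenum_def by (rule someI_ex)
qed

lemma kenum_card: "a < card {\<sigma> :: 'n::finite set. card \<sigma> = i} \<Longrightarrow> card (kenum i a :: 'n set) = i"
  using bij_betwE[OF kenum_bij, of i] by auto

lemma kix_kenum: "a < card {\<sigma> :: 'n::finite set. card \<sigma> = i} \<Longrightarrow> kix (kenum i a :: 'n set) = a"
  unfolding kix_def by (simp add: kenum_card the_inv_into_f_f[OF bij_betw_imp_inj_on[OF kenum_bij]])

lemma kenum_kix: "kenum (card \<sigma>) (kix \<sigma>) = \<sigma>"
  unfolding kix_def
  by (rule f_the_inv_into_f_bij_betw[OF kenum_bij]) simp

lemma kix_less: "kix (\<sigma> :: 'n::finite set) < card {\<tau> :: 'n set. card \<tau> = card \<sigma>}"
proof -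
  have "kix \<sigma> \<in> {..<card {\<tau> :: 'n set. card \<tau> = card \<sigma>}}"
    unfolding kix_def
    by (rule the_inv_into_into[OF bij_betw_imp_inj_on[OF kenum_bij]])
      (simp_all add: bij_betw_imp_surj_on[OF kenum_bij])
  then show ?thesis by simp
qed

text \<open>
  The sum in a matrix entry has at most one term, for the vertex that the column set has in addition
  to the row set.
\<close>

definition koszul :: "('n::finite, 'k::field) free_seq" where
  "koszul = \<lparr> rk = \<lambda>i. card {\<sigma> :: 'n set. card \<sigma> = i}, shift = \<lambda>i b. int i,
     diff = \<lambda>i a b. \<Sum>v | v \<notin> (kenum (i - 1) a :: 'n set) \<and> insert v (kenum (i - 1) a) = kenum i b.
        ksgn v (kenum (i - 1) a) * var v \<rparr>"

lemma rk_koszul: "rk (koszul :: ('n::finite, 'k::field) free_seq) i = card {\<sigma> :: 'n set. card \<sigma> = i}"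
  by (simp add: koszul_def)

lemma shift_koszul: "shift koszul i b = int i"
  by (simp add: koszul_def)

lemma add_eq_iff_minus:
  fixes a q m :: "'n \<Rightarrow>\<^sub>0 nat"
  shows "m = a + q \<longleftrightarrow> m \<in> up a \<and> q = m - a"
proof
  assume "m \<in> up a \<and> q = m - a"
  then show "m = a + q" by (intro poly_mapping_eqI) (simp add: up_def lookup_add lookup_minus)
qed (simp add: up_def lookup_add)

lemma lookup_single_mult:
  fixes g :: "('n, 'k::comm_ring_1) mpoly"
  shows "lookup (single a c * g) m
    = (if m \<in> up a then c * lookup g (m - a) else 0)"
proof -
  have "(\<Sum>q. lookup g q when m = a + q)
      = (if m \<in> up a then lookup g (m - a) else 0)"
    unfolding add_eq_iff_minus by (cases "m \<in> up a") simp_all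
  then show ?thesis by (simp add: lookup_mult lookup_single when_mult)
qed

lemma lookup_var_mult:
  "lookup (var v * g) m
    = (if lookup m v \<ge> 1 then lookup g (m - single v 1) else 0)"
  unfolding var_def lookup_single_mult by (auto simp: up_def lookup_single when_def)

lemma lookup_ksgn_mult: "lookup (ksgn v \<sigma> * g) m = ksgn v \<sigma> * lookup g m"
  for g :: "('n, 'k::comm_ring_1) mpoly"
proof -
  have "lookup ((- 1) ^ n * g) m = (- 1) ^ n * lookup g m" for n
    by (induction n) (simp_all add: mult.assoc)
  then show ?thesis by (simp add: ksgn_def)
qed

text \<open>Tuples of polynomials in homological degree \<open>i\<close> as functions on cells.\<close>

definition toc :: "nat \<Rightarrow> (nat \<Rightarrow>\<^sub>0 ('n::finite, 'k::field) mpoly) \<Rightarrow> 'n cell \<Rightarrow> 'k" where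
  "toc i u = (\<lambda>(m, \<sigma>). if card \<sigma> = i then lookup (lookup u (kix \<sigma>)) m else 0)"

lemma toc_bdry:
  fixes u :: "nat \<Rightarrow>\<^sub>0 ('n::finite, 'k::field) mpoly"
  shows "toc i (bdry koszul (*) (Suc i) u) = kbd (toc (Suc i) u)"
proof (rule ext, clarify)
  fix m and \<sigma> :: "'n set"
  show "toc i (bdry koszul (*) (Suc i) u) (m, \<sigma>) = kbd (toc (Suc i) u) (m, \<sigma>)"
  proof (cases "card \<sigma> = i")
    case False
    then have "kbd (toc (Suc i) u) (m, \<sigma>) = 0"
      unfolding kbd_def split by (intro sum.neutral) (auto simp: toc_def)
    then show ?thesis using False by (simp add: toc_def)
  next
    case True
    let ?r = "card {\<tau> :: 'n set. card \<tau> = Suc i}"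
    let ?V = "\<lambda>b. {v. v \<notin> \<sigma> \<and> insert v \<sigma> = kenum (Suc i) b}"
    have less: "kix \<sigma> < rk (koszul :: ('n, 'k) free_seq) i" using kix_less[of \<sigma>] True by (simp add: rk_koszul)
    have enum: "kenum i (kix \<sigma>) = \<sigma>" using kenum_kix[of \<sigma>] True by simp
    have diff: "diff koszul (Suc i) (kix \<sigma>) b = (\<Sum>v\<in>?V b. ksgn v \<sigma> * var v :: ('n, 'k) mpoly)" for b
      by (simp add: koszul_def enum)
    let ?t = "\<lambda>v b. ksgn v \<sigma> * (if lookup m v \<ge> 1
        then lookup (lookup u b) (m - single v 1) else 0)"
    have "toc i (bdry koszul (*) (Suc i) u) (m, \<sigma>)
        = (\<Sum>b<?r. lookup (diff koszul (Suc i) (kix \<sigma>) b * lookup u b) m)"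
      using True less by (simp add: toc_def lookup_bdry lookup_sum rk_koszul del: bdry.simps)
    also have "\<dots> = (\<Sum>b<?r. \<Sum>v | v \<in> - \<sigma> \<and> insert v \<sigma> = kenum (Suc i) b. ?t v b)"
    proof (rule sum.cong[OF refl])
      fix b
      have "diff koszul (Suc i) (kix \<sigma>) b * lookup u b
          = (\<Sum>v\<in>?V b. ksgn v \<sigma> * (var v * lookup u b))"
        unfolding diff by (simp add: sum_distrib_right mult.assoc)
      then show "lookup (diff koszul (Suc i) (kix \<sigma>) b * lookup u b) m
          = (\<Sum>v | v \<in> - \<sigma> \<and> insert v \<sigma> = kenum (Suc i) b. ?t v b)"
        by (simp only: lookup_sum lookup_ksgn_mult lookup_var_mult Compl_iff)
    qed
    also have "\<dots> = (\<Sum>v\<in>- \<sigma>. \<Sum>b | b \<in> {..<?r} \<and> insert v \<sigma> = kenum (Suc i) b. ?t v b)"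
      by (rule sum.swap_restrict) auto
    also have "\<dots> = (\<Sum>v\<in>- \<sigma>. ?t v (kix (insert v \<sigma>)))"
    proof (rule sum.cong[OF refl])
      fix v assume "v \<in> - \<sigma>"
      then have c: "card (insert v \<sigma>) = Suc i" using True by simp
      have "{b. b \<in> {..<?r} \<and> insert v \<sigma> = kenum (Suc i) b} = {kix (insert v \<sigma>)}"
        using kix_less[of "insert v \<sigma>"] kenum_kix[of "insert v \<sigma>"] c by (auto simp: kix_kenum)
      then show "(\<Sum>b | b \<in> {..<?r} \<and> insert v \<sigma> = kenum (Suc i) b. ?t v b) = ?t v (kix (insert v \<sigma>))"
        by simp
    qed
    also have "\<dots> = (\<Sum>v | v \<notin> \<sigma> \<and> lookup m v \<ge> 1. ?t v (kix (insert v \<sigma>)))"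
      by (rule sum.mono_neutral_right) auto
    also have "\<dots> = kbd (toc (Suc i) u) (m, \<sigma>)"
      unfolding kbd_def split by (rule sum.cong) (auto simp: toc_def True)
    finally show ?thesis .
  qed
qed

lemma toc_inj:
  fixes u :: "nat \<Rightarrow>\<^sub>0 ('n::finite, 'k::field) mpoly"
  assumes "keys u \<subseteq> {..<rk (koszul :: ('n, 'k) free_seq) i}" "toc i u = 0"
  shows "u = 0"
proof (rule poly_mapping_eqI)
  fix b
  show "lookup u b = lookup 0 b"
  proof (cases "b < card {\<sigma> :: 'n set. card \<sigma> = i}")
    case True
    have "lookup (lookup u b) m = 0" for m
      using fun_cong[OF assms(2), of "(m, kenum i b)"] kenum_card[OF True] kix_kenum[OF True]
      by (simp add: toc_def)
    then show ?thesis by (intro poly_mapping_eqI) simp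
  next
    case False
    then show ?thesis using assms(1) by (auto simp: rk_koszul in_keys_iff subset_iff)
  qed
qed

lemma toc_add: "toc i (u + w) = toc i u + toc i w"
  by (auto simp: toc_def fun_eq_iff lookup_add)

lemma toc_diff: "toc i (u - w) = toc i u - toc i w"
  by (auto simp: toc_def fun_eq_iff lookup_minus)

lemma toc_kscale: "toc i (kscale c u) = fscale c (toc i u)"
proof -
  have "lookup (const c * g) m = c * lookup g m" for g :: "('a, 'b) mpoly" and m
    unfolding const_def lookup_single_mult by (simp add: up_def)
  then show ?thesis by (auto simp: toc_def fscale_def kscale_smul fun_eq_iff)
qed

lemma linear_toc:
  "Vector_Spaces.linear kscale fscale (toc i :: (nat \<Rightarrow>\<^sub>0 ('n::finite, 'k::field) mpoly) \<Rightarrow> _)"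
  by (intro Vector_Spaces.linear.intro module_hom.intro module_hom_axioms.intro
      vector_space_kscale vector_space_fscale
      vector_space_kscale[unfolded module_iff_vector_space[symmetric]]
      vector_space_fscale[unfolded module_iff_vector_space[symmetric]] toc_add toc_kscale)

lemma strand_iff_toc:
  fixes u :: "nat \<Rightarrow>\<^sub>0 ('n::finite, 'k::field) mpoly"
  assumes "keys u \<subseteq> {..<rk (koszul :: ('n, 'k) free_seq) i}"
  shows "u \<in> strandI koszul (supported M) i (int j) \<longleftrightarrow> toc i u \<in> kch M i j"
proof
  assume u: "u \<in> strandI koszul (supported M) i (int j)"
  show "toc i u \<in> kch M i j"
  proof (rule kchI)
    fix m \<sigma> assume nz: "toc i u (m, \<sigma>) \<noteq> 0"
    then have c: "card \<sigma> = i" and m: "m \<in> keys (lookup u (kix \<sigma>))"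
      by (auto simp: toc_def in_keys_iff split: if_splits)
    have "lookup u (kix \<sigma>) \<in> supported M \<inter> hom_poly (int j - int i)"
      using u kix_less[of \<sigma>] c unfolding strand_def by (auto simp: rk_koszul shift_koszul)
    then have "m \<in> M" "int (mdeg m) = int j - int i" using m by (auto simp: supported_def hom_poly_def)
    then show "m \<in> M \<and> card \<sigma> = i \<and> mdeg m + i = j" using c by linarith
  qed
next
  assume t: "toc i u \<in> kch M i j"
  show "u \<in> strandI koszul (supported M) i (int j)"
  proof (rule strandI_I)
    fix b assume "b < rk (koszul :: ('n, 'k) free_seq) i"
    then have b: "b < card {\<sigma> :: 'n set. card \<sigma> = i}" by (simp add: rk_koszul)
    have "m \<in> M \<and> int (mdeg m) = int j - int i" if "m \<in> keys (lookup u b)" for m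
    proof -
      have "toc i u (m, kenum i b) \<noteq> 0"
        using that kenum_card[OF b] kix_kenum[OF b] by (simp add: toc_def in_keys_iff)
      then have "m \<in> M" "mdeg m + i = j" using kchD[OF t] by auto
      then show ?thesis by linarith
    qed
    then show "lookup u b \<in> supported M \<inter> hom_poly (int j - shift koszul i b)"
      by (auto simp: supported_def hom_poly_def shift_koszul)
  next
    fix b assume "rk (koszul :: ('n, 'k) free_seq) i \<le> b"
    then show "lookup u b = 0" using assms by (auto simp: in_keys_iff subset_iff)
  qed
qed

lemma toc_surj:
  fixes f :: "'n::finite cell \<Rightarrow> 'k::field"
  assumes f: "f \<in> kch M i j"
  obtains u where "u \<in> strandI koszul (supported M) i (int j)" "toc i u = f"
proof -
  let ?r = "card {\<sigma> :: 'n set. card \<sigma> = i}"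
  define p where "p \<sigma> = (Abs_poly_mapping (\<lambda>m. f (m, \<sigma>)) :: ('n, 'k) mpoly)" for \<sigma>
  have p: "lookup (p \<sigma>) m = f (m, \<sigma>)" for \<sigma> m
  proof -
    have "{m. f (m, \<sigma>) \<noteq> 0} \<subseteq> {m. mdeg m \<le> j}" using kchD[OF f] by fastforce
    then have "finite {m. f (m, \<sigma>) \<noteq> 0}" using finite_mdeg by (rule finite_subset)
    then show ?thesis unfolding p_def by (simp add: lookup_Abs_poly_mapping)
  qed
  define u where "u = (\<Sum>b<?r. single b (p (kenum i b)))"
  have u: "lookup u b = (if b < ?r then p (kenum i b) else 0)" for b
    by (simp add: u_def lookup_sum lookup_single when_def)
  have keys: "keys u \<subseteq> {..<rk (koszul :: ('n, 'k) free_seq) i}"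
    using u by (auto simp: in_keys_iff rk_koszul split: if_splits)
  have t: "toc i u = f"
  proof (rule ext, clarify)
    fix m \<sigma>
    show "toc i u (m, \<sigma>) = f (m, \<sigma>)"
    proof (cases "card \<sigma> = i")
      case True
      then show ?thesis using kix_less[of \<sigma>] kenum_kix[of \<sigma>] by (simp add: toc_def u p)
    next
      case False
      then have "f (m, \<sigma>) = 0" using kchD[OF f] by blast
      then show ?thesis using False by (simp add: toc_def)
    qed
  qed
  show thesis
    by (rule that[of u]) (use strand_iff_toc[OF keys, of M j] t f in simp_all)
qed

lemma bdry_keys: "keys (bdry koszul (*) (Suc i) u) \<subseteq> {..<rk (koszul :: ('n::finite, 'k::field) free_seq) i}"
  for u :: "nat \<Rightarrow>\<^sub>0 ('n::finite, 'k::field) mpoly"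
  by (auto simp: in_keys_iff lookup_bdry simp del: bdry.simps split: if_splits)

lemma bdry_zero_iff: "bdry koszul (*) (Suc i) u = 0 \<longleftrightarrow> kbd (toc (Suc i) u) = 0"
proof -
  have toc0: "toc i 0 = 0" by (rule ext) (auto simp: toc_def)
  show ?thesis
  proof
    assume "bdry koszul (*) (Suc i) u = 0"
    then have "toc i (bdry koszul (*) (Suc i) u) = toc i 0" by (rule arg_cong)
    then show "kbd (toc (Suc i) u) = 0" by (simp only: toc_bdry toc0)
  next
    assume "kbd (toc (Suc i) u) = 0"
    then show "bdry koszul (*) (Suc i) u = 0"
      by (intro toc_inj[OF bdry_keys]) (simp only: toc_bdry)
  qed
qed

text \<open>In a nonzero multidegree, divide by any variable that occurs in it.\<close>

lemma koszul_exact: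
  fixes f :: "'n::finite cell \<Rightarrow> 'k::field"
  assumes f: "f \<in> kch UNIV i j" "kbd f = 0" "f (0, {}) = 0"
  obtains y where "y \<in> kch UNIV (Suc i) j" "kbd y = f"
proof -
  define \<chi> where "\<chi> a = (SOME v. a v \<ge> (1::nat))" for a :: "'n \<Rightarrow> nat"
  have "kh \<chi> f \<in> kch UNIV (Suc i) j" by (rule kh_kch[OF f(1)]) simp
  moreover have "kbd (kh \<chi> f) = f"
  proof (rule ext, clarify)
    fix m \<sigma>
    show "kbd (kh \<chi> f) (m, \<sigma>) = f (m, \<sigma>)"
    proof (cases "\<exists>v. mdgr m \<sigma> v \<ge> 1")
      case True
      then have "mdgr m \<sigma> (\<chi> (mdgr m \<sigma>)) \<ge> 1" unfolding \<chi>_def by (rule someI_ex)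
      then show ?thesis using koszul_homotopy[of m \<sigma> \<chi> f] f(2) by (simp add: kh_zero)
    next
      case False
      then have z: "mdgr m \<sigma> v = 0" for v by (simp add: not_le One_nat_def)
      have "v \<notin> \<sigma>" "lookup m v = 0" for v
        using z[of v] by (auto simp: mdgr_def split: if_splits)
      then have s: "\<sigma> = {}" "m = 0" by (auto intro!: poly_mapping_eqI)
      have "kbd (kh \<chi> f) (m, \<sigma>) = 0" unfolding s kbd_def by simp
      then show ?thesis using f(3) s by simp
    qed
  qed
  ultimately show thesis by (rule that)
qed

lemma lookup_mult_zero:
  fixes f g :: "('n, 'k::comm_ring_1) mpoly"
  shows "lookup (f * g) 0 = lookup f 0 * lookup g 0"
proof -
  have "0 = l + q \<longleftrightarrow> l = 0 \<and> q = 0" for l q :: "'n \<Rightarrow>\<^sub>0 nat"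
    unfolding add_eq_iff_minus by (auto simp: up_def poly_mapping_eq_iff fun_eq_iff lookup_minus)
  then have "(\<Sum>q. lookup g q when 0 = l + q) = (lookup g 0 when l = 0)"
    for l :: "'n \<Rightarrow>\<^sub>0 nat"
    by (cases "l = 0") simp_all
  then show ?thesis by (simp add: lookup_mult mult_when)
qed

lemma module_residue: "module (residue_scale :: ('n, 'k::field) mpoly \<Rightarrow> 'k \<Rightarrow> 'k)"
  by unfold_locales (simp_all add: residue_scale_def lookup_add lookup_mult_zero algebra_simps)

lemma strand_negative:
  assumes "J < 0" "u \<in> strandI koszul I i J"
  shows "u = 0"
proof (rule poly_mapping_eqI)
  fix b
  show "lookup u b = lookup 0 b"
  proof (cases "b < rk (koszul :: ('a, 'b) free_seq) i")
    case True
    then have "lookup u b \<in> hom_poly (J - int i)"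
      using assms(2) unfolding strand_def by (auto simp: shift_koszul)
    then have "keys (lookup u b) = {}" using assms(1) by (fastforce simp: hom_poly_def)
    then show ?thesis by simp
  next
    case False
    then show ?thesis using strandI_zeros[OF assms(2)] by simp
  qed
qed

lemma supported_UNIV: "supported UNIV = UNIV"
  by (simp add: supported_def)

lemma aug_koszul: "aug residue_scale koszul (\<lambda>_. 1) u = toc 0 u (0, {})"
  for u :: "nat \<Rightarrow>\<^sub>0 ('n::finite, 'k::field) mpoly"
proof -
  have "{\<sigma> :: 'n set. card \<sigma> = 0} = {{}}" by auto
  then have r: "card {\<sigma> :: 'n set. card \<sigma> = 0} = Suc 0" by simp
  then have "kix ({} :: 'n set) = 0" using kix_less[of "{} :: 'n set"] by simp
  then show ?thesis by (simp add: aug_def rk_koszul r toc_def residue_scale_def lessThan_Suc)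
qed

lemma koszul_resolves:
  "resolves (koszul :: ('n::finite, 'k::field) free_seq) residue_scale residue_piece (\<lambda>_. 1)"
proof -
  let ?F = "koszul :: ('n, 'k) free_seq"
  have upU: "upclosed (UNIV :: ('n \<Rightarrow>\<^sub>0 nat) set)" by (simp add: upclosed_def)
  have iff: "u \<in> strandI ?F UNIV i (int j) \<longleftrightarrow> toc i u \<in> kch UNIV i j"
    if "keys u \<subseteq> {..<rk ?F i}" for u i j
    using strand_iff_toc[OF that, of UNIV j] by (simp only: supported_UNIV)
  have surj: "\<exists>u. u \<in> strandI ?F UNIV i (int j) \<and> toc i u = f" if "f \<in> kch UNIV i j" for f i j
    using toc_surj[OF that] by (metis supported_UNIV)
  have bdry_in: "bdry ?F (*) (Suc i) u \<in> strandI ?F UNIV i (int j)"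
    if "u \<in> strandI ?F UNIV (Suc i) (int j)" for u i j
  proof -
    have "toc (Suc i) u \<in> kch UNIV (Suc i) j" using that iff[OF strandI_keys[OF that]] by blast
    then have "kbd (toc (Suc i) u) \<in> kch UNIV i j" by (rule kbd_kch[OF upU])
    then show ?thesis unfolding iff[OF bdry_keys] toc_bdry .
  qed
  have zero_in: "0 \<in> bdry ?F (*) (Suc i) ` strandI ?F UNIV (Suc i) J" for i J
    by (rule image_eqI[of _ _ 0]) (simp_all only: slin_zero[OF slin_bdry] strandI_zero[OF is_ideal_UNIV])
  have lift: "u \<in> bdry ?F (*) (Suc i) ` strandI ?F UNIV (Suc i) (int j)"
    if u: "u \<in> strandI ?F UNIV i (int j)" and cyc: "kbd (toc i u) = 0" "toc i u (0, {}) = 0" for u i j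
  proof -
    have "toc i u \<in> kch UNIV i j" using u iff[OF strandI_keys[OF u]] by blast
    then obtain y where y: "y \<in> kch UNIV (Suc i) j" "kbd y = toc i u"
      by (rule koszul_exact[OF _ cyc])
    obtain w where w: "w \<in> strandI ?F UNIV (Suc i) (int j)" "toc (Suc i) w = y" using surj[OF y(1)] by blast
    have "toc i (bdry ?F (*) (Suc i) w - u) = 0" unfolding toc_diff toc_bdry w(2) y(2) by simp
    moreover have "keys (bdry ?F (*) (Suc i) w - u) \<subseteq> {..<rk ?F i}"
      by (rule strandI_keys[OF strandI_minus[OF is_ideal_UNIV bdry_in[OF w(1)] u]])
    ultimately have "bdry ?F (*) (Suc i) w - u = 0" using toc_inj by blast
    then have "u = bdry ?F (*) (Suc i) w" by (simp only: right_minus_eq)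
    then show ?thesis using w(1) by (rule image_eqI)
  qed
  show ?thesis
    unfolding resolves_def
  proof (intro conjI allI impI ballI)
    fix i b assume "b < rk ?F (Suc i)"
    then show "bdry ?F (*) (Suc i) (unit b) \<in> strandI ?F UNIV i (shift ?F (Suc i) b)"
      unfolding shift_koszul using bdry_in[of "unit b" i "Suc i"] unit_strand[of b ?F "Suc i"]
      unfolding shift_koszul by blast
  next
    fix i J u assume u: "u \<in> strandI ?F UNIV (Suc i) J"
    show "bdry ?F (*) (Suc i) u = 0 \<longleftrightarrow> u \<in> bdry ?F (*) (Suc (Suc i)) ` strandI ?F UNIV (Suc (Suc i)) J"
    proof (cases "J < 0")
      case True
      then have "u = 0" using strand_negative u by blast
      then show ?thesis using zero_in by (simp only: slin_zero[OF slin_bdry] simp_thms)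
    next
      case False
      then obtain j where J: "J = int j" by (meson nonneg_int_cases not_le)
      show ?thesis
      proof
        assume "bdry ?F (*) (Suc i) u = 0"
        then show "u \<in> bdry ?F (*) (Suc (Suc i)) ` strandI ?F UNIV (Suc (Suc i)) J"
          unfolding J bdry_zero_iff by (intro lift u[unfolded J]) (simp_all add: toc_def)
      next
        assume "u \<in> bdry ?F (*) (Suc (Suc i)) ` strandI ?F UNIV (Suc (Suc i)) J"
        then obtain w where w: "u = bdry ?F (*) (Suc (Suc i)) w" by blast
        show "bdry ?F (*) (Suc i) u = 0" unfolding bdry_zero_iff w toc_bdry by (rule kbd_kbd)
      qed
    qed
  next
    fix b show "(1 :: 'k) \<in> residue_piece (shift ?F 0 b)" by (simp add: shift_koszul residue_piece_def)
  next
    fix J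
    show "aug residue_scale ?F (\<lambda>_. 1) ` strandI ?F UNIV 0 J = residue_piece J"
    proof (cases "J = 0")
      case True
      have "c \<in> aug residue_scale ?F (\<lambda>_. 1) ` strandI ?F UNIV 0 J" for c :: 'k
      proof -
        define f where "f = (\<lambda>x :: 'n cell. if x = (0, {}) then c else 0)"
        have "f \<in> kch UNIV 0 0" by (rule kchI) (auto simp: f_def mdeg_def split: if_splits)
        then obtain u where "u \<in> strandI ?F UNIV 0 (int 0)" "toc 0 u = f" using surj by blast
        then show ?thesis using True by (intro image_eqI[of _ _ u]) (simp_all add: aug_koszul f_def)
      qed
      then have "UNIV = aug residue_scale ?F (\<lambda>_. 1) ` strandI ?F UNIV 0 J" by (rule UNIV_eq_I)
      then show ?thesis using True by (simp only: residue_piece_def if_True simp_thms)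
    next
      case False
      have "aug residue_scale ?F (\<lambda>_. 1) u = 0" if u: "u \<in> strandI ?F UNIV 0 J" for u
      proof -
        have "lookup u (kix ({} :: 'n set)) \<in> hom_poly J"
          using strandI_lookup[OF is_ideal_UNIV u] by (simp add: shift_koszul)
        then have "0 \<notin> keys (lookup u (kix ({} :: 'n set)))"
          using False by (auto simp: hom_poly_def mdeg_def)
        then show ?thesis by (simp add: aug_koszul toc_def in_keys_iff)
      qed
      moreover have "0 \<in> strandI ?F UNIV 0 J" by (rule strandI_zero[OF is_ideal_UNIV])
      ultimately have "aug residue_scale ?F (\<lambda>_. 1) ` strandI ?F UNIV 0 J = {0}" by (auto intro!: image_eqI)
      then show ?thesis using False by (simp add: residue_piece_def)
    qed
  next
    fix J u assume u: "u \<in> strandI ?F UNIV 0 J"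
    show "aug residue_scale ?F (\<lambda>_. 1) u = 0 \<longleftrightarrow> u \<in> bdry ?F (*) (Suc 0) ` strandI ?F UNIV (Suc 0) J"
    proof (cases "J < 0")
      case True
      then have "u = 0" using strand_negative u by blast
      then show ?thesis using zero_in by (simp only: aug_koszul) (simp add: toc_def)
    next
      case False
      then obtain j where J: "J = int j" by (meson nonneg_int_cases not_le)
      show ?thesis
      proof
        assume "aug residue_scale ?F (\<lambda>_. 1) u = 0"
        moreover have "kbd (toc 0 u) = 0"
          by (rule kbd_kch_0) (use u iff[OF strandI_keys[OF u]] J in blast)
        ultimately show "u \<in> bdry ?F (*) (Suc 0) ` strandI ?F UNIV (Suc 0) J"
          unfolding J aug_koszul by (intro lift u[unfolded J])
      next
        assume "u \<in> bdry ?F (*) (Suc 0) ` strandI ?F UNIV (Suc 0) J"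
        then obtain w where w: "u = bdry ?F (*) (Suc 0) w" by blast
        show "aug residue_scale ?F (\<lambda>_. 1) u = 0"
          unfolding aug_koszul w toc_bdry by (simp add: kbd_def)
      qed
    qed
  qed
qed

section \<open>Betti numbers of monomial ideals\<close>

text \<open>
  The definition picks an arbitrary resolution of the residue field; the comparison in both directions
  replaces it by the Koszul complex.
\<close>

lemma graded_betti_koszul:
  assumes I: "is_ideal (I :: ('n::finite, 'k::field) mpoly set)"
  shows "graded_betti I i j = homology_dim koszul (*) (\<lambda>d. I \<inter> hom_poly d) i (int j)"
proof -
  define F :: "('n, 'k) free_seq" where "F = (SOME F. graded_free_resolution F residue_scale residue_piece)"
  have "graded_free_resolution (koszul :: ('n, 'k) free_seq) residue_scale residue_piece"
    unfolding graded_free_resolution_iff by (rule exI, rule koszul_resolves)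
  then have "graded_free_resolution F residue_scale residue_piece" unfolding F_def by (rule someI)
  then obtain g where g: "resolves F residue_scale residue_piece g" unfolding graded_free_resolution_iff by blast
  show ?thesis
    unfolding graded_betti_def tor_dim_def F_def[symmetric]
    by (rule antisym; rule homology_dim_le[OF _ _ module_residue I]; rule g koszul_resolves)
qed

lemma graded_betti_supported:
  fixes M :: "('n::finite \<Rightarrow>\<^sub>0 nat) set"
  assumes "upclosed M"
  shows "graded_betti (supported M :: ('n, 'k::field) mpoly set) i j
    = fs.dim {f \<in> kch M i j. kbd f = (0 :: 'n cell \<Rightarrow> 'k)} - fs.dim (kbd ` kch M (Suc i) j :: ('n cell \<Rightarrow> 'k) set)"
proof -
  let ?F = "koszul :: ('n, 'k) free_seq" and ?I = "supported M :: ('n, 'k) mpoly set"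
  interpret V: vector_space "kscale :: 'k \<Rightarrow> (nat \<Rightarrow>\<^sub>0 ('n, 'k) mpoly) \<Rightarrow> _" by (rule vector_space_kscale)
  have I: "is_ideal ?I" by (rule supported_ideal[OF assms])
  let ?Z = "{u \<in> strandI ?F ?I i (int j). bdry ?F (*) i u = 0}"
  let ?B = "bdry ?F (*) (Suc i) ` strandI ?F ?I (Suc i) (int j)"
  have sub_strand: "V.subspace (strandI ?F ?I i (int j))" for i
    unfolding V.subspace_def kscale_smul
    using strandI_zero[OF I] strandI_add[OF I] strandI_const_smul[OF I] by blast
  have subZ: "V.subspace ?Z"
    using sub_strand[of i] unfolding V.subspace_def kscale_smul
    by (auto simp: slin_zero[OF slin_bdry] slin_add[OF slin_bdry] slin_smul[OF slin_bdry] smul_simps)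
  have subB: "V.subspace ?B"
    by (rule module_hom.subspace_image[OF Vector_Spaces.linear.axioms(3)[OF linear_kscale[OF slin_bdry]] sub_strand])
  have B_strand: "?B \<subseteq> strandI ?F ?I i (int j)"
    using bdry_strandI[OF koszul_resolves module_residue I] by blast
  obtain T where T: "finite T" "strandI ?F ?I i (int j) \<subseteq> V.span T" by (rule strandI_finite_dim)
  have strand: "toc i ` strandI ?F ?I i (int j) = kch M i j" for i
  proof (intro equalityI subsetI)
    fix f assume "f \<in> toc i ` strandI ?F ?I i (int j)"
    then obtain u where u: "f = toc i u" "u \<in> strandI ?F ?I i (int j)" by blast
    then show "f \<in> kch M i j" using strand_iff_toc[OF strandI_keys[OF u(2)]] by blast
  next
    fix f :: "'n cell \<Rightarrow> 'k" assume "f \<in> kch M i j"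
    then obtain u where "u \<in> strandI ?F ?I i (int j)" "toc i u = f" by (rule toc_surj)
    then show "f \<in> toc i ` strandI ?F ?I i (int j)" by blast
  qed
  have inj: "u = 0" if "u \<in> strandI ?F ?I i (int j)" "toc i u = 0" for u
    by (rule toc_inj[OF strandI_keys[OF that(1)] that(2)])
  have zero_iff: "bdry ?F (*) i u = 0 \<longleftrightarrow> kbd (toc i u) = 0" if "u \<in> strandI ?F ?I i (int j)" for u
  proof (cases i)
    case 0
    have "toc 0 u \<in> kch M 0 j" using strand that 0 by blast
    then show ?thesis using 0 kbd_kch_0[of "toc 0 u"] by simp
  next
    case (Suc i')
    then show ?thesis using bdry_zero_iff[of i' u] by (simp del: bdry.simps)
  qed
  have "fs.dim (toc i ` ?Z) = V.dim ?Z"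
    by (rule dim_inj_image[OF linear_toc subZ _ T(1)]) (use T(2) inj in auto)
  moreover have "toc i ` ?Z = {f \<in> kch M i j. kbd f = 0}"
    unfolding strand[symmetric] using zero_iff by blast
  moreover have "fs.dim (toc i ` ?B) = V.dim ?B"
    by (rule dim_inj_image[OF linear_toc subB _ T(1)]) (use T(2) B_strand inj in blast)+
  moreover have "toc i ` ?B = kbd ` kch M (Suc i) j"
    unfolding strand[symmetric] image_image toc_bdry ..
  ultimately show ?thesis
    unfolding graded_betti_koszul[OF I] homology_dim_def Let_def by simp
qed

lemma graded_betti_field_independent:
  fixes M :: "('n::finite \<Rightarrow>\<^sub>0 nat) set"
  assumes "upclosed M" "cycles_lift TYPE('a::field) M" "cycles_lift TYPE('b::field) M"
  shows "graded_betti (supported M :: ('n, 'a) mpoly set) i j = graded_betti (supported M :: ('n, 'b) mpoly set) i j"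
  unfolding graded_betti_supported[OF assms(1)]
  using dim_cycles_rat[OF assms(1,2)] dim_cycles_rat[OF assms(1,3)] by simp

theorem corollary4p7:
  fixes E :: "'n::finite set set" and k i j :: nat
  assumes "simple_graph E" and "k \<ge> 1"
  shows "graded_betti (ideal_power (comp_edge_ideal E :: ('n, 'a::field) mpoly set) k) i j =
         graded_betti (ideal_power (comp_edge_ideal E :: ('n, 'b::field) mpoly set) k) i j"
  unfolding ideal_power_supported
  by (intro graded_betti_field_independent upclosed_multi_edge_monomials
      multi_edge_monomials_cycles_lift assms)

end
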